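(* There exist two families $C^0_{j,l}$ and $C^1_{j,l}$ ($j,l\in\mathbb{Z}_{\ge 0}$) of $\gamma$-local bilinear operators on $C^\infty(\mathbb{R}^2)$, not depending on $k$, such that: (1) if $a_1,a_2\in\operatorname{Poly}(\mathbb{R}^2)$ are polynomials of degrees $(m_1,n_1)$ and $(m_2,n_2)$, then $C^0_{j,l}(a_1,a_2)$ and $C^1_{j,l}(a_1,a_2)$ are again polynomials, of degree $(m_1+m_2-j,\,n_1+n_2-j)$; here a polynomial in $(x,p)$ is said to be of degree $(m,n)$ if it has degree at most $m$ in $x$ and at most $n$ in $p$ (and it is $0$ if $m<0$ or $n<0$); (2) $C^0_{j,l}=0$ and $C^1_{j,l}=0$ whenever $l>j$; (3) for all polynomials $a_1(x,p),a_2(x,p)$ and every real $k\ge 0$, $$\operatorname{Op}_k(a_1)\circ\operatorname{Op}_k(a_2)=\sum_{j,l}k^l\Big(\operatorname{Op}_k\big(C^0_{j,l}(a_1,a_2)\big)+\operatorname{Op}_k\big(C^1_{j,l}(a_1,a_2)\big)\circ\hat\gamma\Big)$$ as operators on $\mathcal{S}(\mathbb{R})$ (for given $a_1,a_2$ the sum is finite).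
   Context: $C^\infty(\mathbb{R}^2)$ is the space of complex valued smooth functions of $(x,p)\in\mathbb{R}^2$, $\operatorname{Poly}(\mathbb{R}^2)$ the complex polynomials in $x,p$, and $\mathcal{S}(\mathbb{R})$ the Schwartz space. For real $k\ge 0$ the Dunkl operator is $T_k(f)(x)=f'(x)+k\frac{f(x)-f(-x)}{x}$. For $\lambda\in\mathbb{C}$, the Dunkl kernel $x\mapsto E_k(x,-i\lambda)$ is the unique solution $u$ of $T_k u=-i\lambda u$, $u(0)=1$. Let $d\mu_k(x)=\frac{|x|^{2k}}{2^{k+1/2}\Gamma(k+1/2)}dx$ on $\mathbb{R}$. The Dunkl transform is $\mathcal{F}_k(f)(\lambda)=\int_{\mathbb{R}}E_k(y,-i\lambda)f(y)\,d\mu_k(y)$; it maps $\mathcal{S}(\mathbb{R})$ to itself. For a polynomial $a(x,p)$, $\operatorname{Op}_k(a)$ is the linear operator on $\mathcal{S}(\mathbb{R})$ defined by $\operatorname{Op}_k(a)(f)(x)=\int_{\mathbb{R}}a(x,p)E_k(x,ip)\mathcal{F}_k(f)(p)\,d\mu_k(p)$. The operator $\hat\gamma$ is $(\hat\gamma f)(x)=f(-x)$. A multilinear operator $D$ on $C^\infty(\mathbb{R}^2)$ (with values in $C^\infty(\mathbb{R}^2)$) is called $\gamma$-local if for all $f_1,\dots,f_r$ and every $(x,p)$, the value $D(f_1,\dots,f_r)(x,p)$ is determined by finitely many jets (partial derivatives up to some finite order) of $f_1,\dots,f_r$ at the four points $(x,p),(-x,p),(x,-p),(-x,-p)$. *)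

theory Defs
  imports "HOL-Analysis.Analysis"
begin

section \<open>Smooth functions of two variables\<close>

definition partial_x :: "(real \<times> real \<Rightarrow> complex) \<Rightarrow> real \<times> real \<Rightarrow> complex" where
  "partial_x f = (\<lambda>(x, p). vector_derivative (\<lambda>t. f (t, p)) (at x))"

definition partial_p :: "(real \<times> real \<Rightarrow> complex) \<Rightarrow> real \<times> real \<Rightarrow> complex" where
  "partial_p f = (\<lambda>(x, p). vector_derivative (\<lambda>t. f (x, t)) (at p))"

primrec C_n :: "nat \<Rightarrow> (real \<times> real \<Rightarrow> complex) \<Rightarrow> bool" where
  "C_n 0 f \<longleftrightarrow> continuous_on UNIV f"
| "C_n (Suc n) f \<longleftrightarrow>
     (\<forall>x p. (\<lambda>t. f (t, p)) differentiable (at x) \<and> (\<lambda>t. f (x, t)) differentiable (at p)) \<and>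
     C_n n (partial_x f) \<and> C_n n (partial_p f)"

definition C_infinity :: "(real \<times> real \<Rightarrow> complex) set" where
  "C_infinity = {f. \<forall>n. C_n n f}"

text \<open>Polynomials are regarded as elements of \<open>C_infinity\<close>. The bidegree consists of
  integers; if one of them is negative, the sum is empty and the polynomial is zero.\<close>

definition has_bidegree :: "(real \<times> real \<Rightarrow> complex) \<Rightarrow> int \<Rightarrow> int \<Rightarrow> bool" where
  "has_bidegree a m n \<longleftrightarrow> (\<exists>c :: nat \<Rightarrow> nat \<Rightarrow> complex.
     a = (\<lambda>(x, p). \<Sum>i | int i \<le> m. \<Sum>j | int j \<le> n. c i j * of_real x ^ i * of_real p ^ j))"

definition Poly2 :: "(real \<times> real \<Rightarrow> complex) set" where
  "Poly2 = {a. \<exists>m n. has_bidegree a m n}"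

section \<open>Local bilinear operators\<close>

type_synonym bioperator =
  "(real \<times> real \<Rightarrow> complex) \<Rightarrow> (real \<times> real \<Rightarrow> complex) \<Rightarrow> real \<times> real \<Rightarrow> complex"

text \<open>Only the values on \<open>C_infinity\<close> are constrained; the values of a \<open>bioperator\<close> elsewhere
  carry no meaning.\<close>

definition bilinear_operator :: "bioperator \<Rightarrow> bool" where
  "bilinear_operator D \<longleftrightarrow>
     (\<forall>f\<in>C_infinity. \<forall>g\<in>C_infinity. D f g \<in> C_infinity) \<and>
     (\<forall>f\<in>C_infinity. \<forall>f'\<in>C_infinity. \<forall>g\<in>C_infinity. \<forall>c c'.
        D (\<lambda>z. c * f z + c' * f' z) g = (\<lambda>z. c * D f g z + c' * D f' g z)) \<and>
     (\<forall>f\<in>C_infinity. \<forall>g\<in>C_infinity. \<forall>g'\<in>C_infinity. \<forall>c c'.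
        D f (\<lambda>z. c * g z + c' * g' z) = (\<lambda>z. c * D f g z + c' * D f g' z))"

definition same_jet :: "nat \<Rightarrow> real \<times> real \<Rightarrow> (real \<times> real \<Rightarrow> complex) \<Rightarrow> (real \<times> real \<Rightarrow> complex) \<Rightarrow> bool"
  where
  "same_jet N z f g \<longleftrightarrow>
     (\<forall>i j. i + j \<le> N \<longrightarrow> (partial_x ^^ i) ((partial_p ^^ j) f) z = (partial_x ^^ i) ((partial_p ^^ j) g) z)"

text \<open>The order \<open>N\<close> may depend on the point \<open>(x, p)\<close>. For bilinear operators, letting it also
  depend on the arguments would give the same notion.\<close>

definition gamma_local :: "bioperator \<Rightarrow> bool" where
  "gamma_local D \<longleftrightarrow> (\<forall>x p. \<exists>N.
     \<forall>f\<in>C_infinity. \<forall>g\<in>C_infinity. \<forall>f'\<in>C_infinity. \<forall>g'\<in>C_infinity.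
       (\<forall>z\<in>{(x, p), (- x, p), (x, - p), (- x, - p)}. same_jet N z f f' \<and> same_jet N z g g') \<longrightarrow>
       D f g (x, p) = D f' g' (x, p))"

section \<open>Dunkl analysis on the real line\<close>

abbreviation vderiv :: "(real \<Rightarrow> complex) \<Rightarrow> real \<Rightarrow> complex" where
  "vderiv f \<equiv> \<lambda>x. vector_derivative f (at x)"

definition schwartz :: "(real \<Rightarrow> complex) set" where
  "schwartz = {f. (\<forall>n x. (vderiv ^^ n) f differentiable (at x)) \<and>
     (\<forall>m n. bounded (range (\<lambda>x. of_real x ^ m * (vderiv ^^ n) f x)))}"

text \<open>At \<open>x = 0\<close> the difference quotient is read as its limit, which is twice the derivative.\<close>

definition dunkl_T :: "real \<Rightarrow> (real \<Rightarrow> complex) \<Rightarrow> real \<Rightarrow> complex" where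
  "dunkl_T k f x = vderiv f x +
     of_real k * (if x = 0 then 2 * vderiv f 0 else (f x - f (- x)) / of_real x)"

definition dunkl_E :: "real \<Rightarrow> real \<Rightarrow> complex \<Rightarrow> complex" where
  "dunkl_E k x w = (THE u. (\<forall>y. u differentiable (at y)) \<and>
     (\<forall>y. dunkl_T k u y = w * u y) \<and> u 0 = 1) x"

text \<open>For \<open>k = 0\<close> the density vanishes at the origin, since \<open>0 powr 0 = 0\<close>; this is a null set.\<close>

definition dunkl_measure :: "real \<Rightarrow> real measure" where
  "dunkl_measure k = density lborel
     (\<lambda>x. ennreal (\<bar>x\<bar> powr (2 * k) / (2 powr (k + 1/2) * Gamma (k + 1/2))))"

definition dunkl_transform :: "real \<Rightarrow> (real \<Rightarrow> complex) \<Rightarrow> real \<Rightarrow> complex" where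
  "dunkl_transform k f \<xi> =
     (LINT y|dunkl_measure k. dunkl_E k y (- (\<i> * of_real \<xi>)) * f y)"

definition Op :: "real \<Rightarrow> (real \<times> real \<Rightarrow> complex) \<Rightarrow> (real \<Rightarrow> complex) \<Rightarrow> real \<Rightarrow> complex" where
  "Op k a f x =
     (LINT p|dunkl_measure k. a (x, p) * dunkl_E k x (\<i> * of_real p) * dunkl_transform k f p)"

definition gamma_hat :: "(real \<Rightarrow> complex) \<Rightarrow> real \<Rightarrow> complex" where
  "gamma_hat f x = f (- x)"

end

theory Submission
  imports Defs
begin

text \<open>
  Write \<open>P = - \<i> T\<^sub>k\<close> for the Dunkl momentum and \<open>\<gamma>\<close> for the reflection. By inversion of the Dunkl
  transform, \<open>Op k\<close> sends the monomial \<open>x\<^sup>m p\<^sup>n\<close> to the operator \<open>x\<^sup>m P\<^sup>n\<close>, so that the composition of two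
  quantised polynomials only requires moving powers of \<open>P\<close> to the right of powers of \<open>x\<close>. One step of
  this is (\<open>momentum_Op\<close>)
  \<open>P Op(a) = Op(p a) + Op(D a) + k Op(R a) \<gamma>\<close> with \<open>D a = - \<i> \<partial>\<^sub>x a\<close> and
  \<open>R a (x, p) = - \<i> (a (x, - p) - a (- x, - p)) / x\<close>.
  Hence \<open>P\<^sup>n Op(a)\<close> is the \<open>n\<close>th power of \<open>p + D + k R \<gamma>\<close> applied to \<open>a\<close>. Multiplication by \<open>p\<close> commutes with \<open>D\<close>
  and anticommutes with \<open>R\<close>. If all factors \<open>p\<close> are moved to the left past a word \<open>w\<close> of length \<open>j\<close> in \<open>D\<close>
  and \<open>R\<close>, they contribute the complete homogeneous symmetric polynomial of degree \<open>n - j\<close> in the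
  \<open>j + 1\<close> variables \<open>\<plusminus>p\<close>, where the sign of the \<open>i\<close>th variable is the parity of the number of letters \<open>R\<close>
  among the first \<open>i\<close> letters. This polynomial is a divided difference of \<open>p\<^sup>n\<close>. By linearity, a
  word \<open>w\<close> with \<open>l\<close> letters \<open>R\<close> contributes \<open>k\<^sup>l a\<^sub>1[\<plusminus>p, \<dots>, \<plusminus>p] (w a\<^sub>2)\<close>, followed by \<open>\<gamma>\<^sup>l\<close>, to the symbol
  of the composition. The sum over words is the operator \<open>star\<close>; even \<open>l\<close> gives the first
  family, odd \<open>l\<close> the second.

  Confluent divided differences at \<open>p\<close> and \<open>- p\<close> have two descriptions. The Hermite--Genocchi
  integral shows that they preserve smoothness and treats the axis \<open>p = 0\<close>, where only derivatives at \<open>(x, 0)\<close>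
  enter; the recursion \<open>divdiff_step\<close> shows that off the axis they depend only on derivatives at
  \<open>(x, \<plusminus>p)\<close>. The identities \<open>divdiff_mult_p\<close>, which express how a divided difference reacts to
  multiplication by \<open>p\<close>, yield the recursion \<open>star_shift_Suc\<close>. This is the symbol-level form of
  \<open>(a\<^sub>1 p) \<circ> a\<^sub>2 = a\<^sub>1 \<circ> (P a\<^sub>2)\<close>, and the composition formula follows by induction on the
  degree of \<open>a\<^sub>1\<close> in \<open>p\<close>.

  On the analytic side, the kernel at imaginary parameter is \<open>B\<^sub>k(s) + \<i> s B\<^sub>k\<^sub>+\<^sub>1(s) / (2 k + 1)\<close> for
  normalised Bessel functions \<open>B\<^sub>k\<close>. An energy that does not increase away from the origin gives both the bound by
  \<open>1\<close> and uniqueness. The transform preserves Schwartz functions because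
  derivatives of a Hankel transform are again Hankel transforms of shifted order. The inversion formula has a short
  proof: the twofold transform followed by reflection commutes with multiplication by \<open>x\<close>, so it is itself
  multiplication by a function (a Schwartz function vanishing at a point is divisible there), and
  this function is \<open>1\<close> since the Gaussian is its own transform.
\<close>

section \<open>Smooth functions of two variables\<close>

lemma partial_x_eqI:
  assumes "\<And>x p. ((\<lambda>t. f (t, p)) has_vector_derivative f' (x, p)) (at x)"
  shows "partial_x f = f'"
  unfolding partial_x_def using assms by (auto intro!: ext vector_derivative_at)

lemma partial_p_eqI:
  assumes "\<And>x p. ((\<lambda>t. f (x, t)) has_vector_derivative f' (x, p)) (at p)"
  shows "partial_p f = f'"
  unfolding partial_p_def using assms by (auto intro!: ext vector_derivative_at)

text \<open>Smoothness is the greatest predicate stable under both partial derivatives. Exhibiting a stable set of continuous functions avoids inductions over the order of differentiability.\<close>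

lemma C_infinity_coinduct:
  assumes "u \<in> V"
    and cont: "\<And>u. u \<in> V \<Longrightarrow> continuous_on UNIV u"
    and dx: "\<And>u. u \<in> V \<Longrightarrow> \<exists>u'\<in>V. \<forall>x p. ((\<lambda>t. u (t, p)) has_vector_derivative u' (x, p)) (at x)"
    and dp: "\<And>u. u \<in> V \<Longrightarrow> \<exists>u'\<in>V. \<forall>x p. ((\<lambda>t. u (x, t)) has_vector_derivative u' (x, p)) (at p)"
  shows "u \<in> C_infinity"
proof -
  have "\<forall>u\<in>V. C_n n u" for n
  proof (induction n)
    case 0
    then show ?case using cont by simp
  next
    case (Suc n)
    show ?case
    proof
      fix u assume u: "u \<in> V"
      obtain ux where ux: "ux \<in> V" "\<And>x p. ((\<lambda>t. u (t, p)) has_vector_derivative ux (x, p)) (at x)"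
        using dx[OF u] by blast
      obtain up where up: "up \<in> V" "\<And>x p. ((\<lambda>t. u (x, t)) has_vector_derivative up (x, p)) (at p)"
        using dp[OF u] by blast
      have "partial_x u = ux" "partial_p u = up"
        by (auto intro: partial_x_eqI partial_p_eqI ux up)
      then show "C_n (Suc n) u"
        using Suc ux up differentiableI_vector[OF ux(2)] differentiableI_vector[OF up(2)] by simp
    qed
  qed
  then show ?thesis using \<open>u \<in> V\<close> by (auto simp: C_infinity_def)
qed

lemma C_infinity_continuous: "f \<in> C_infinity \<Longrightarrow> continuous_on A f"
  using C_n.simps(1)[of f] by (auto simp: C_infinity_def intro: continuous_on_subset)

lemma C_infinity_partial_x:
  assumes "f \<in> C_infinity"
  shows "partial_x f \<in> C_infinity"
proof -
  have "C_n (Suc n) f" for n using assms by (simp only: C_infinity_def mem_Collect_eq)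
  then show ?thesis by (simp add: C_infinity_def)
qed

lemma C_infinity_partial_p:
  assumes "f \<in> C_infinity"
  shows "partial_p f \<in> C_infinity"
proof -
  have "C_n (Suc n) f" for n using assms by (simp only: C_infinity_def mem_Collect_eq)
  then show ?thesis by (simp add: C_infinity_def)
qed

lemma has_vector_derivative_partial_x:
  assumes "f \<in> C_infinity"
  shows "((\<lambda>t. f (t, p)) has_vector_derivative partial_x f (x, p)) (at x)"
proof -
  have "C_n 1 f" using assms by (auto simp: C_infinity_def)
  then show ?thesis by (simp add: partial_x_def vector_derivative_works[symmetric])
qed

lemma has_vector_derivative_partial_p:
  assumes "f \<in> C_infinity"
  shows "((\<lambda>t. f (x, t)) has_vector_derivative partial_p f (x, p)) (at p)"
proof -
  have "C_n 1 f" using assms by (auto simp: C_infinity_def)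
  then show ?thesis by (simp add: partial_p_def vector_derivative_works[symmetric])
qed

lemma C_infinity_funpow_partial_p: "f \<in> C_infinity \<Longrightarrow> (partial_p ^^ n) f \<in> C_infinity"
  by (induction n) (auto intro: C_infinity_partial_p)

lemma C_infinity_funpow_partial_x: "f \<in> C_infinity \<Longrightarrow> (partial_x ^^ n) f \<in> C_infinity"
  by (induction n) (auto intro: C_infinity_partial_x)

lemma C_infinity_lincomb:
  assumes "f \<in> C_infinity" "g \<in> C_infinity"
  shows "(\<lambda>z. a * f z + b * g z) \<in> C_infinity"
proof (rule C_infinity_coinduct[where V = "{\<lambda>z. a * f z + b * g z |f g. f \<in> C_infinity \<and> g \<in> C_infinity}"])
  fix u assume "u \<in> {\<lambda>z. a * f z + b * g z |f g. f \<in> C_infinity \<and> g \<in> C_infinity}"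
  then obtain f g where u: "u = (\<lambda>z. a * f z + b * g z)" and f: "f \<in> C_infinity" and g: "g \<in> C_infinity"
    by blast
  show "continuous_on UNIV u"
    unfolding u by (intro continuous_intros C_infinity_continuous f g)
  show "\<exists>u'\<in>{\<lambda>z. a * f z + b * g z |f g. f \<in> C_infinity \<and> g \<in> C_infinity}.
      \<forall>x p. ((\<lambda>t. u (t, p)) has_vector_derivative u' (x, p)) (at x)"
    unfolding u
    by (rule bexI[where x = "\<lambda>z. a * partial_x f z + b * partial_x g z"])
      (use f g in \<open>auto intro!: derivative_eq_intros has_vector_derivative_mult_right
         has_vector_derivative_partial_x C_infinity_partial_x\<close>)
  show "\<exists>u'\<in>{\<lambda>z. a * f z + b * g z |f g. f \<in> C_infinity \<and> g \<in> C_infinity}.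
      \<forall>x p. ((\<lambda>t. u (x, t)) has_vector_derivative u' (x, p)) (at p)"
    unfolding u
    by (rule bexI[where x = "\<lambda>z. a * partial_p f z + b * partial_p g z"])
      (use f g in \<open>auto intro!: derivative_eq_intros has_vector_derivative_mult_right
         has_vector_derivative_partial_p C_infinity_partial_p\<close>)
qed (use assms in blast)

lemma C_infinity_add: "f \<in> C_infinity \<Longrightarrow> g \<in> C_infinity \<Longrightarrow> (\<lambda>z. f z + g z) \<in> C_infinity"
  using C_infinity_lincomb[of f g 1 1] by simp

lemma C_infinity_cmult: "f \<in> C_infinity \<Longrightarrow> (\<lambda>z. a * f z) \<in> C_infinity"
  using C_infinity_lincomb[of f f a 0] by simp

lemma C_infinity_const: "(\<lambda>_. c) \<in> C_infinity"
proof (rule C_infinity_coinduct[where V = "range (\<lambda>c _. c)"])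
  show "\<exists>u'\<in>range (\<lambda>c _. c). \<forall>x p. ((\<lambda>t. u (t, p)) has_vector_derivative u' (x, p)) (at x)"
    if "u \<in> range (\<lambda>c _. c)" for u :: "real \<times> real \<Rightarrow> complex"
    using that by (intro bexI[where x = "\<lambda>_. 0"]) auto
  show "\<exists>u'\<in>range (\<lambda>c _. c). \<forall>x p. ((\<lambda>t. u (x, t)) has_vector_derivative u' (x, p)) (at p)"
    if "u \<in> range (\<lambda>c _. c)" for u :: "real \<times> real \<Rightarrow> complex"
    using that by (intro bexI[where x = "\<lambda>_. 0"]) auto
qed auto

lemma C_infinity_mult:
  assumes "f \<in> C_infinity" "g \<in> C_infinity"
  shows "(\<lambda>z. f z * g z) \<in> C_infinity"
proof -
  define S where "S = {\<lambda>z. \<Sum>i<(n::nat). f i z * g i z |n f g. (\<forall>i. f i \<in> C_infinity) \<and> (\<forall>i. g i \<in> C_infinity)}"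
  \<comment> \<open>Sums of products are stable under the product rule: a sum of n products goes to a sum of 2 n products.\<close>
  have SI: "(\<lambda>z. \<Sum>i<n. (f' i z * g i z + f i z * g' i z)) \<in> S"
    if fg: "\<And>i. f i \<in> C_infinity" "\<And>i. g i \<in> C_infinity" "\<And>i. f' i \<in> C_infinity" "\<And>i. g' i \<in> C_infinity"
    for f g f' g' :: "nat \<Rightarrow> real \<times> real \<Rightarrow> complex" and n
  proof -
    define F where "F = (\<lambda>i. if i < n then f' i else f (i - n))"
    define G where "G = (\<lambda>i. if i < n then g i else g' (i - n))"
    have "(\<Sum>i<n. (f' i z * g i z + f i z * g' i z)) = (\<Sum>i<n+n. F i z * G i z)" for z
    proof -
      have "(\<Sum>i<n+n. F i z * G i z) = (\<Sum>i<n. F i z * G i z) + (\<Sum>i<n. F (n + i) z * G (n + i) z)"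
        by (simp add: sum.nat_group lessThan_atLeast0 sum.atLeastLessThan_concat[symmetric, of 0 n "n+n"]
            sum.shift_bounds_nat_ivl[of _ 0 n n, simplified] add.commute)
      also have "\<dots> = (\<Sum>i<n. (f' i z * g i z + f i z * g' i z))"
        by (simp add: F_def G_def sum.distrib)
      finally show ?thesis by simp
    qed
    moreover have "\<forall>i. F i \<in> C_infinity" "\<forall>i. G i \<in> C_infinity"
      using fg by (auto simp: F_def G_def)
    ultimately show ?thesis unfolding S_def by blast
  qed
  show ?thesis
  proof (rule C_infinity_coinduct[where V = S])
    show "(\<lambda>z. f z * g z) \<in> S"
      unfolding S_def using assms
      by (intro CollectI exI[where x = 1] exI[where x = "\<lambda>_. f"] exI[where x = "\<lambda>_. g"]) auto
  next
    fix u assume "u \<in> S"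
    then obtain n f g where u: "u = (\<lambda>z. \<Sum>i<(n::nat). f i z * g i z)"
      and f: "\<And>i. f i \<in> C_infinity" and g: "\<And>i. g i \<in> C_infinity"
      unfolding S_def by blast
    show "continuous_on UNIV u"
      unfolding u by (intro continuous_intros C_infinity_continuous f g)
    show "\<exists>u'\<in>S. \<forall>x p. ((\<lambda>t. u (t, p)) has_vector_derivative u' (x, p)) (at x)"
    proof (rule bexI[OF _ SI[of f g "\<lambda>i. partial_x (f i)" "\<lambda>i. partial_x (g i)" n]])
      show "\<forall>x p. ((\<lambda>t. u (t, p)) has_vector_derivative
         (\<Sum>i<n. partial_x (f i) (x, p) * g i (x, p) + f i (x, p) * partial_x (g i) (x, p))) (at x)"
        unfolding u
        by (intro allI has_vector_derivative_sum)
          (auto intro!: has_vector_derivative_eq_rhs[OF has_vector_derivative_mult[OF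
              has_vector_derivative_partial_x[OF f] has_vector_derivative_partial_x[OF g]]])
    qed (auto intro: f g C_infinity_partial_x)
    show "\<exists>u'\<in>S. \<forall>x p. ((\<lambda>t. u (x, t)) has_vector_derivative u' (x, p)) (at p)"
    proof (rule bexI[OF _ SI[of f g "\<lambda>i. partial_p (f i)" "\<lambda>i. partial_p (g i)" n]])
      show "\<forall>x p. ((\<lambda>t. u (x, t)) has_vector_derivative
         (\<Sum>i<n. partial_p (f i) (x, p) * g i (x, p) + f i (x, p) * partial_p (g i) (x, p))) (at p)"
        unfolding u
        by (intro allI has_vector_derivative_sum)
          (auto intro!: has_vector_derivative_eq_rhs[OF has_vector_derivative_mult[OF
              has_vector_derivative_partial_p[OF f] has_vector_derivative_partial_p[OF g]]])
    qed (auto intro: f g C_infinity_partial_p)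
  qed
qed


subsection \<open>Weighted averages over dilations\<close>

text \<open>Apart from differentiation, all operators on symbols needed below have this form: reflections and divided
  differences at \<open>x\<close> and \<open>- x\<close> as well as their higher and confluent versions
  (Hermite--Genocchi formula). The form is stable under both partial derivatives, which makes
  smoothness of the result immediate by coinduction.\<close>

definition average ::
    "(real \<Rightarrow> real) \<Rightarrow> (real \<Rightarrow> real) \<Rightarrow> (real \<Rightarrow> real) \<Rightarrow> (real \<times> real \<Rightarrow> complex) \<Rightarrow> real \<times> real \<Rightarrow> complex" where
  "average w \<alpha> \<beta> g = (\<lambda>(x, p). integral {0..1} (\<lambda>t. of_real (w t) * g (\<alpha> t * x, \<beta> t * p)))"

lemma average_continuous_integrand:
  fixes w \<alpha> \<beta> :: "real \<Rightarrow> real" and g :: "real \<times> real \<Rightarrow> complex"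
  assumes "continuous_on UNIV w" "continuous_on UNIV \<alpha>" "continuous_on UNIV \<beta>" "continuous_on UNIV g"
  shows "continuous_on A (\<lambda>((x, p), t). of_real (w t) * g (\<alpha> t * x, \<beta> t * p))"
  unfolding case_prod_unfold
  by (intro continuous_intros continuous_on_compose2[OF assms(1)] continuous_on_compose2[OF assms(2)]
      continuous_on_compose2[OF assms(3)] continuous_on_compose2[OF assms(4)]) auto

lemma average_integrable:
  fixes w \<alpha> \<beta> :: "real \<Rightarrow> real" and g :: "real \<times> real \<Rightarrow> complex"
  assumes "continuous_on UNIV w" "continuous_on UNIV \<alpha>" "continuous_on UNIV \<beta>" "continuous_on UNIV g"
  shows "(\<lambda>t. of_real (w t) * g (\<alpha> t * x, \<beta> t * p)) integrable_on {0..1}"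
  by (intro integrable_continuous_real continuous_intros continuous_on_compose2[OF assms(1)]
      continuous_on_compose2[OF assms(2)] continuous_on_compose2[OF assms(3)]
      continuous_on_compose2[OF assms(4)]) auto

lemma has_vector_derivative_average_x:
  assumes c: "continuous_on UNIV w" "continuous_on UNIV \<alpha>" "continuous_on UNIV \<beta>" and g: "g \<in> C_infinity"
  shows "((\<lambda>s. average w \<alpha> \<beta> g (s, p)) has_vector_derivative
           average (\<lambda>t. w t * \<alpha> t) \<alpha> \<beta> (partial_x g) (x, p)) (at x)"
proof -
  have cw: "continuous_on UNIV (\<lambda>t. w t * \<alpha> t)" by (intro continuous_intros c)
  have "((\<lambda>s. integral (cbox 0 1) (\<lambda>t. of_real (w t) * g (\<alpha> t * s, \<beta> t * p))) has_vector_derivative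
      integral (cbox 0 1) (\<lambda>t. of_real (w t * \<alpha> t) * partial_x g (\<alpha> t * x, \<beta> t * p))) (at x within UNIV)"
  proof (rule leibniz_rule_vector_derivative)
    fix s t :: real
    have "((\<lambda>s. g (s, \<beta> t * p)) \<circ> (\<lambda>s. \<alpha> t * s) has_vector_derivative
        \<alpha> t *\<^sub>R partial_x g (\<alpha> t * s, \<beta> t * p)) (at s within UNIV)"
      by (rule vector_diff_chain_within)
        (rule has_vector_derivative_eq_rhs[OF has_vector_derivative_mult_right[OF has_vector_derivative_id]],
         simp, rule has_vector_derivative_at_within[OF has_vector_derivative_partial_x[OF g]])
    then show "((\<lambda>s. of_real (w t) * g (\<alpha> t * s, \<beta> t * p)) has_vector_derivative
        of_real (w t * \<alpha> t) * partial_x g (\<alpha> t * s, \<beta> t * p)) (at s within UNIV)"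
      unfolding o_def
      by (rule has_vector_derivative_eq_rhs[OF has_vector_derivative_mult_right])
        (simp add: scaleR_conv_of_real)
  next
    show "(\<lambda>t. of_real (w t) * g (\<alpha> t * s, \<beta> t * p)) integrable_on cbox 0 1" for s
      using average_integrable[OF c C_infinity_continuous[OF g]] by simp
    have "continuous_on UNIV ((\<lambda>((x, p), t). of_real (w t * \<alpha> t) * partial_x g (\<alpha> t * x, \<beta> t * p)) \<circ> (\<lambda>(s, t). ((s, p), t)))"
      by (rule continuous_on_compose, simp add: case_prod_unfold, intro continuous_intros)
        (rule average_continuous_integrand[OF cw c(2,3) C_infinity_continuous[OF C_infinity_partial_x[OF g]]])
    then show "continuous_on (UNIV \<times> cbox 0 1)
        (\<lambda>(s, t). of_real (w t * \<alpha> t) * partial_x g (\<alpha> t * s, \<beta> t * p))"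
      using continuous_on_subset by (fastforce simp: o_def case_prod_unfold)
  qed auto
  then show ?thesis by (simp add: average_def)
qed

lemma has_vector_derivative_average_p:
  assumes c: "continuous_on UNIV w" "continuous_on UNIV \<alpha>" "continuous_on UNIV \<beta>" and g: "g \<in> C_infinity"
  shows "((\<lambda>s. average w \<alpha> \<beta> g (x, s)) has_vector_derivative
           average (\<lambda>t. w t * \<beta> t) \<alpha> \<beta> (partial_p g) (x, p)) (at p)"
proof -
  have cw: "continuous_on UNIV (\<lambda>t. w t * \<beta> t)" by (intro continuous_intros c)
  have "((\<lambda>s. integral (cbox 0 1) (\<lambda>t. of_real (w t) * g (\<alpha> t * x, \<beta> t * s))) has_vector_derivative
      integral (cbox 0 1) (\<lambda>t. of_real (w t * \<beta> t) * partial_p g (\<alpha> t * x, \<beta> t * p))) (at p within UNIV)"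
  proof (rule leibniz_rule_vector_derivative)
    fix s t :: real
    have "((\<lambda>s. g (\<alpha> t * x, s)) \<circ> (\<lambda>s. \<beta> t * s) has_vector_derivative
        \<beta> t *\<^sub>R partial_p g (\<alpha> t * x, \<beta> t * s)) (at s within UNIV)"
      by (rule vector_diff_chain_within)
        (rule has_vector_derivative_eq_rhs[OF has_vector_derivative_mult_right[OF has_vector_derivative_id]],
         simp, rule has_vector_derivative_at_within[OF has_vector_derivative_partial_p[OF g]])
    then show "((\<lambda>s. of_real (w t) * g (\<alpha> t * x, \<beta> t * s)) has_vector_derivative
        of_real (w t * \<beta> t) * partial_p g (\<alpha> t * x, \<beta> t * s)) (at s within UNIV)"
      unfolding o_def
      by (rule has_vector_derivative_eq_rhs[OF has_vector_derivative_mult_right])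
        (simp add: scaleR_conv_of_real)
  next
    show "(\<lambda>t. of_real (w t) * g (\<alpha> t * x, \<beta> t * s)) integrable_on cbox 0 1" for s
      using average_integrable[OF c C_infinity_continuous[OF g]] by simp
    have "continuous_on UNIV ((\<lambda>((x, p), t). of_real (w t * \<beta> t) * partial_p g (\<alpha> t * x, \<beta> t * p)) \<circ> (\<lambda>(s, t). ((x, s), t)))"
      by (rule continuous_on_compose, simp add: case_prod_unfold, intro continuous_intros)
        (rule average_continuous_integrand[OF cw c(2,3) C_infinity_continuous[OF C_infinity_partial_p[OF g]]])
    then show "continuous_on (UNIV \<times> cbox 0 1)
        (\<lambda>(s, t). of_real (w t * \<beta> t) * partial_p g (\<alpha> t * x, \<beta> t * s))"
      using continuous_on_subset by (fastforce simp: o_def case_prod_unfold)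
  qed auto
  then show ?thesis by (simp add: average_def)
qed

lemma C_infinity_average:
  assumes "continuous_on UNIV w" "continuous_on UNIV \<alpha>" "continuous_on UNIV \<beta>" "g \<in> C_infinity"
  shows "average w \<alpha> \<beta> g \<in> C_infinity"
proof -
  define V where "V = {average w \<alpha> \<beta> g |w g. continuous_on UNIV w \<and> g \<in> C_infinity}"
  show ?thesis
  proof (rule C_infinity_coinduct[where V = V])
    show "average w \<alpha> \<beta> g \<in> V" using assms by (auto simp: V_def)
  next
    fix u assume "u \<in> V"
    then obtain w g where u: "u = average w \<alpha> \<beta> g" and w: "continuous_on UNIV w" and g: "g \<in> C_infinity"
      by (auto simp: V_def)
    have "continuous_on UNIV (\<lambda>z. integral (cbox 0 1) (\<lambda>t. of_real (w t) * g (\<alpha> t * fst z, \<beta> t * snd z)))"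
      using average_continuous_integrand[OF w assms(2,3) C_infinity_continuous[OF g]]
      by (intro integral_continuous_on_param) (simp add: case_prod_unfold)
    then show "continuous_on UNIV u"
      by (simp add: u average_def case_prod_unfold)
    show "\<exists>u'\<in>V. \<forall>x p. ((\<lambda>t. u (t, p)) has_vector_derivative u' (x, p)) (at x)"
      unfolding u
      by (rule bexI[where x = "average (\<lambda>t. w t * \<alpha> t) \<alpha> \<beta> (partial_x g)"])
        (auto simp: V_def intro!: has_vector_derivative_average_x w assms g continuous_intros
           C_infinity_partial_x exI[where x = "\<lambda>t. w t * \<alpha> t"] exI[where x = "partial_x g"])
    show "\<exists>u'\<in>V. \<forall>x p. ((\<lambda>t. u (x, t)) has_vector_derivative u' (x, p)) (at p)"
      unfolding u
      by (rule bexI[where x = "average (\<lambda>t. w t * \<beta> t) \<alpha> \<beta> (partial_p g)"])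
        (auto simp: V_def intro!: has_vector_derivative_average_p w assms g continuous_intros
           C_infinity_partial_p exI[where x = "\<lambda>t. w t * \<beta> t"] exI[where x = "partial_p g"])
  qed
qed

lemma average_lincomb:
  assumes c: "continuous_on UNIV w" "continuous_on UNIV \<alpha>" "continuous_on UNIV \<beta>"
    and "f \<in> C_infinity" "g \<in> C_infinity"
  shows "average w \<alpha> \<beta> (\<lambda>z. a * f z + b * g z) = (\<lambda>z. a * average w \<alpha> \<beta> f z + b * average w \<alpha> \<beta> g z)"
proof -
  have "integral {0..1} (\<lambda>t. of_real (w t) * (a * f (\<alpha> t * x, \<beta> t * p) + b * g (\<alpha> t * x, \<beta> t * p))) =
      a * integral {0..1} (\<lambda>t. of_real (w t) * f (\<alpha> t * x, \<beta> t * p)) +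
      b * integral {0..1} (\<lambda>t. of_real (w t) * g (\<alpha> t * x, \<beta> t * p))" for x p
  proof -
    note int = average_integrable[OF c C_infinity_continuous[OF assms(4)]]
      average_integrable[OF c C_infinity_continuous[OF assms(5)]]
    have "integral {0..1} (\<lambda>t. of_real (w t) * (a * f (\<alpha> t * x, \<beta> t * p) + b * g (\<alpha> t * x, \<beta> t * p))) =
        integral {0..1} (\<lambda>t. a * (of_real (w t) * f (\<alpha> t * x, \<beta> t * p)) + b * (of_real (w t) * g (\<alpha> t * x, \<beta> t * p)))"
      by (simp add: algebra_simps)
    also have "\<dots> = a * integral {0..1} (\<lambda>t. of_real (w t) * f (\<alpha> t * x, \<beta> t * p)) +
      b * integral {0..1} (\<lambda>t. of_real (w t) * g (\<alpha> t * x, \<beta> t * p))"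
      by (subst integral_add) (auto intro!: integrable_on_mult_right int)
    finally show ?thesis .
  qed
  then show ?thesis by (auto simp: average_def)
qed

subsection \<open>Polynomials and their bidegree\<close>

lemma has_bidegree_zero: "has_bidegree (\<lambda>_. 0) m n"
  unfolding has_bidegree_def by (rule exI[where x = "\<lambda>_ _. 0"]) auto

lemma finite_nat_int_le: "finite {i. int i \<le> m}"
  by (rule finite_subset[of _ "{..nat m}"]) auto

lemma has_bidegree_add:
  assumes "has_bidegree f m n" "has_bidegree g m n"
  shows "has_bidegree (\<lambda>z. f z + g z) m n"
proof -
  obtain c d where "f = (\<lambda>(x, p). \<Sum>i | int i \<le> m. \<Sum>j | int j \<le> n. c i j * of_real x ^ i * of_real p ^ j)"
    "g = (\<lambda>(x, p). \<Sum>i | int i \<le> m. \<Sum>j | int j \<le> n. d i j * of_real x ^ i * of_real p ^ j)"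
    using assms unfolding has_bidegree_def by blast
  then show ?thesis unfolding has_bidegree_def
    by (intro exI[where x = "\<lambda>i j. c i j + d i j"]) (auto simp: sum.distrib[symmetric] algebra_simps)
qed

lemma has_bidegree_cmult:
  assumes "has_bidegree f m n"
  shows "has_bidegree (\<lambda>z. a * f z) m n"
proof -
  obtain c where "f = (\<lambda>(x, p). \<Sum>i | int i \<le> m. \<Sum>j | int j \<le> n. c i j * of_real x ^ i * of_real p ^ j)"
    using assms unfolding has_bidegree_def by blast
  then show ?thesis unfolding has_bidegree_def
    by (intro exI[where x = "\<lambda>i j. a * c i j"]) (auto simp: sum_distrib_left algebra_simps)
qed

lemma has_bidegree_monomial:
  assumes "int i \<le> m" "int j \<le> n"
  shows "has_bidegree (\<lambda>(x, p). a * of_real x ^ i * of_real p ^ j) m n"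
proof -
  have "(\<Sum>i' | int i' \<le> m. \<Sum>j' | int j' \<le> n. (if i' = i \<and> j' = j then a else 0) * of_real x ^ i' * of_real p ^ j') =
      a * of_real x ^ i * of_real p ^ j" for x p
  proof -
    have "(\<Sum>i' | int i' \<le> m. \<Sum>j' | int j' \<le> n. (if i' = i \<and> j' = j then a else 0) * of_real x ^ i' * of_real p ^ j') =
        (\<Sum>i' | int i' \<le> m. \<Sum>j' | int j' \<le> n. if i' = i then if j' = j then a * of_real x ^ i' * of_real p ^ j' else 0 else 0)"
      by (intro sum.cong) auto
    also have "\<dots> = (\<Sum>i' | int i' \<le> m. if i' = i then a * of_real x ^ i' * of_real p ^ j else 0)"
      using assms by (intro sum.cong) (auto simp: sum.delta finite_nat_int_le)
    also have "\<dots> = a * of_real x ^ i * of_real p ^ j"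
      using assms by (auto simp: sum.delta finite_nat_int_le)
    finally show ?thesis .
  qed
  then show ?thesis unfolding has_bidegree_def
    by (intro exI[where x = "\<lambda>i' j'. if i' = i \<and> j' = j then a else 0"]) auto
qed

lemma has_bidegree_induct [consumes 1, case_names zero add monomial]:
  assumes "has_bidegree f m n"
    and "P (\<lambda>_. 0)"
    and add: "\<And>f g. has_bidegree f m n \<Longrightarrow> has_bidegree g m n \<Longrightarrow> P f \<Longrightarrow> P g \<Longrightarrow> P (\<lambda>z. f z + g z)"
    and mono: "\<And>a i j. int i \<le> m \<Longrightarrow> int j \<le> n \<Longrightarrow> P (\<lambda>(x, p). a * of_real x ^ i * of_real p ^ j)"
  shows "P f"
proof -
  obtain c where f: "f = (\<lambda>(x, p). \<Sum>i | int i \<le> m. \<Sum>j | int j \<le> n. c i j * of_real x ^ i * of_real p ^ j)"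
    using assms(1) unfolding has_bidegree_def by blast
  define Q where "Q = (\<lambda>f. has_bidegree f m n \<and> P f)"
  have Q_sum: "Q (\<lambda>z. \<Sum>i\<in>A. F i z)" if "\<And>i. i \<in> A \<Longrightarrow> Q (F i)" "finite A"
    for A :: "nat set" and F
    using that(2,1)
    by (induction A rule: finite_induct)
      (auto simp: Q_def assms(2) has_bidegree_zero intro!: has_bidegree_add add)
  have "Q (\<lambda>z. \<Sum>i | int i \<le> m. \<Sum>j | int j \<le> n. (\<lambda>(x, p). c i j * of_real x ^ i * of_real p ^ j) z)"
    by (intro Q_sum) (auto simp: finite_nat_int_le Q_def intro!: mono has_bidegree_monomial)
  also have "(\<lambda>z. \<Sum>i | int i \<le> m. \<Sum>j | int j \<le> n. (\<lambda>(x, p). c i j * of_real x ^ i * of_real p ^ j) z) = f"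
    by (auto simp: f)
  finally show ?thesis by (simp add: Q_def)
qed

lemma has_bidegree_mult:
  assumes "has_bidegree f m n" "has_bidegree g m' n'"
  shows "has_bidegree (\<lambda>z. f z * g z) (m + m') (n + n')"
  using assms(1)
proof (induction rule: has_bidegree_induct)
  case zero
  then show ?case by (simp add: has_bidegree_zero)
next
  case (add f h)
  then show ?case using has_bidegree_add[OF add(3,4)] by (simp add: algebra_simps)
next
  case (monomial a i j)
  note ij = monomial
  from assms(2) show ?case
  proof (induction rule: has_bidegree_induct)
    case zero
    then show ?case by (simp add: has_bidegree_zero)
  next
    case (add g h)
    then show ?case using has_bidegree_add[OF add(3,4)] by (simp add: algebra_simps)
  next
    case (monomial b i' j')
    have "has_bidegree (\<lambda>(x, p). a * b * of_real x ^ (i + i') * of_real p ^ (j + j')) (m + m') (n + n')"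
      using ij monomial by (intro has_bidegree_monomial) auto
    then show ?case by (simp add: power_add case_prod_unfold mult_ac)
  qed
qed

lemma has_bidegree_zeroD: "has_bidegree f m n \<Longrightarrow> m < 0 \<or> n < 0 \<Longrightarrow> f = (\<lambda>_. 0)"
  by (induction rule: has_bidegree_induct) auto

lemma has_vector_derivative_of_real_power:
  "((\<lambda>t. a * of_real t ^ i * b) has_vector_derivative (a * of_nat i * of_real x ^ (i - 1) * b :: complex)) (at x)"
proof -
  have "((\<lambda>z. a * z ^ i * b) has_field_derivative a * of_nat i * of_real x ^ (i - 1) * b) (at (of_real x))"
    by (auto intro!: derivative_eq_intros)
  from has_vector_derivative_real_field[OF this] show ?thesis by simp
qed

lemma has_vector_derivative_of_real_power':
  "((\<lambda>t. a * b * of_real t ^ i) has_vector_derivative (a * of_nat i * b * of_real x ^ (i - 1) :: complex)) (at x)"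
  using has_vector_derivative_of_real_power[of a i b x] by (simp add: mult_ac)

lemma has_bidegree_C_infinity: "has_bidegree f m n \<Longrightarrow> f \<in> C_infinity"
proof (induction rule: has_bidegree_induct)
  case zero
  then show ?case by (rule C_infinity_const)
next
  case (add f g)
  then show ?case by (intro C_infinity_add)
next
  case (monomial a i j)
  define V where "V = range (\<lambda>(a, i, j). \<lambda>(x, p). a * of_real x ^ i * of_real p ^ j :: complex)"
  have VI: "(\<lambda>(x, p). a * of_real x ^ i * of_real p ^ j) \<in> V" for a i j
    unfolding V_def by (rule image_eqI[where x = "(a, i, j)"]) auto
  show ?case
  proof (rule C_infinity_coinduct[OF VI])
    fix u assume "u \<in> V"
    then obtain a i j where u: "u = (\<lambda>(x, p). a * of_real x ^ i * of_real p ^ j)" by (auto simp: V_def)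
    show "continuous_on UNIV u" unfolding u case_prod_unfold by (intro continuous_intros)
    show "\<exists>u'\<in>V. \<forall>x p. ((\<lambda>t. u (t, p)) has_vector_derivative u' (x, p)) (at x)"
      by (rule bexI[OF _ VI[of "a * of_nat i" "i - 1" j]])
        (auto simp: u intro: has_vector_derivative_of_real_power[unfolded One_nat_def])
    show "\<exists>u'\<in>V. \<forall>x p. ((\<lambda>t. u (x, t)) has_vector_derivative u' (x, p)) (at p)"
      by (rule bexI[OF _ VI[of "a * of_nat j" i "j - 1"]])
        (auto simp: u intro: has_vector_derivative_of_real_power'[unfolded One_nat_def])
  qed
qed

lemma has_bidegree_average:
  assumes c: "continuous_on UNIV w" "continuous_on UNIV \<alpha>" "continuous_on UNIV \<beta>"
  shows "has_bidegree f m n \<Longrightarrow> has_bidegree (average w \<alpha> \<beta> f) m n"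
proof (induction rule: has_bidegree_induct)
  case zero
  then show ?case by (simp add: average_def has_bidegree_zero case_prod_unfold)
next
  case (add f g)
  then show ?case
    using average_lincomb[OF c, of f g 1 1] has_bidegree_C_infinity[OF add(1)] has_bidegree_C_infinity[OF add(2)]
      has_bidegree_add[OF add(3,4)] by simp
next
  case (monomial a i j)
  have "average w \<alpha> \<beta> (\<lambda>(x, p). a * of_real x ^ i * of_real p ^ j) =
    (\<lambda>(x, p). (a * integral {0..1} (\<lambda>t. of_real (w t * \<alpha> t ^ i * \<beta> t ^ j))) * of_real x ^ i * of_real p ^ j)"
  proof (intro ext, clarify)
    fix x p :: real
    have "average w \<alpha> \<beta> (\<lambda>(x, p). a * of_real x ^ i * of_real p ^ j) (x, p) =
        integral {0..1} (\<lambda>t. (a * of_real x ^ i * of_real p ^ j) * of_real (w t * \<alpha> t ^ i * \<beta> t ^ j))"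
      by (simp add: average_def power_mult_distrib mult_ac)
    also have "\<dots> = (a * of_real x ^ i * of_real p ^ j) * integral {0..1} (\<lambda>t. of_real (w t * \<alpha> t ^ i * \<beta> t ^ j))"
      by (rule integral_mult_right)
    finally show "average w \<alpha> \<beta> (\<lambda>(x, p). a * of_real x ^ i * of_real p ^ j) (x, p) =
      (a * integral {0..1} (\<lambda>t. of_real (w t * \<alpha> t ^ i * \<beta> t ^ j))) * of_real x ^ i * of_real p ^ j"
      by (simp add: mult_ac)
  qed
  then show ?case using has_bidegree_monomial[OF monomial] by simp
qed

lemma partial_x_lincomb:
  assumes "f \<in> C_infinity" "g \<in> C_infinity"
  shows "partial_x (\<lambda>z. a * f z + b * g z) = (\<lambda>z. a * partial_x f z + b * partial_x g z)"
  by (rule partial_x_eqI) (use assms in \<open>auto intro!: derivative_eq_intros has_vector_derivative_mult_right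
         has_vector_derivative_partial_x\<close>)

lemma partial_p_lincomb:
  assumes "f \<in> C_infinity" "g \<in> C_infinity"
  shows "partial_p (\<lambda>z. a * f z + b * g z) = (\<lambda>z. a * partial_p f z + b * partial_p g z)"
  by (rule partial_p_eqI) (use assms in \<open>auto intro!: derivative_eq_intros has_vector_derivative_mult_right
         has_vector_derivative_partial_p\<close>)

lemma funpow_partial_p_lincomb:
  assumes "f \<in> C_infinity" "g \<in> C_infinity"
  shows "(partial_p ^^ n) (\<lambda>z. a * f z + b * g z) = (\<lambda>z. a * (partial_p ^^ n) f z + b * (partial_p ^^ n) g z)"
  by (induction n) (auto simp: partial_p_lincomb C_infinity_funpow_partial_p assms)

lemma funpow_partial_x_lincomb:
  assumes "f \<in> C_infinity" "g \<in> C_infinity"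
  shows "(partial_x ^^ n) (\<lambda>z. a * f z + b * g z) = (\<lambda>z. a * (partial_x ^^ n) f z + b * (partial_x ^^ n) g z)"
  by (induction n) (auto simp: partial_x_lincomb C_infinity_funpow_partial_x assms)

lemma partial_x_zero: "partial_x (\<lambda>_. 0) = (\<lambda>_. 0)"
  by (rule partial_x_eqI) auto

lemma partial_p_zero: "partial_p (\<lambda>_. 0) = (\<lambda>_. 0)"
  by (rule partial_p_eqI) auto

lemma has_bidegree_partial_x: "has_bidegree f m n \<Longrightarrow> has_bidegree (partial_x f) (m - 1) n"
proof (induction rule: has_bidegree_induct)
  case zero
  then show ?case by (simp add: partial_x_zero has_bidegree_zero)
next
  case (add f g)
  then show ?case
    using partial_x_lincomb[of f g 1 1] has_bidegree_C_infinity[OF add(1)] has_bidegree_C_infinity[OF add(2)]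
      has_bidegree_add[OF add(3,4)] by simp
next
  case (monomial a i j)
  have "partial_x (\<lambda>(x, p). a * of_real x ^ i * of_real p ^ j) =
     (\<lambda>(x, p). (a * of_nat i) * of_real x ^ (i - 1) * of_real p ^ j)"
    by (rule partial_x_eqI) (auto intro: has_vector_derivative_of_real_power[unfolded One_nat_def])
  then show ?case using monomial has_bidegree_monomial[of "i - 1" "m - 1" j n "a * of_nat i"]
    by (cases "i = 0") (auto simp: has_bidegree_zero case_prod_unfold)
qed

lemma has_bidegree_partial_p: "has_bidegree f m n \<Longrightarrow> has_bidegree (partial_p f) m (n - 1)"
proof (induction rule: has_bidegree_induct)
  case zero
  then show ?case by (simp add: partial_p_zero has_bidegree_zero)
next
  case (add f g)
  then show ?case
    using partial_p_lincomb[of f g 1 1] has_bidegree_C_infinity[OF add(1)] has_bidegree_C_infinity[OF add(2)]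
      has_bidegree_add[OF add(3,4)] by simp
next
  case (monomial a i j)
  have "partial_p (\<lambda>(x, p). a * of_real x ^ i * of_real p ^ j) =
     (\<lambda>(x, p). (a * of_nat j) * of_real x ^ i * of_real p ^ (j - 1))"
    by (rule partial_p_eqI) (auto intro: has_vector_derivative_of_real_power'[unfolded One_nat_def])
  then show ?case using monomial has_bidegree_monomial[of i m "j - 1" "n - 1" "a * of_nat j"]
    by (cases "j = 0") (auto simp: has_bidegree_zero case_prod_unfold)
qed

lemma has_bidegree_funpow_partial_p:
  "has_bidegree f m n \<Longrightarrow> has_bidegree ((partial_p ^^ j) f) m (n - int j)"
proof (induction j)
  case (Suc j)
  then show ?case using has_bidegree_partial_p[of "(partial_p ^^ j) f" m "n - int j"] by (simp add: algebra_simps)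
qed simp

section \<open>Confluent divided differences at opposite points\<close>

lemma C_infinity_eqI_off_axis:
  fixes f g :: "real \<times> real \<Rightarrow> complex"
  assumes "continuous_on UNIV f" "continuous_on UNIV g"
    and eq: "\<And>x p. p \<noteq> 0 \<Longrightarrow> f (x, p) = g (x, p)"
  shows "f = g"
proof (intro ext, clarify)
  fix x p :: real
  have lim: "((\<lambda>q. h (x, q)) \<longlongrightarrow> h (x, p)) (at p)" if "continuous_on UNIV h"
    for h :: "real \<times> real \<Rightarrow> complex"
  proof -
    have "continuous_on UNIV (\<lambda>q. h (x, q))"
      by (intro continuous_on_compose2[OF that] continuous_intros) auto
    then show ?thesis by (simp add: continuous_on)
  qed
  show "f (x, p) = g (x, p)"
  proof (cases "p = 0")
    case True
    have "\<forall>\<^sub>F q in at p. f (x, q) = g (x, q)"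
      using eq True by (auto simp: eventually_at_filter)
    then have "((\<lambda>q. f (x, q)) \<longlongrightarrow> g (x, p)) (at p)"
      using lim[OF assms(2)] by (simp add: tendsto_cong)
    then show ?thesis using lim[OF assms(1)] tendsto_unique[OF trivial_limit_at] by blast
  qed (use eq in auto)
qed

definition mult_p :: "(real \<times> real \<Rightarrow> complex) \<Rightarrow> real \<times> real \<Rightarrow> complex" where
  "mult_p f = (\<lambda>z. of_real (snd z) * f z)"

text \<open>The divided difference of \<open>f (x, _)\<close> at the node \<open>p\<close> taken \<open>a\<close> times and the node \<open>- p\<close> taken \<open>b\<close> times, with the Hermite--Genocchi integral when both nodes occur. The value \<open>0\<close> for the empty node list makes the identities \<open>divdiff_mult_p\<close> hold without exception.\<close>

fun divdiff :: "nat \<Rightarrow> nat \<Rightarrow> (real \<times> real \<Rightarrow> complex) \<Rightarrow> real \<times> real \<Rightarrow> complex" where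
  "divdiff 0 0 f = (\<lambda>_. 0)"
| "divdiff (Suc a) 0 f = (\<lambda>z. (partial_p ^^ a) f z / fact a)"
| "divdiff 0 (Suc b) f = (\<lambda>(x, p). (partial_p ^^ b) f (x, - p) / fact b)"
| "divdiff (Suc a) (Suc b) f =
     average (\<lambda>t. t ^ a * (1 - t) ^ b / (fact a * fact b)) (\<lambda>_. 1) (\<lambda>t. 2 * t - 1)
       ((partial_p ^^ (a + b + 1)) f)"

lemma reflection_eq_average: "(\<lambda>(x, p). f (x, - p)) = average (\<lambda>_. 1) (\<lambda>_. 1) (\<lambda>_. - 1) f"
  by (auto simp: average_def)

lemma C_infinity_reflection: "f \<in> C_infinity \<Longrightarrow> (\<lambda>(x, p). f (x, - p)) \<in> C_infinity"
  unfolding reflection_eq_average by (intro C_infinity_average continuous_intros)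

lemma has_bidegree_reflection: "has_bidegree f m n \<Longrightarrow> has_bidegree (\<lambda>(x, p). f (x, - p)) m n"
  unfolding reflection_eq_average by (intro has_bidegree_average continuous_intros)

lemma C_infinity_divdiff: "f \<in> C_infinity \<Longrightarrow> divdiff a b f \<in> C_infinity"
proof (induction a b f rule: divdiff.induct)
  case (2 a f)
  then show ?case using C_infinity_cmult[OF C_infinity_funpow_partial_p[OF 2], of "1 / fact a" a] by simp
next
  case (3 b f)
  then show ?case
    using C_infinity_cmult[OF C_infinity_reflection[OF C_infinity_funpow_partial_p[OF 3, of b]], of "1 / fact b"]
    by (simp add: case_prod_unfold)
next
  case (4 a b f)
  then show ?case
    unfolding divdiff.simps
    by (intro C_infinity_average continuous_intros C_infinity_funpow_partial_p) auto
qed (simp_all add: C_infinity_const)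

lemma divdiff_lincomb:
  assumes "f \<in> C_infinity" "g \<in> C_infinity"
  shows "divdiff a b (\<lambda>z. c * f z + d * g z) = (\<lambda>z. c * divdiff a b f z + d * divdiff a b g z)"
  using assms
proof (induction a b f rule: divdiff.induct)
  case (4 a b f)
  have "average (\<lambda>t. t ^ a * (1 - t) ^ b / (fact a * fact b)) (\<lambda>_. 1) (\<lambda>t. 2 * t - 1)
     (\<lambda>z. c * (partial_p ^^ (a + b + 1)) f z + d * (partial_p ^^ (a + b + 1)) g z) =
     (\<lambda>z. c * divdiff (Suc a) (Suc b) f z + d * divdiff (Suc a) (Suc b) g z)"
    unfolding divdiff.simps using 4
    by (intro average_lincomb continuous_intros C_infinity_funpow_partial_p) auto
  then show ?case
    by (simp only: divdiff.simps funpow_partial_p_lincomb[OF 4])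
qed (auto simp: funpow_partial_p_lincomb field_simps)

lemma has_bidegree_divdiff:
  "has_bidegree f m n \<Longrightarrow> has_bidegree (divdiff a b f) m (n + 1 - int a - int b)"
proof (induction a b f rule: divdiff.induct)
  case (2 a f)
  then show ?case using has_bidegree_cmult[OF has_bidegree_funpow_partial_p[OF 2, of a], of "1 / fact a"] by simp
next
  case (3 b f)
  then show ?case
    using has_bidegree_cmult[OF has_bidegree_reflection[OF has_bidegree_funpow_partial_p[OF 3, of b]], of "1 / fact b"]
    by (simp add: case_prod_unfold)
next
  case (4 a b f)
  have e: "n + 1 - int (Suc a) - int (Suc b) = n - int (a + b + 1)" by simp
  show ?case
    unfolding divdiff.simps e
    by (intro has_bidegree_average continuous_intros has_bidegree_funpow_partial_p 4) auto
qed (simp_all add: has_bidegree_zero)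

text \<open>This is the defining recursion of divided differences, obtained from the Hermite--Genocchi integral by integration by parts in \<open>t\<close>.\<close>

lemma divdiff_step:
  assumes f: "f \<in> C_infinity"
  shows "2 * of_real p * divdiff (Suc a) (Suc b) f (x, p) = divdiff (Suc a) b f (x, p) - divdiff a (Suc b) f (x, p)"
proof -
  define w where "w = (\<lambda>t::real. t ^ a * (1 - t) ^ b / (fact a * fact b))"
  define w' where "w' = (\<lambda>t::real. (of_nat a * t ^ (a - 1) * (1 - t) ^ b - of_nat b * t ^ a * (1 - t) ^ (b - 1)) / (fact a * fact b))"
  define \<phi> where "\<phi> = (\<lambda>t. (partial_p ^^ (a + b)) f (x, (2 * t - 1) * p))"
  define \<phi>' where "\<phi>' = (\<lambda>t. (partial_p ^^ (a + b + 1)) f (x, (2 * t - 1) * p))"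
  have w: "(w has_field_derivative w' t) (at t within {0..1})" for t
  proof -
    have "((\<lambda>t. t ^ a * (1 - t) ^ b) has_real_derivative
        of_nat a * (1 * t ^ (a - Suc 0)) * (1 - t) ^ b + of_nat b * ((0 - 1) * (1 - t) ^ (b - Suc 0)) * t ^ a)
        (at t within {0..1})"
      by (intro DERIV_mult DERIV_power DERIV_diff DERIV_const DERIV_ident)
    then have "((\<lambda>t. t ^ a * (1 - t) ^ b) has_real_derivative
        of_nat a * t ^ (a - 1) * (1 - t) ^ b - of_nat b * t ^ a * (1 - t) ^ (b - 1)) (at t within {0..1})"
      by (simp add: mult_ac)
    from DERIV_cdivide[OF this, of "fact a * fact b"] show ?thesis
      unfolding w_def w'_def .
  qed
  have \<phi>: "(\<phi> has_vector_derivative (2 * p) *\<^sub>R \<phi>' t) (at t within {0..1})" for t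
  proof -
    have "((\<lambda>q. (partial_p ^^ (a + b)) f (x, q)) \<circ> (\<lambda>t. (2 * t - 1) * p) has_vector_derivative (2 * p) *\<^sub>R \<phi>' t) (at t within {0..1})"
    proof (rule vector_diff_chain_within)
      show "((\<lambda>t. (2 * t - 1) * p) has_vector_derivative 2 * p) (at t within {0..1})"
        unfolding has_real_derivative_iff_has_vector_derivative[symmetric]
        by (auto intro!: derivative_eq_intros)
      show "((\<lambda>q. (partial_p ^^ (a + b)) f (x, q)) has_vector_derivative \<phi>' t)
          (at ((2 * t - 1) * p) within (\<lambda>t. (2 * t - 1) * p) ` {0..1})"
        unfolding \<phi>'_def
        using has_vector_derivative_at_within[OF has_vector_derivative_partial_p[OF C_infinity_funpow_partial_p[OF f, of "a + b"]]]
        by simp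
    qed
    then show ?thesis by (simp add: \<phi>_def o_def)
  qed
  have c\<phi>: "continuous_on {0..1} \<phi>" "continuous_on {0..1} \<phi>'"
    unfolding \<phi>_def \<phi>'_def
    by (intro continuous_on_compose2[OF C_infinity_continuous[OF C_infinity_funpow_partial_p[OF f], of UNIV]] continuous_intros; simp)+
  have cw: "continuous_on {0..1} w" "continuous_on {0..1} w'"
    unfolding w_def w'_def by (intro continuous_intros; simp)+
  have I1: "((\<lambda>t. of_real (w' t) * \<phi> t + 2 * of_real p * (of_real (w t) * \<phi>' t)) has_integral of_real (w 1) * \<phi> 1 - of_real (w 0) * \<phi> 0) {0..1}"
  proof (rule fundamental_theorem_of_calculus)
    fix t :: real
    have "((\<lambda>t. of_real (w t) * \<phi> t) has_vector_derivative of_real (w t) * ((2 * p) *\<^sub>R \<phi>' t) + of_real (w' t) * \<phi> t) (at t within {0..1})"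
      by (rule has_vector_derivative_mult[OF has_vector_derivative_of_real[OF w] \<phi>])
    then show "((\<lambda>t. of_real (w t) * \<phi> t) has_vector_derivative of_real (w' t) * \<phi> t + 2 * of_real p * (of_real (w t) * \<phi>' t)) (at t within {0..1})"
      by (simp add: scaleR_conv_of_real algebra_simps)
  qed simp
  have I2: "((\<lambda>t. 2 * of_real p * (of_real (w t) * \<phi>' t)) has_integral
      2 * of_real p * integral {0..1} (\<lambda>t. of_real (w t) * \<phi>' t)) {0..1}"
    by (intro has_integral_mult_right integrable_integral integrable_continuous_real continuous_intros c\<phi> cw)
  have "((\<lambda>t. of_real (w' t) * \<phi> t) has_integral
     (of_real (w 1) * \<phi> 1 - of_real (w 0) * \<phi> 0) - 2 * of_real p * integral {0..1} (\<lambda>t. of_real (w t) * \<phi>' t)) {0..1}"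
    using has_integral_diff[OF I1 I2] by simp
  then have ibp: "2 * of_real p * divdiff (Suc a) (Suc b) f (x, p) =
     of_real (w 1) * \<phi> 1 - of_real (w 0) * \<phi> 0 - integral {0..1} (\<lambda>t. of_real (w' t) * \<phi> t)"
    by (simp add: integral_unique average_def w_def \<phi>'_def)
  have part: "(\<lambda>t. of_real (t ^ i * (1 - t) ^ j / c) * \<phi> t) integrable_on {0..1}" for i j c
    unfolding of_real_divide by (cases "c = 0") (auto intro!: integrable_continuous_real continuous_intros c\<phi>)
  consider "a = 0" "b = 0" | b' where "a = 0" "b = Suc b'" | a' where "a = Suc a'" "b = 0"
    | a' b' where "a = Suc a'" "b = Suc b'"
    by (metis not0_implies_Suc)
  then show ?thesis
  proof cases
    case 1
    show ?thesis unfolding ibp using 1 by (simp add: w_def w'_def \<phi>_def)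
  next
    case 2
    have "w' t = - ((1 - t) ^ b' / fact b')" for t
      using 2 by (simp add: w'_def)
    then have "integral {0..1} (\<lambda>t. of_real (w' t) * \<phi> t) = - divdiff (Suc a) b f (x, p)"
      using 2 by (simp add: average_def \<phi>_def)
    then show ?thesis unfolding ibp using 2 by (simp add: w_def \<phi>_def)
  next
    case 3
    have "w' t = t ^ a' / fact a'" for t
      using 3 by (simp add: w'_def)
    then have "integral {0..1} (\<lambda>t. of_real (w' t) * \<phi> t) = divdiff a (Suc b) f (x, p)"
      using 3 by (simp add: average_def \<phi>_def)
    then show ?thesis unfolding ibp using 3 by (simp add: w_def \<phi>_def)
  next
    case 4
    have "w' t = t ^ a' * (1 - t) ^ b / (fact a' * fact b) - t ^ a * (1 - t) ^ b' / (fact a * fact b')" for t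
      using 4 by (simp add: w'_def diff_divide_distrib mult.assoc del: of_nat_Suc)
    then have "integral {0..1} (\<lambda>t. of_real (w' t) * \<phi> t) =
        integral {0..1} (\<lambda>t. of_real (t ^ a' * (1 - t) ^ b / (fact a' * fact b)) * \<phi> t -
          of_real (t ^ a * (1 - t) ^ b' / (fact a * fact b')) * \<phi> t)"
      by (simp only: of_real_diff left_diff_distrib)
    also have "\<dots> = integral {0..1} (\<lambda>t. of_real (t ^ a' * (1 - t) ^ b / (fact a' * fact b)) * \<phi> t) -
        integral {0..1} (\<lambda>t. of_real (t ^ a * (1 - t) ^ b' / (fact a * fact b')) * \<phi> t)"
      by (rule integral_diff[OF part part])
    also have "\<dots> = divdiff a (Suc b) f (x, p) - divdiff (Suc a) b f (x, p)"
      unfolding 4 divdiff.simps average_def \<phi>_def by simp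
    finally show ?thesis unfolding ibp using 4 by (simp add: w_def del: divdiff.simps)
  qed
qed

lemma funpow_partial_p_mult_p:
  assumes f: "f \<in> C_infinity"
  shows "(partial_p ^^ n) (mult_p f) =
    (\<lambda>z. of_real (snd z) * (partial_p ^^ n) f z + of_nat n * (partial_p ^^ (n - 1)) f z)"
  unfolding mult_p_def
proof (induction n)
  case (Suc n)
  have "partial_p (\<lambda>z. of_real (snd z) * (partial_p ^^ n) f z + of_nat n * (partial_p ^^ (n - 1)) f z) =
      (\<lambda>z. of_real (snd z) * (partial_p ^^ Suc n) f z + of_nat (Suc n) * (partial_p ^^ n) f z)"
  proof (rule partial_p_eqI)
    fix x p
    have d: "((\<lambda>t. (partial_p ^^ m) f (x, t)) has_vector_derivative (partial_p ^^ Suc m) f (x, p)) (at p)" for m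
      using has_vector_derivative_partial_p[OF C_infinity_funpow_partial_p[OF f]] by simp
    have "((\<lambda>t. of_real t * (partial_p ^^ n) f (x, t) + of_nat n * (partial_p ^^ (n - 1)) f (x, t))
       has_vector_derivative (of_real p * (partial_p ^^ Suc n) f (x, p) + of_real 1 * (partial_p ^^ n) f (x, p))
         + of_nat n * (partial_p ^^ Suc (n - 1)) f (x, p)) (at p)"
      by (rule has_vector_derivative_add[OF has_vector_derivative_mult[OF has_vector_derivative_of_real[OF DERIV_ident] d]
          has_vector_derivative_mult_right[OF d]])
    then show "((\<lambda>t. of_real (snd (x, t)) * (partial_p ^^ n) f (x, t) + of_nat n * (partial_p ^^ (n - 1)) f (x, t))
       has_vector_derivative of_real (snd (x, p)) * (partial_p ^^ Suc n) f (x, p) + of_nat (Suc n) * (partial_p ^^ n) f (x, p)) (at p)"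
      by (cases n) (simp_all add: algebra_simps)
  qed
  then show ?case using Suc by simp
qed simp

lemma C_infinity_snd: "(\<lambda>z. of_real (snd z)) \<in> C_infinity"
  using has_bidegree_C_infinity[OF has_bidegree_monomial[of 0 0 1 1 1]] by (simp add: case_prod_unfold)

lemma C_infinity_mult_p: "f \<in> C_infinity \<Longrightarrow> (mult_p f) \<in> C_infinity"
  unfolding mult_p_def by (rule C_infinity_mult[OF C_infinity_snd])

text \<open>For any node \<open>y\<^sub>j\<close>, the divided difference of \<open>y \<phi>(y)\<close> at \<open>y\<^sub>0, \<dots>, y\<^sub>j\<close> is \<open>y\<^sub>j \<phi>[y\<^sub>0, \<dots>, y\<^sub>j]\<close> plus the divided difference of \<open>\<phi>\<close> without that node. The two claims choose the node \<open>p\<close> or \<open>- p\<close>. Pure nodes are the Leibniz rule; mixed ones reduce to lower order by \<open>divdiff_step\<close>, which may be divided by \<open>p\<close> off the axis.\<close>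

lemma divdiff_mult_p_off_axis:
  assumes f: "f \<in> C_infinity" and p: "p \<noteq> 0"
  shows "divdiff (Suc a) b (mult_p f) (x, p) =
           of_real p * divdiff (Suc a) b f (x, p) + divdiff a b f (x, p) \<and>
         divdiff a (Suc b) (mult_p f) (x, p) =
           - of_real p * divdiff a (Suc b) f (x, p) + divdiff a b f (x, p)"
proof (induction "a + b" arbitrary: a b)
  case 0
  then show ?case by (simp add: mult_p_def)
next
  case (Suc n)
  note Cp = C_infinity_mult_p[OF f]
  have p2: "2 * of_real p \<noteq> (0::complex)" using p by simp
  have mixed: "divdiff (Suc a') (Suc b') (mult_p f) (x, p) =
      (divdiff (Suc a') b' f (x, p) + divdiff a' (Suc b') f (x, p)) / 2" if "n = a' + b'" for a' b'
  proof -
    have "2 * of_real p * divdiff (Suc a') (Suc b') (mult_p f) (x, p) =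
        2 * of_real p * ((divdiff (Suc a') b' f (x, p) + divdiff a' (Suc b') f (x, p)) / 2)"
      unfolding divdiff_step[OF Cp] Suc(1)[OF that, THEN conjunct1] Suc(1)[OF that, THEN conjunct2]
      by (simp add: algebra_simps del: divdiff.simps)
    then show ?thesis unfolding mult_left_cancel[OF p2] .
  qed
  have step: "of_real p * divdiff (Suc a') (Suc b') f (x, p) =
     (divdiff (Suc a') b' f (x, p) - divdiff a' (Suc b') f (x, p)) / 2" for a' b'
    using divdiff_step[OF f, of p a' b' x] by (simp add: field_simps)
  have half_sum: "X = q * Y + v \<and> X = - q * Y + u" if "X = (u + v) / 2" "q * Y = (u - v) / 2"
    for X Y u v q :: complex
  proof -
    have "u = 2 * (q * Y) + v" using that(2) by (simp add: field_simps)
    then show ?thesis unfolding that(1) by simp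
  qed
  have pure: "(partial_p ^^ Suc m) (mult_p f) (x, q) / fact (Suc m) =
     of_real q * ((partial_p ^^ Suc m) f (x, q) / fact (Suc m)) + (partial_p ^^ m) f (x, q) / fact m" for m q
    unfolding funpow_partial_p_mult_p[OF f] by (simp add: field_simps del: funpow.simps of_nat_Suc)
  show ?case
  proof
    show "divdiff (Suc a) b (mult_p f) (x, p) =
           of_real p * divdiff (Suc a) b f (x, p) + divdiff a b f (x, p)"
    proof (cases b)
      case 0
      then have "a = Suc n" using Suc by simp
      then show ?thesis using 0 pure[of n p] by (simp del: funpow.simps)
    next
      case (Suc b')
      then show ?thesis
        using mixed[of a b'] half_sum[OF refl step[of a b'], THEN conjunct1] \<open>Suc n = a + b\<close> by simp
    qed
    show "divdiff a (Suc b) (mult_p f) (x, p) =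
           - of_real p * divdiff a (Suc b) f (x, p) + divdiff a b f (x, p)"
    proof (cases a)
      case 0
      then have "b = Suc n" using Suc by simp
      then show ?thesis using 0 pure[of n "- p"] by (simp del: funpow.simps)
    next
      case (Suc a')
      then show ?thesis
        using mixed[of a' b] half_sum[OF refl step[of a' b], THEN conjunct2] \<open>Suc n = a + b\<close> by simp
    qed
  qed
qed

lemma divdiff_mult_p:
  assumes f: "f \<in> C_infinity"
  shows "divdiff (Suc a) b (mult_p f) =
           (\<lambda>z. of_real (snd z) * divdiff (Suc a) b f z + divdiff a b f z)"
    and "divdiff a (Suc b) (mult_p f) =
           (\<lambda>z. - of_real (snd z) * divdiff a (Suc b) f z + divdiff a b f z)"
  by (rule C_infinity_eqI_off_axis;
      (intro continuous_intros C_infinity_continuous C_infinity_divdiff C_infinity_mult_p f)?;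
      use divdiff_mult_p_off_axis[OF f] in simp)+

text \<open>Off the axis the recursion reduces to one-sided nodes, whose divided differences are derivatives; on the axis all dilated points of the integral coincide.\<close>

lemma divdiff_local:
  assumes f: "f \<in> C_infinity" "f' \<in> C_infinity"
    and jets: "\<And>i q. i \<le> a + b \<Longrightarrow> q = p \<or> q = - p \<Longrightarrow> (partial_p ^^ i) f (x, q) = (partial_p ^^ i) f' (x, q)"
  shows "divdiff a b f (x, p) = divdiff a b f' (x, p)"
  using jets
proof (induction "a + b" arbitrary: a b)
  case 0
  then show ?case by simp
next
  case (Suc n)
  show ?case
  proof (cases "a = 0 \<or> b = 0")
    case True
    then show ?thesis using Suc by (cases a; cases b) auto
  next
    case False
    then obtain a' b' where ab: "a = Suc a'" "b = Suc b'" by (meson not0_implies_Suc)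
    have j: "\<And>i q. i \<le> Suc (Suc (a' + b')) \<Longrightarrow> q = p \<or> q = - p \<Longrightarrow> (partial_p ^^ i) f (x, q) = (partial_p ^^ i) f' (x, q)"
      using Suc(3) ab by simp
    show ?thesis
    proof (cases "p = 0")
      case True
      then show ?thesis using j[of "a' + b' + 1" 0] by (simp add: ab average_def del: funpow.simps)
    next
      case False
      have "divdiff (Suc a') b' f (x, p) = divdiff (Suc a') b' f' (x, p)"
           "divdiff a' (Suc b') f (x, p) = divdiff a' (Suc b') f' (x, p)"
        using Suc(1)[of "Suc a'" b'] Suc(1)[of a' "Suc b'"] Suc(2) ab j by auto
      then have "2 * of_real p * divdiff (Suc a') (Suc b') f (x, p) = 2 * of_real p * divdiff (Suc a') (Suc b') f' (x, p)"
        unfolding divdiff_step[OF f(1)] divdiff_step[OF f(2)] by simp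
      moreover have "2 * of_real p \<noteq> (0::complex)" using False by simp
      ultimately show ?thesis unfolding ab using mult_left_cancel by blast
    qed
  qed
qed


section \<open>The bilinear operators\<close>

definition symbol_D :: "(real \<times> real \<Rightarrow> complex) \<Rightarrow> real \<times> real \<Rightarrow> complex" where
  "symbol_D g = (\<lambda>z. - \<i> * partial_x g z)"

text \<open>The reflected difference quotient \<open>- \<i> (g (x, - p) - g (- x, - p)) / x\<close>, as an average of the derivative so that it is defined and smooth also at \<open>x = 0\<close>.\<close>

definition symbol_R :: "(real \<times> real \<Rightarrow> complex) \<Rightarrow> real \<times> real \<Rightarrow> complex" where
  "symbol_R g = (\<lambda>z. - 2 * \<i> * average (\<lambda>_. 1) (\<lambda>t. 2 * t - 1) (\<lambda>_. - 1) (partial_x g) z)"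

lemma C_infinity_symbol_D: "g \<in> C_infinity \<Longrightarrow> symbol_D g \<in> C_infinity"
  unfolding symbol_D_def by (intro C_infinity_cmult C_infinity_partial_x)

lemma C_infinity_symbol_R: "g \<in> C_infinity \<Longrightarrow> symbol_R g \<in> C_infinity"
  unfolding symbol_R_def by (intro C_infinity_cmult C_infinity_average C_infinity_partial_x continuous_intros)

lemma symbol_D_lincomb:
  "f \<in> C_infinity \<Longrightarrow> g \<in> C_infinity \<Longrightarrow>
    symbol_D (\<lambda>z. c * f z + d * g z) = (\<lambda>z. c * symbol_D f z + d * symbol_D g z)"
  by (auto simp: symbol_D_def partial_x_lincomb algebra_simps)

lemma symbol_R_lincomb:
  assumes "f \<in> C_infinity" "g \<in> C_infinity"
  shows "symbol_R (\<lambda>z. c * f z + d * g z) = (\<lambda>z. c * symbol_R f z + d * symbol_R g z)"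
proof -
  have "average (\<lambda>_. 1) (\<lambda>t. 2 * t - 1) (\<lambda>_. - 1) (\<lambda>z. c * partial_x f z + d * partial_x g z) =
    (\<lambda>z. c * average (\<lambda>_. 1) (\<lambda>t. 2 * t - 1) (\<lambda>_. - 1) (partial_x f) z +
         d * average (\<lambda>_. 1) (\<lambda>t. 2 * t - 1) (\<lambda>_. - 1) (partial_x g) z)"
    by (intro average_lincomb continuous_intros C_infinity_partial_x assms)
  then show ?thesis
    unfolding symbol_R_def partial_x_lincomb[OF assms] by (simp add: algebra_simps)
qed

lemma has_bidegree_symbol_D: "has_bidegree g m n \<Longrightarrow> has_bidegree (symbol_D g) (m - 1) n"
  unfolding symbol_D_def by (intro has_bidegree_cmult has_bidegree_partial_x)

lemma has_bidegree_symbol_R: "has_bidegree g m n \<Longrightarrow> has_bidegree (symbol_R g) (m - 1) n"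
  unfolding symbol_R_def
  by (intro has_bidegree_cmult has_bidegree_average has_bidegree_partial_x continuous_intros)

text \<open>The fundamental theorem of calculus along the segment from \<open>- x\<close> to \<open>x\<close>.\<close>

lemma mult_x_symbol_R:
  assumes g: "g \<in> C_infinity"
  shows "of_real x * symbol_R g (x, p) = - \<i> * (g (x, - p) - g (- x, - p))"
proof -
  have "((\<lambda>t. 2 * of_real x * partial_x g ((2 * t - 1) * x, - p)) has_integral
      g ((2 * 1 - 1) * x, - p) - g ((2 * 0 - 1) * x, - p)) {0..1}"
  proof (rule fundamental_theorem_of_calculus)
    fix t :: real
    have "((\<lambda>q. g (q, - p)) \<circ> (\<lambda>t. (2 * t - 1) * x) has_vector_derivative (2 * x) *\<^sub>R partial_x g ((2 * t - 1) * x, - p)) (at t within {0..1})"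
    proof (rule vector_diff_chain_within)
      show "((\<lambda>t. (2 * t - 1) * x) has_vector_derivative 2 * x) (at t within {0..1})"
        unfolding has_real_derivative_iff_has_vector_derivative[symmetric]
        by (auto intro!: derivative_eq_intros)
    qed (rule has_vector_derivative_at_within[OF has_vector_derivative_partial_x[OF g]])
    then show "((\<lambda>t. g ((2 * t - 1) * x, - p)) has_vector_derivative 2 * of_real x * partial_x g ((2 * t - 1) * x, - p)) (at t within {0..1})"
      by (simp add: o_def scaleR_conv_of_real)
  qed simp
  from integral_unique[OF this]
  have "2 * of_real x * integral {0..1} (\<lambda>t. partial_x g ((2 * t - 1) * x, - p)) = g (x, - p) - g (- x, - p)"
    unfolding integral_mult_right by simp
  moreover have "of_real x * symbol_R g (x, p) =
      - \<i> * (2 * of_real x * integral {0..1} (\<lambda>t. partial_x g ((2 * t - 1) * x, - p)))"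
    by (simp add: symbol_R_def average_def)
  ultimately show ?thesis by simp
qed

lemma partial_x_mult_p:
  assumes "g \<in> C_infinity"
  shows "partial_x (mult_p g) = mult_p (partial_x g)"
  unfolding mult_p_def
  by (rule partial_x_eqI) (auto intro!: has_vector_derivative_mult_right has_vector_derivative_partial_x assms)

lemma symbol_D_mult_p: "g \<in> C_infinity \<Longrightarrow> symbol_D (mult_p g) = mult_p (symbol_D g)"
  by (simp add: symbol_D_def partial_x_mult_p) (simp add: mult_p_def mult_ac)

lemma symbol_R_mult_p:
  "g \<in> C_infinity \<Longrightarrow> symbol_R (mult_p g) = (\<lambda>z. - mult_p (symbol_R g) z)"
  by (simp add: symbol_R_def partial_x_mult_p) (auto simp: average_def mult_p_def mult_ac)

text \<open>The sum over all words of length \<open>j\<close> with \<open>l\<close> letters \<open>R\<close>. The letters are consumed in the order in which they act on \<open>g\<close>. The sign of the node belonging to a letter is the parity of the number of letters \<open>R\<close> from that letter on, that is, the parity of \<open>l\<close>; \<open>a\<close> and \<open>b\<close> count the nodes \<open>p\<close> and \<open>- p\<close> collected so far. The empty word contributes one more node \<open>p\<close>.\<close>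

primrec star :: "nat \<Rightarrow> nat \<Rightarrow> nat \<Rightarrow> nat \<Rightarrow> bioperator" where
  "star 0 l a b f g = (if l = 0 then (\<lambda>z. divdiff (Suc a) b f z * g z) else (\<lambda>_. 0))"
| "star (Suc j) l a b f g =
    (let a' = (if even l then Suc a else a); b' = (if even l then b else Suc b) in
      (\<lambda>z. star j l a' b' f (symbol_D g) z + (if l = 0 then 0 else star j (l - 1) a' b' f (symbol_R g) z)))"

lemma C_infinity_star: "f \<in> C_infinity \<Longrightarrow> g \<in> C_infinity \<Longrightarrow> star j l a b f g \<in> C_infinity"
proof (induction j arbitrary: l a b g)
  case 0
  then show ?case by (auto simp: C_infinity_const simp del: divdiff.simps intro!: C_infinity_mult C_infinity_divdiff)
next
  case (Suc j)
  note IH = Suc.IH[OF Suc.prems(1) C_infinity_symbol_D[OF Suc.prems(2)]]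
    Suc.IH[OF Suc.prems(1) C_infinity_symbol_R[OF Suc.prems(2)]]
  show ?case by (cases "l = 0") (auto simp: Let_def intro!: C_infinity_add IH)
qed

lemma star_lincomb_left:
  assumes "f \<in> C_infinity" "f' \<in> C_infinity"
  shows "star j l a b (\<lambda>z. c * f z + d * f' z) g = (\<lambda>z. c * star j l a b f g z + d * star j l a b f' g z)"
proof (induction j arbitrary: l a b g)
  case 0
  then show ?case by (auto simp: divdiff_lincomb[OF assms] algebra_simps simp del: divdiff.simps)
next
  case (Suc j)
  then show ?case by (auto simp: Let_def algebra_simps)
qed

lemma star_lincomb_right:
  "g \<in> C_infinity \<Longrightarrow> g' \<in> C_infinity \<Longrightarrow>
    star j l a b f (\<lambda>z. c * g z + d * g' z) = (\<lambda>z. c * star j l a b f g z + d * star j l a b f g' z)"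
proof (induction j arbitrary: l a b g g')
  case 0
  then show ?case by (auto simp: algebra_simps simp del: divdiff.simps)
next
  case (Suc j)
  then show ?case
    by (auto simp: Let_def algebra_simps symbol_D_lincomb symbol_R_lincomb C_infinity_symbol_D C_infinity_symbol_R)
qed

lemma star_eq_0: "l > j \<Longrightarrow> star j l a b f g = (\<lambda>_. 0)"
  by (induction j arbitrary: l a b g) (auto simp: Let_def)

lemma has_bidegree_star:
  assumes "has_bidegree f m n"
  shows "has_bidegree g m' n' \<Longrightarrow> has_bidegree (star j l a b f g) (m + m' - int j) (n + n' - int a - int b - int j)"
proof (induction j arbitrary: l a b g m')
  case 0
  then show ?case
    using has_bidegree_mult[OF has_bidegree_divdiff[OF assms, of "Suc a" b] 0]
    by (auto simp: has_bidegree_zero algebra_simps simp del: divdiff.simps)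
next
  case (Suc j)
  define a' where "a' = (if even l then Suc a else a)"
  define b' where "b' = (if even l then b else Suc b)"
  have e: "m + (m' - 1) - int j = m + m' - int (Suc j)"
    "n + n' - int a' - int b' - int j = n + n' - int a - int b - int (Suc j)"
    by (auto simp: a'_def b'_def)
  have "has_bidegree (star j l a' b' f (symbol_D g)) (m + m' - int (Suc j)) (n + n' - int a - int b - int (Suc j))"
    "has_bidegree (star j (l - 1) a' b' f (symbol_R g)) (m + m' - int (Suc j)) (n + n' - int a - int b - int (Suc j))"
    using Suc.IH[OF has_bidegree_symbol_D[OF Suc.prems], of l a' b']
      Suc.IH[OF has_bidegree_symbol_R[OF Suc.prems], of "l - 1" a' b'] unfolding e by auto
  then have "has_bidegree (\<lambda>z. star j l a' b' f (symbol_D g) z + (if l = 0 then 0 else star j (l - 1) a' b' f (symbol_R g) z))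
    (m + m' - int (Suc j)) (n + n' - int a - int b - int (Suc j))"
    by (cases "l = 0") (auto intro: has_bidegree_add)
  then show ?case unfolding star.simps Let_def a'_def b'_def .
qed

text \<open>These are the identities \<open>divdiff_mult_p\<close>, carried through the linear recursion of \<open>star\<close>.\<close>

lemma star_mult_p_left:
  assumes f: "f \<in> C_infinity"
  shows "star j l (Suc a) b (mult_p f) g =
           (\<lambda>z. of_real (snd z) * star j l (Suc a) b f g z + star j l a b f g z)"
    and "star j l a (Suc b) (mult_p f) g =
           (\<lambda>z. - of_real (snd z) * star j l a (Suc b) f g z + star j l a b f g z)"
proof (induction j arbitrary: l a b g)
  case 0
  {
    case 1
    show ?case by (auto simp: divdiff_mult_p[OF f] ring_distribs mult_ac simp del: divdiff.simps)
  next
    case 2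
    show ?case by (auto simp: divdiff_mult_p[OF f] ring_distribs mult_ac simp del: divdiff.simps)
  }
next
  case (Suc j)
  {
    case 1
    show ?case by (auto simp: Let_def Suc(1) algebra_simps)
  next
    case 2
    show ?case by (auto simp: Let_def Suc(2) algebra_simps)
  }
qed

text \<open>Multiplication by \<open>p\<close> commutes with \<open>D\<close> and changes sign at each of the \<open>l\<close> letters \<open>R\<close>.\<close>

lemma star_mult_p_right:
  "g \<in> C_infinity \<Longrightarrow> star j l a b f (mult_p g) =
    (\<lambda>z. (- 1) ^ l * of_real (snd z) * star j l a b f g z)"
proof (induction j arbitrary: l a b g)
  case 0
  then show ?case by (auto simp: mult_p_def algebra_simps simp del: divdiff.simps)
next
  case (Suc j)
  have "star j l a b f (\<lambda>z. - mult_p (symbol_R g) z) =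
      (\<lambda>z. - ((- 1) ^ l * of_real (snd z) * star j l a b f (symbol_R g) z))" for l a b
    using star_lincomb_right[OF C_infinity_mult_p[OF C_infinity_symbol_R[OF Suc.prems]] C_infinity_const,
        of j l a b f "- 1" 0 0] Suc.IH[OF C_infinity_symbol_R[OF Suc.prems]] by simp
  then show ?case
    using Suc.IH[OF C_infinity_symbol_D[OF Suc.prems]]
    by (cases l) (auto simp: Let_def symbol_D_mult_p[OF Suc.prems] symbol_R_mult_p[OF Suc.prems] algebra_simps)
qed

lemma star_shift_0:
  assumes "f \<in> C_infinity" "g \<in> C_infinity"
  shows "star 0 l 0 0 (mult_p f) g = star 0 l 0 0 f (mult_p g)"
  by (auto simp: mult_p_def mult_ac)

text \<open>The last node of a word with \<open>l\<close> letters \<open>R\<close> is \<open>(- 1)\<^sup>l p\<close>. Removing it from the divided differences leaves the words of length \<open>j\<close>, and the factor \<open>(- 1)\<^sup>l p\<close> is what moving \<open>p\<close> through the word to the right produces.\<close>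

lemma star_shift_Suc:
  assumes f: "f \<in> C_infinity" and g: "g \<in> C_infinity"
  shows "star (Suc j) l 0 0 (mult_p f) g =
    (\<lambda>z. star (Suc j) l 0 0 f (mult_p g) z + star j l 0 0 f (symbol_D g) z
       + (if l = 0 then 0 else star j (l - 1) 0 0 f (symbol_R g) z))"
  unfolding star_mult_p_right[OF g]
  by (auto simp: Let_def star_mult_p_left[OF f] algebra_simps)

lemma divdiff_eq_0:
  assumes "f \<in> C_infinity" "partial_p f = (\<lambda>_. 0)" "a + b \<ge> 2"
  shows "divdiff a b f = (\<lambda>_. 0)"
proof -
  have z: "(partial_p ^^ Suc n) f = (\<lambda>_. 0)" for n
    by (induction n) (simp_all add: assms partial_p_zero)
  show ?thesis
  proof (intro ext, clarify)
    fix x p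
    show "divdiff a b f (x, p) = 0"
      using assms(3) z[of "a - 2"] z[of "b - 2"] z[of "a - 1 + (b - 1)"]
      by (cases a; cases b) (auto simp: average_def numeral_2_eq_2 Suc_diff_Suc Suc_le_eq gr0_conv_Suc)
  qed
qed

lemma star_eq_0_of_no_p:
  assumes "f \<in> C_infinity" "partial_p f = (\<lambda>_. 0)" "a + b + j \<ge> 1"
  shows "star j l a b f g = (\<lambda>_. 0)"
  using assms(3)
proof (induction j arbitrary: l a b g)
  case 0
  then have "divdiff (Suc a) b f = (\<lambda>_. 0)"
    by (intro divdiff_eq_0 assms) auto
  then show ?case by (auto simp del: divdiff.simps)
next
  case (Suc j)
  then show ?case by (auto simp: Let_def)
qed

subsection \<open>Locality\<close>

lemma funpow_partial_x_mult_x: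
  assumes f: "f \<in> C_infinity"
  shows "(partial_x ^^ n) (\<lambda>z. of_real (fst z) * f z) =
    (\<lambda>z. of_real (fst z) * (partial_x ^^ n) f z + of_nat n * (partial_x ^^ (n - 1)) f z)"
proof (induction n)
  case (Suc n)
  have "partial_x (\<lambda>z. of_real (fst z) * (partial_x ^^ n) f z + of_nat n * (partial_x ^^ (n - 1)) f z) =
      (\<lambda>z. of_real (fst z) * (partial_x ^^ Suc n) f z + of_nat (Suc n) * (partial_x ^^ n) f z)"
  proof (rule partial_x_eqI)
    fix x p
    have d: "((\<lambda>t. (partial_x ^^ m) f (t, p)) has_vector_derivative (partial_x ^^ Suc m) f (x, p)) (at x)" for m
      using has_vector_derivative_partial_x[OF C_infinity_funpow_partial_x[OF f]] by simp
    have "((\<lambda>t. of_real t * (partial_x ^^ n) f (t, p) + of_nat n * (partial_x ^^ (n - 1)) f (t, p))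
       has_vector_derivative (of_real x * (partial_x ^^ Suc n) f (x, p) + of_real 1 * (partial_x ^^ n) f (x, p))
         + of_nat n * (partial_x ^^ Suc (n - 1)) f (x, p)) (at x)"
      by (rule has_vector_derivative_add[OF has_vector_derivative_mult[OF has_vector_derivative_of_real[OF DERIV_ident] d]
          has_vector_derivative_mult_right[OF d]])
    then show "((\<lambda>t. of_real (fst (t, p)) * (partial_x ^^ n) f (t, p) + of_nat n * (partial_x ^^ (n - 1)) f (t, p))
       has_vector_derivative of_real (fst (x, p)) * (partial_x ^^ Suc n) f (x, p) + of_nat (Suc n) * (partial_x ^^ n) f (x, p)) (at x)"
      by (cases n) (simp_all add: algebra_simps)
  qed
  then show ?case using Suc by simp
qed simp

lemma funpow_partial_x_reflected_difference:
  assumes f: "f \<in> C_infinity"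
  shows "(partial_x ^^ n) (\<lambda>(x, p). - \<i> * (f (x, - p) - f (- x, - p))) =
    (\<lambda>(x, p). - \<i> * ((partial_x ^^ n) f (x, - p) - (- 1) ^ n * (partial_x ^^ n) f (- x, - p)))"
proof (induction n)
  case (Suc n)
  have "partial_x (\<lambda>(x, p). - \<i> * ((partial_x ^^ n) f (x, - p) - (- 1) ^ n * (partial_x ^^ n) f (- x, - p))) =
    (\<lambda>(x, p). - \<i> * ((partial_x ^^ Suc n) f (x, - p) - (- 1) ^ Suc n * (partial_x ^^ Suc n) f (- x, - p)))"
  proof (rule partial_x_eqI)
    fix x p
    have d: "((\<lambda>t. (partial_x ^^ n) f (t, - p)) has_vector_derivative (partial_x ^^ Suc n) f (x, - p)) (at x)" for x
      using has_vector_derivative_partial_x[OF C_infinity_funpow_partial_x[OF f]] by simp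
    have "((\<lambda>t. (partial_x ^^ n) f (t, - p)) \<circ> (\<lambda>t. - t) has_vector_derivative (- 1) *\<^sub>R (partial_x ^^ Suc n) f (- x, - p)) (at x)"
      by (rule vector_diff_chain_at[OF _ d]) (auto intro!: derivative_eq_intros simp flip: has_real_derivative_iff_has_vector_derivative)
    then have d': "((\<lambda>t. (partial_x ^^ n) f (- t, - p)) has_vector_derivative - (partial_x ^^ Suc n) f (- x, - p)) (at x)"
      by (simp add: o_def)
    have "((\<lambda>t. - \<i> * ((partial_x ^^ n) f (t, - p) - (- 1) ^ n * (partial_x ^^ n) f (- t, - p)))
      has_vector_derivative - \<i> * ((partial_x ^^ Suc n) f (x, - p) - (- 1) ^ n * - (partial_x ^^ Suc n) f (- x, - p))) (at x)"
      by (intro has_vector_derivative_diff has_vector_derivative_mult_right d d')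
    then show "((\<lambda>t. case (t, p) of (x, p) \<Rightarrow> - \<i> * ((partial_x ^^ n) f (x, - p) - (- 1) ^ n * (partial_x ^^ n) f (- x, - p)))
      has_vector_derivative (case (x, p) of (x, p) \<Rightarrow> - \<i> * ((partial_x ^^ Suc n) f (x, - p) - (- 1) ^ Suc n * (partial_x ^^ Suc n) f (- x, - p)))) (at x)"
      by simp
  qed
  then show ?case using Suc by simp
qed simp

text \<open>The product \<open>x R g\<close> is a reflected difference of \<open>g\<close>. Its \<open>i\<close>th derivative is \<open>x (R g)\<^sup>(\<^sup>i\<^sup>) + i (R g)\<^sup>(\<^sup>i\<^sup>-\<^sup>1\<^sup>)\<close>, from which the jets of \<open>R g\<close> can be recovered at \<open>x \<noteq> 0\<close> by induction and at \<open>x = 0\<close> with the loss of one order.\<close>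

lemma symbol_R_flat:
  assumes g: "g \<in> C_infinity"
    and flat: "\<And>i. i \<le> Suc N \<Longrightarrow> (partial_x ^^ i) g (x, - p) = 0 \<and> (partial_x ^^ i) g (- x, - p) = 0"
  shows "i \<le> N \<Longrightarrow> (partial_x ^^ i) (symbol_R g) (x, p) = 0"
proof -
  note C = C_infinity_symbol_R[OF g]
  have "(\<lambda>z. of_real (fst z) * symbol_R g z) = (\<lambda>(x, p). - \<i> * (g (x, - p) - g (- x, - p)))"
    using mult_x_symbol_R[OF g] by auto
  then have "of_real x * (partial_x ^^ i) (symbol_R g) (x, p) + of_nat i * (partial_x ^^ (i - 1)) (symbol_R g) (x, p) =
      - \<i> * ((partial_x ^^ i) g (x, - p) - (- 1) ^ i * (partial_x ^^ i) g (- x, - p))" for i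
    using funpow_partial_x_reflected_difference[OF g, of i] funpow_partial_x_mult_x[OF C, of i]
    by (metis (no_types, lifting) case_prod_conv fst_conv)
  then have eq: "of_real x * (partial_x ^^ i) (symbol_R g) (x, p) + of_nat i * (partial_x ^^ (i - 1)) (symbol_R g) (x, p) = 0"
    if "i \<le> Suc N" for i
    using flat[OF that] by simp
  show "i \<le> N \<Longrightarrow> (partial_x ^^ i) (symbol_R g) (x, p) = 0"
  proof (cases "x = 0")
    case True
    assume "i \<le> N"
    then show ?thesis using eq[of "Suc i"] True by (simp del: funpow.simps of_nat_Suc)
  next
    case False
    assume "i \<le> N"
    then show ?thesis
    proof (induction i)
      case 0
      then show ?case using eq[of 0] False by simp
    next
      case (Suc i)
      then show ?case using eq[of "Suc i"] False by (simp del: funpow.simps)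
    qed
  qed
qed

lemma symbol_R_local:
  assumes g: "g \<in> C_infinity" "g' \<in> C_infinity"
    and jets: "\<And>i. i \<le> Suc N \<Longrightarrow> (partial_x ^^ i) g (x, - p) = (partial_x ^^ i) g' (x, - p) \<and>
       (partial_x ^^ i) g (- x, - p) = (partial_x ^^ i) g' (- x, - p)"
    and i: "i \<le> N"
  shows "(partial_x ^^ i) (symbol_R g) (x, p) = (partial_x ^^ i) (symbol_R g') (x, p)"
proof -
  have "(partial_x ^^ i) (symbol_R (\<lambda>z. 1 * g z + (- 1) * g' z)) (x, p) = 0"
    by (rule symbol_R_flat[OF C_infinity_lincomb[OF g] _ i])
      (use jets funpow_partial_x_lincomb[OF g, of _ 1 "- 1"] in simp)
  then show ?thesis
    unfolding symbol_R_lincomb[OF g] funpow_partial_x_lincomb[OF C_infinity_symbol_R[OF g(1)] C_infinity_symbol_R[OF g(2)]]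
    by simp
qed

lemma star_local:
  assumes f: "f \<in> C_infinity" "f' \<in> C_infinity"
  shows "g \<in> C_infinity \<Longrightarrow> g' \<in> C_infinity \<Longrightarrow>
    (\<And>i q. i \<le> a + b + j + 1 \<Longrightarrow> q = p \<or> q = - p \<Longrightarrow> (partial_p ^^ i) f (x, q) = (partial_p ^^ i) f' (x, q)) \<Longrightarrow>
    (\<And>i y q. i \<le> j \<Longrightarrow> y = x \<or> y = - x \<Longrightarrow> q = p \<or> q = - p \<Longrightarrow> (partial_x ^^ i) g (y, q) = (partial_x ^^ i) g' (y, q)) \<Longrightarrow>
    star j l a b f g (x, p) = star j l a b f' g' (x, p)"
proof (induction j arbitrary: l a b g g')
  case 0
  have "divdiff (Suc a) b f (x, p) = divdiff (Suc a) b f' (x, p)"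
    by (rule divdiff_local[OF f]) (use 0(3) in auto)
  moreover have "g (x, p) = g' (x, p)" using 0(4)[of 0 x p] by simp
  ultimately show ?case by (simp del: divdiff.simps)
next
  case (Suc j)
  have D: "(partial_x ^^ i) (symbol_D h) = (\<lambda>z. - \<i> * (partial_x ^^ Suc i) h z)" if "h \<in> C_infinity" for h i
    using funpow_partial_x_lincomb[OF C_infinity_partial_x[OF that] C_infinity_const, of i "- \<i>" 0 0]
    by (simp add: symbol_D_def funpow_Suc_right del: funpow.simps)
  define a' where "a' = (if even l then Suc a else a)"
  define b' where "b' = (if even l then b else Suc b)"
  have fj: "\<And>i q. i \<le> a' + b' + j + 1 \<Longrightarrow> q = p \<or> q = - p \<Longrightarrow> (partial_p ^^ i) f (x, q) = (partial_p ^^ i) f' (x, q)"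
    by (rule Suc.prems(3)) (auto simp: a'_def b'_def split: if_splits)
  have "star j l a' b' f (symbol_D g) (x, p) = star j l a' b' f' (symbol_D g') (x, p)" for l
  proof (rule Suc.IH[OF C_infinity_symbol_D[OF Suc.prems(1)] C_infinity_symbol_D[OF Suc.prems(2)] fj])
    fix i y q assume "i \<le> j" "y = x \<or> y = - x" "q = p \<or> q = - p"
    then show "(partial_x ^^ i) (symbol_D g) (y, q) = (partial_x ^^ i) (symbol_D g') (y, q)"
      unfolding D[OF Suc.prems(1)] D[OF Suc.prems(2)] using Suc.prems(4)[of "Suc i" y q]
      by (simp del: funpow.simps)
  qed auto
  moreover have "star j l a' b' f (symbol_R g) (x, p) = star j l a' b' f' (symbol_R g') (x, p)" for l
  proof (rule Suc.IH[OF C_infinity_symbol_R[OF Suc.prems(1)] C_infinity_symbol_R[OF Suc.prems(2)] fj])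
    fix i y q assume i: "i \<le> j" and yq: "y = x \<or> y = - x" "q = p \<or> q = - p"
    show "(partial_x ^^ i) (symbol_R g) (y, q) = (partial_x ^^ i) (symbol_R g') (y, q)"
      by (rule symbol_R_local[OF Suc.prems(1,2) _ i]) (use Suc.prems(4) yq in auto)
  qed auto
  ultimately show ?case by (simp add: Let_def a'_def b'_def)
qed

lemma bilinear_operator_star: "bilinear_operator (star j l a b)"
  unfolding bilinear_operator_def
  by (auto simp: C_infinity_star star_lincomb_left star_lincomb_right)

lemma gamma_local_star: "gamma_local (star j l a b)"
  unfolding gamma_local_def
proof (intro allI)
  fix x p
  show "\<exists>N. \<forall>f\<in>C_infinity. \<forall>g\<in>C_infinity. \<forall>f'\<in>C_infinity. \<forall>g'\<in>C_infinity.
       (\<forall>z\<in>{(x, p), (- x, p), (x, - p), (- x, - p)}. same_jet N z f f' \<and> same_jet N z g g') \<longrightarrow>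
       star j l a b f g (x, p) = star j l a b f' g' (x, p)"
  proof (intro exI[where x = "a + b + j + 1"] ballI impI)
    fix f g f' g'
    assume C: "f \<in> C_infinity" "g \<in> C_infinity" "f' \<in> C_infinity" "g' \<in> C_infinity"
      and J: "\<forall>z\<in>{(x, p), (- x, p), (x, - p), (- x, - p)}. same_jet (a + b + j + 1) z f f' \<and> same_jet (a + b + j + 1) z g g'"
    show "star j l a b f g (x, p) = star j l a b f' g' (x, p)"
    proof (rule star_local[OF C(1,3,2,4)])
      fix i q assume "i \<le> a + b + j + 1" "q = p \<or> q = - p"
      then have "same_jet (a + b + j + 1) (x, q) f f'" "0 + i \<le> a + b + j + 1" using J by auto
      then have "(partial_x ^^ 0) ((partial_p ^^ i) f) (x, q) = (partial_x ^^ 0) ((partial_p ^^ i) f') (x, q)"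
        unfolding same_jet_def by blast
      then show "(partial_p ^^ i) f (x, q) = (partial_p ^^ i) f' (x, q)" by simp
    next
      fix i y q assume "i \<le> j" "y = x \<or> y = - x" "q = p \<or> q = - p"
      then have "same_jet (a + b + j + 1) (y, q) g g'" "i + 0 \<le> a + b + j + 1" using J by auto
      then have "(partial_x ^^ i) ((partial_p ^^ 0) g) (y, q) = (partial_x ^^ i) ((partial_p ^^ 0) g') (y, q)"
        unfolding same_jet_def by blast
      then show "(partial_x ^^ i) g (y, q) = (partial_x ^^ i) g' (y, q)" by simp
    qed
  qed
qed

section \<open>The Schwartz space\<close>

definition rapid :: "(real \<Rightarrow> complex) \<Rightarrow> bool" where
  "rapid f \<longleftrightarrow> (\<forall>m. \<exists>C. \<forall>x. norm (of_real x ^ m * f x) \<le> C)"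

lemma rapid_lincomb:
  assumes "rapid f" "rapid g"
  shows "rapid (\<lambda>x. a * f x + b * g x)"
  unfolding rapid_def
proof
  fix m
  obtain C D where C: "\<And>x. norm (of_real x ^ m * f x) \<le> C" and D: "\<And>x. norm (of_real x ^ m * g x) \<le> D"
    using assms unfolding rapid_def by metis
  have "norm (of_real x ^ m * (a * f x + b * g x)) \<le> norm a * C + norm b * D" for x
  proof -
    have "norm (of_real x ^ m * (a * f x + b * g x)) = norm (a * (of_real x ^ m * f x) + b * (of_real x ^ m * g x))"
      by (simp add: algebra_simps)
    also have "\<dots> \<le> norm (a * (of_real x ^ m * f x)) + norm (b * (of_real x ^ m * g x))"
      by (rule norm_triangle_ineq)
    also have "\<dots> = norm a * norm (of_real x ^ m * f x) + norm b * norm (of_real x ^ m * g x)"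
      by (simp only: norm_mult)
    also have "\<dots> \<le> norm a * C + norm b * D"
      by (intro add_mono mult_left_mono C D norm_ge_zero)
    finally show ?thesis .
  qed
  then show "\<exists>C. \<forall>x. norm (of_real x ^ m * (a * f x + b * g x)) \<le> C" by blast
qed

lemma rapid_mult_x: "rapid f \<Longrightarrow> rapid (\<lambda>x. of_real x * f x)"
  unfolding rapid_def
proof
  fix m assume "\<forall>m. \<exists>C. \<forall>x. norm (of_real x ^ m * f x) \<le> C"
  then obtain C where "\<And>x. norm (of_real x ^ Suc m * f x) \<le> C" by blast
  then show "\<exists>C. \<forall>x. norm (of_real x ^ m * (of_real x * f x)) \<le> C"
    by (intro exI[of _ C]) (simp add: mult_ac)
qed

lemma rapid_reflect:
  assumes "rapid f"
  shows "rapid (\<lambda>x. f (- x))"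
  unfolding rapid_def
proof
  fix m
  obtain C where C: "\<And>x. norm (of_real x ^ m * f x) \<le> C" using assms unfolding rapid_def by blast
  have "norm (of_real x ^ m * f (- x)) \<le> C" for x
    using C[of "- x"] by (simp add: norm_mult norm_power)
  then show "\<exists>C. \<forall>x. norm (of_real x ^ m * f (- x)) \<le> C" by blast
qed

lemma schwartz_iff:
  "f \<in> schwartz \<longleftrightarrow> (\<forall>n x. (vderiv ^^ n) f differentiable (at x)) \<and> (\<forall>n. rapid ((vderiv ^^ n) f))"
  unfolding schwartz_def rapid_def bounded_iff by auto

text \<open>The counterpart of \<open>C_infinity_coinduct\<close> for rapidly decreasing functions.\<close>

lemma schwartz_coinduct:
  assumes "u \<in> V"
    and deriv: "\<And>u. u \<in> V \<Longrightarrow> \<exists>u'\<in>V. \<forall>x. (u has_vector_derivative u' x) (at x)"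
    and rapid: "\<And>u. u \<in> V \<Longrightarrow> rapid u"
  shows "u \<in> schwartz"
proof -
  have V: "(vderiv ^^ n) u \<in> V" for n
  proof (induction n)
    case (Suc n)
    obtain u' where u': "u' \<in> V" "\<And>x. ((vderiv ^^ n) u has_vector_derivative u' x) (at x)"
      using deriv[OF Suc] by blast
    then have "(vderiv ^^ Suc n) u = u'"
      by (auto intro!: ext vector_derivative_at)
    then show ?case using u' by simp
  qed (simp add: assms(1))
  have "(vderiv ^^ n) u differentiable (at x)" for n x
    using deriv[OF V[of n]] by (auto intro: differentiableI_vector)
  then show ?thesis unfolding schwartz_iff using rapid[OF V] by blast
qed

lemma schwartz_rapid:
  assumes "f \<in> schwartz"
  shows "rapid f"
proof -
  have "rapid ((vderiv ^^ 0) f)" using assms unfolding schwartz_iff by blast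
  then show ?thesis by simp
qed

lemma schwartz_has_vector_derivative:
  assumes "f \<in> schwartz"
  shows "(f has_vector_derivative vderiv f x) (at x)"
proof -
  have "(vderiv ^^ 0) f differentiable (at x)" using assms unfolding schwartz_iff by blast
  then show ?thesis by (simp add: vector_derivative_works)
qed

lemma schwartz_vderiv:
  assumes "f \<in> schwartz"
  shows "vderiv f \<in> schwartz"
proof -
  have "(vderiv ^^ n) (vderiv f) = (vderiv ^^ Suc n) f" for n
    by (simp only: funpow_Suc_right o_def)
  then show ?thesis using assms unfolding schwartz_iff by (simp del: funpow.simps)
qed

lemma schwartz_continuous: "f \<in> schwartz \<Longrightarrow> continuous_on A f"
  using has_vector_derivative_continuous[OF schwartz_has_vector_derivative]
  by (intro continuous_at_imp_continuous_on) blast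

lemma schwartz_funpow_vderiv: "f \<in> schwartz \<Longrightarrow> (vderiv ^^ n) f \<in> schwartz"
  by (induction n) (simp_all add: schwartz_vderiv)

lemma schwartz_lincomb:
  assumes "f \<in> schwartz" "g \<in> schwartz"
  shows "(\<lambda>x. a * f x + b * g x) \<in> schwartz"
proof (rule schwartz_coinduct[where V = "{\<lambda>x. a * f x + b * g x |f g. f \<in> schwartz \<and> g \<in> schwartz}"])
  fix u assume "u \<in> {\<lambda>x. a * f x + b * g x |f g. f \<in> schwartz \<and> g \<in> schwartz}"
  then obtain f g where u: "u = (\<lambda>x. a * f x + b * g x)" and f: "f \<in> schwartz" and g: "g \<in> schwartz"
    by blast
  show "rapid u" unfolding u by (intro rapid_lincomb schwartz_rapid f g)
  show "\<exists>u'\<in>{\<lambda>x. a * f x + b * g x |f g. f \<in> schwartz \<and> g \<in> schwartz}. \<forall>x. (u has_vector_derivative u' x) (at x)"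
    unfolding u
  proof (rule bexI[where x = "\<lambda>x. a * vderiv f x + b * vderiv g x"])
    show "\<forall>x. ((\<lambda>x. a * f x + b * g x) has_vector_derivative a * vderiv f x + b * vderiv g x) (at x)"
      by (intro allI has_vector_derivative_add[OF has_vector_derivative_mult_right has_vector_derivative_mult_right]
          schwartz_has_vector_derivative f g)
    show "(\<lambda>x. a * vderiv f x + b * vderiv g x) \<in> {\<lambda>x. a * f x + b * g x |f g. f \<in> schwartz \<and> g \<in> schwartz}"
      by (intro CollectI exI[of _ "vderiv f"] exI[of _ "vderiv g"] conjI refl schwartz_vderiv f g)
  qed
qed (use assms in blast)

lemma schwartz_add: "f \<in> schwartz \<Longrightarrow> g \<in> schwartz \<Longrightarrow> (\<lambda>x. f x + g x) \<in> schwartz"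
  using schwartz_lincomb[of f g 1 1] by simp

lemma schwartz_diff: "f \<in> schwartz \<Longrightarrow> g \<in> schwartz \<Longrightarrow> (\<lambda>x. f x - g x) \<in> schwartz"
  using schwartz_lincomb[of f g 1 "- 1"] by simp

lemma schwartz_cmult: "f \<in> schwartz \<Longrightarrow> (\<lambda>x. c * f x) \<in> schwartz"
  using schwartz_lincomb[of f f c 0] by simp

lemma schwartz_mult_x:
  assumes "f \<in> schwartz"
  shows "(\<lambda>x. of_real x * f x) \<in> schwartz"
proof (rule schwartz_coinduct[where V = "{\<lambda>x. of_real x * f x + g x |f g. f \<in> schwartz \<and> g \<in> schwartz}"])
  have "(\<lambda>_. 0) \<in> schwartz" using schwartz_lincomb[OF assms assms, of 0 0] by simp
  then show "(\<lambda>x. of_real x * f x) \<in> {\<lambda>x. of_real x * f x + g x |f g. f \<in> schwartz \<and> g \<in> schwartz}"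
    using assms by (intro CollectI exI[of _ f] exI[of _ "\<lambda>_. 0"]) auto
next
  fix u assume "u \<in> {\<lambda>x. of_real x * f x + g x |f g. f \<in> schwartz \<and> g \<in> schwartz}"
  then obtain f g where u: "u = (\<lambda>x. of_real x * f x + g x)" and f: "f \<in> schwartz" and g: "g \<in> schwartz"
    by blast
  show "rapid u"
    using rapid_lincomb[OF rapid_mult_x[OF schwartz_rapid[OF f]] schwartz_rapid[OF g], of 1 1] by (simp add: u)
  show "\<exists>u'\<in>{\<lambda>x. of_real x * f x + g x |f g. f \<in> schwartz \<and> g \<in> schwartz}. \<forall>x. (u has_vector_derivative u' x) (at x)"
  proof (rule bexI[where x = "\<lambda>x. of_real x * vderiv f x + (f x + vderiv g x)"])
    show "\<forall>x. (u has_vector_derivative of_real x * vderiv f x + (f x + vderiv g x)) (at x)"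
    proof
      fix x
      have "(u has_vector_derivative (of_real x * vderiv f x + of_real 1 * f x) + vderiv g x) (at x)"
        unfolding u
        by (rule has_vector_derivative_add[OF has_vector_derivative_mult[OF has_vector_derivative_of_real[OF DERIV_ident]
            schwartz_has_vector_derivative[OF f]] schwartz_has_vector_derivative[OF g]])
      then show "(u has_vector_derivative of_real x * vderiv f x + (f x + vderiv g x)) (at x)"
        by (simp add: algebra_simps)
    qed
    show "(\<lambda>x. of_real x * vderiv f x + (f x + vderiv g x)) \<in> {\<lambda>x. of_real x * f x + g x |f g. f \<in> schwartz \<and> g \<in> schwartz}"
      by (intro CollectI exI[of _ "vderiv f"] exI[of _ "\<lambda>x. f x + vderiv g x"] conjI refl schwartz_vderiv schwartz_add f g)
  qed
qed

lemma schwartz_mult_x_power: "f \<in> schwartz \<Longrightarrow> (\<lambda>x. of_real x ^ n * f x) \<in> schwartz"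
proof (induction n)
  case (Suc n)
  then show ?case using schwartz_mult_x[of "\<lambda>x. of_real x ^ n * f x"] by (simp add: mult_ac)
qed simp

lemma has_vector_derivative_reflect:
  assumes "\<And>x. (f has_vector_derivative f' x) (at x)"
  shows "((\<lambda>x. f (- x)) has_vector_derivative - f' (- x)) (at x)"
proof -
  have "(f \<circ> (\<lambda>x. - x) has_vector_derivative (- 1) *\<^sub>R f' (- x)) (at x)"
    by (rule vector_diff_chain_at[OF _ assms])
      (auto intro!: derivative_eq_intros simp flip: has_real_derivative_iff_has_vector_derivative)
  then show ?thesis by (simp add: o_def)
qed

lemma schwartz_reflect:
  assumes "f \<in> schwartz"
  shows "(\<lambda>x. f (- x)) \<in> schwartz"
proof (rule schwartz_coinduct[where V = "{\<lambda>x. f (- x) |f. f \<in> schwartz}"])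
  fix u assume "u \<in> {\<lambda>x::real. f (- x) |f. f \<in> schwartz}"
  then obtain f where u: "u = (\<lambda>x. f (- x))" and f: "f \<in> schwartz" by blast
  show "rapid u" unfolding u by (intro rapid_reflect schwartz_rapid f)
  have "(\<lambda>x. - 1 * vderiv f x) \<in> schwartz" by (intro schwartz_cmult schwartz_vderiv f)
  then have "(\<lambda>x. - vderiv f (- x)) \<in> {\<lambda>x. f (- x) |f. f \<in> schwartz}"
    by (intro CollectI exI[of _ "\<lambda>x. - 1 * vderiv f x"]) auto
  then show "\<exists>u'\<in>{\<lambda>x. f (- x) |f. f \<in> schwartz}. \<forall>x. (u has_vector_derivative u' x) (at x)"
    unfolding u
    by (rule bexI[rotated]) (intro allI has_vector_derivative_reflect schwartz_has_vector_derivative f)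
qed (use assms in blast)

subsection \<open>Division by a zero\<close>

text \<open>If \<open>f\<close> vanishes at \<open>x0\<close>, then \<open>f x = (x - x0) * q\<^sub>0 x\<close>, where \<open>q\<^sub>n\<close> averages the derivative of
  order \<open>n + 1\<close> over the segment from \<open>x0\<close> to \<open>x\<close> with weight \<open>t\<^sup>n\<close>, so that the derivative of \<open>q\<^sub>n\<close> is
  \<open>q\<^sub>n\<^sub>+\<^sub>1\<close>. The averages do not decay by themselves; decay is recovered from the fact that, for \<open>n > 0\<close>,
  \<open>(x - x0) * q\<^sub>n x\<close> is the \<open>n\<close>th derivative of \<open>f\<close> minus \<open>n * q\<^sub>n\<^sub>-\<^sub>1 x\<close>.\<close>

lemma schwartz_divide_zero:
  assumes f: "f \<in> schwartz" and "f x0 = 0"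
  shows "\<exists>q\<in>schwartz. \<forall>x. f x = of_real (x - x0) * q x"
proof -
  define F where "F = (\<lambda>n. (vderiv ^^ n) f)"
  have F: "F n \<in> schwartz" for n unfolding F_def by (rule schwartz_funpow_vderiv[OF f])
  have F': "(F n has_vector_derivative F (Suc n) x) (at x)" for n x
    using schwartz_has_vector_derivative[OF F[of n], of x] by (simp add: F_def)
  define s where "s = (\<lambda>x t::real. x0 + t * (x - x0))"
  define q where "q = (\<lambda>n x. integral {0..1} (\<lambda>t. of_real (t ^ n) * F (Suc n) (s x t)))"
  have cF: "continuous_on A (\<lambda>t. F n (s x t))" for n x A
    unfolding s_def by (rule continuous_on_compose2[OF schwartz_continuous[OF F, of UNIV]]) (auto intro!: continuous_intros)
  have int: "(\<lambda>t. of_real (t ^ n) * F m (s x t)) integrable_on {0..1}" for n m x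
    by (intro integrable_continuous_real continuous_intros cF)
  have q': "(q n has_vector_derivative q (Suc n) x) (at x)" for n x
  proof -
    have "((\<lambda>x. integral (cbox 0 1) (\<lambda>t. of_real (t ^ n) * F (Suc n) (s x t))) has_vector_derivative
      integral (cbox 0 1) (\<lambda>t. of_real (t ^ Suc n) * F (Suc (Suc n)) (s x t))) (at x within UNIV)"
    proof (rule leibniz_rule_vector_derivative)
      fix x t
      have "(F (Suc n) \<circ> (\<lambda>x. s x t) has_vector_derivative t *\<^sub>R F (Suc (Suc n)) (s x t)) (at x)"
        by (rule vector_diff_chain_at[OF _ F'])
          (auto simp: s_def intro!: derivative_eq_intros simp flip: has_real_derivative_iff_has_vector_derivative)
      from has_vector_derivative_mult_right[OF this, of "of_real (t ^ n)"]
      show "((\<lambda>x. of_real (t ^ n) * F (Suc n) (s x t)) has_vector_derivative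
         of_real (t ^ Suc n) * F (Suc (Suc n)) (s x t)) (at x within UNIV)"
        by (simp add: o_def scaleR_conv_of_real mult_ac)
    next
      show "(\<lambda>t. of_real (t ^ n) * F (Suc n) (s x t)) integrable_on cbox 0 1" for x
        using int by simp
      have "continuous_on (UNIV \<times> cbox 0 1) (\<lambda>z. F (Suc (Suc n)) (s (fst z) (snd z)))"
        unfolding s_def by (rule continuous_on_compose2[OF schwartz_continuous[OF F, of UNIV]]) (auto intro!: continuous_intros)
      then show "continuous_on (UNIV \<times> cbox 0 1) (\<lambda>(x, t). of_real (t ^ Suc n) * F (Suc (Suc n)) (s x t))"
        unfolding case_prod_unfold by (intro continuous_intros)
    qed auto
    then show ?thesis by (simp add: q_def[abs_def])
  qed
  have ibp: "of_real (x - x0) * q n x = F n x - of_real (0 ^ n) * F n x0 -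
      (if n = 0 then 0 else of_nat n * q (n - 1) x)" for n x
  proof -
    have "((\<lambda>t. of_real (x - x0) * (of_real (t ^ n) * F (Suc n) (s x t)) + of_nat n * (of_real (t ^ (n - 1)) * F n (s x t)))
       has_integral of_real (1 ^ n) * F n (s x 1) - of_real (0 ^ n) * F n (s x 0)) {0..1}"
    proof (rule fundamental_theorem_of_calculus)
      fix t :: real
      have "(F n \<circ> s x has_vector_derivative (x - x0) *\<^sub>R F (Suc n) (s x t)) (at t)"
        by (rule vector_diff_chain_at[OF _ F'])
          (auto simp: s_def intro!: derivative_eq_intros simp flip: has_real_derivative_iff_has_vector_derivative)
      then have "((\<lambda>t. F n (s x t)) has_vector_derivative (x - x0) *\<^sub>R F (Suc n) (s x t)) (at t within {0..1})"
        using has_vector_derivative_at_within by (simp add: o_def) blast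
      from has_vector_derivative_mult[OF has_vector_derivative_of_real[OF DERIV_pow[of n t "{0..1}"]] this]
      show "((\<lambda>t. of_real (t ^ n) * F n (s x t)) has_vector_derivative
        of_real (x - x0) * (of_real (t ^ n) * F (Suc n) (s x t)) + of_nat n * (of_real (t ^ (n - 1)) * F n (s x t))) (at t within {0..1})"
        by (simp add: scaleR_conv_of_real mult_ac)
    qed simp
    from integral_unique[OF this]
    have "integral {0..1} (\<lambda>t. of_real (x - x0) * (of_real (t ^ n) * F (Suc n) (s x t)) + of_nat n * (of_real (t ^ (n - 1)) * F n (s x t)))
       = F n x - of_real (0 ^ n) * F n x0"
      by (simp add: s_def)
    also have "integral {0..1} (\<lambda>t. of_real (x - x0) * (of_real (t ^ n) * F (Suc n) (s x t)) + of_nat n * (of_real (t ^ (n - 1)) * F n (s x t)))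
       = integral {0..1} (\<lambda>t. of_real (x - x0) * (of_real (t ^ n) * F (Suc n) (s x t))) + integral {0..1} (\<lambda>t. of_nat n * (of_real (t ^ (n - 1)) * F n (s x t)))"
      by (rule integral_add; rule integrable_on_mult_right[OF int])
    also have "\<dots> = of_real (x - x0) * q n x + of_nat n * integral {0..1} (\<lambda>t. of_real (t ^ (n - 1)) * F n (s x t))"
      unfolding integral_mult_right q_def ..
    finally show ?thesis by (cases n) (simp_all add: q_def algebra_simps)
  qed
  have bounded: "\<exists>C. \<forall>x. norm (q n x) \<le> C" for n
  proof -
    obtain C where C: "\<And>x. norm (F (Suc n) x) \<le> C"
      using schwartz_rapid[OF F[of "Suc n"]] unfolding rapid_def by (metis mult_1 power_0)
    have "norm (q n x) \<le> C * (1 - 0)" for x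
      unfolding q_def
    proof (rule integral_bound)
      show "continuous_on {0..1} (\<lambda>t. of_real (t ^ n) * F (Suc n) (s x t))" by (intro continuous_intros cF)
      fix t :: real assume t: "t \<in> {0..1}"
      have "norm (complex_of_real (t ^ n) * F (Suc n) (s x t)) = t ^ n * norm (F (Suc n) (s x t))"
        using t by (simp add: norm_mult norm_power)
      also have "\<dots> \<le> 1 * C" using t by (intro mult_mono C power_le_one) auto
      finally show "norm (complex_of_real (t ^ n) * F (Suc n) (s x t)) \<le> C" by simp
    qed simp
    then show ?thesis by auto
  qed
  have decay: "\<exists>C. \<forall>x. norm (of_real x ^ m * q n x) \<le> C" for m n
  proof (induction n arbitrary: m)
    case 0
    show ?case
    proof (induction m)
      case 0
      then show ?case using bounded[of 0] by simp
    next
      case (Suc m)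
      obtain C where C: "\<And>x. norm (of_real x ^ m * q 0 x) \<le> C" using Suc by blast
      obtain D where D: "\<And>x. norm (of_real x ^ m * F 0 x) \<le> D"
        using schwartz_rapid[OF F[of 0]] unfolding rapid_def by metis
      have "norm (of_real x ^ Suc m * q 0 x) \<le> D + \<bar>x0\<bar> * C" for x
      proof -
        have "of_real x ^ Suc m * q 0 x = of_real x ^ m * (of_real (x - x0) * q 0 x) + of_real x0 * (of_real x ^ m * q 0 x)"
          by (simp add: algebra_simps)
        also have "\<dots> = of_real x ^ m * F 0 x + of_real x0 * (of_real x ^ m * q 0 x)"
          unfolding ibp using assms(2) by (simp add: F_def)
        finally show ?thesis
          using norm_triangle_ineq[of "of_real x ^ m * F 0 x" "of_real x0 * (of_real x ^ m * q 0 x)"] D[of x]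
            mult_left_mono[OF C[of x], of "\<bar>x0\<bar>"] by (simp only: norm_mult[of "of_real x0"] norm_of_real) auto
      qed
      then show ?case by blast
    qed
  next
    case (Suc n)
    note IHn = Suc
    show ?case
    proof (induction m)
      case 0
      then show ?case using bounded[of "Suc n"] by simp
    next
      case (Suc m)
      obtain C where C: "\<And>x. norm (of_real x ^ m * q (Suc n) x) \<le> C" using Suc by blast
      obtain D where D: "\<And>x. norm (of_real x ^ m * F (Suc n) x) \<le> D"
        using schwartz_rapid[OF F[of "Suc n"]] unfolding rapid_def by metis
      obtain E where E: "\<And>x. norm (of_real x ^ m * q n x) \<le> E" using IHn by blast
      have "norm (of_real x ^ Suc m * q (Suc n) x) \<le> D + real (Suc n) * E + \<bar>x0\<bar> * C" for x
      proof -
        have "of_real x ^ Suc m * q (Suc n) x = of_real x ^ m * (of_real (x - x0) * q (Suc n) x) + of_real x0 * (of_real x ^ m * q (Suc n) x)"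
          by (simp add: algebra_simps)
        also have "\<dots> = of_real x ^ m * F (Suc n) x - of_nat (Suc n) * (of_real x ^ m * q n x) + of_real x0 * (of_real x ^ m * q (Suc n) x)"
          unfolding ibp by (simp add: algebra_simps del: of_nat_Suc)
        finally have e: "of_real x ^ Suc m * q (Suc n) x = of_real x ^ m * F (Suc n) x - of_nat (Suc n) * (of_real x ^ m * q n x) + of_real x0 * (of_real x ^ m * q (Suc n) x)" .
        have "norm (of_real x ^ Suc m * q (Suc n) x) \<le> norm (of_real x ^ m * F (Suc n) x) + norm (of_nat (Suc n) * (of_real x ^ m * q n x)) + norm (of_real x0 * (of_real x ^ m * q (Suc n) x))"
          unfolding e by (intro order_trans[OF norm_triangle_ineq] add_mono order_refl norm_triangle_ineq4)
        also have "\<dots> = norm (of_real x ^ m * F (Suc n) x) + real (Suc n) * norm (of_real x ^ m * q n x) + \<bar>x0\<bar> * norm (of_real x ^ m * q (Suc n) x)"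
          by (simp only: norm_mult[of "of_nat _"] norm_mult[of "of_real x0"] norm_of_real norm_of_nat)
        also have "\<dots> \<le> D + real (Suc n) * E + \<bar>x0\<bar> * C"
          by (intro add_mono mult_left_mono C D E) auto
        finally show ?thesis .
      qed
      then show ?case by blast
    qed
  qed
  have "q 0 \<in> schwartz"
  proof (rule schwartz_coinduct[where V = "range q"])
    fix u assume "u \<in> range q"
    then show "rapid u" using decay unfolding rapid_def by blast
    show "\<exists>u'\<in>range q. \<forall>x. (u has_vector_derivative u' x) (at x)"
      using \<open>u \<in> range q\<close> q' by blast
  qed simp
  moreover have "f x = of_real (x - x0) * q 0 x" for x
    unfolding ibp using assms(2) by (simp add: F_def)
  ultimately show ?thesis by blast
qed

subsection \<open>The Gaussian\<close>

lemma rapid_gaussian: "rapid (\<lambda>x. of_real (exp (- x\<^sup>2 / 2)))"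
  unfolding rapid_def
proof
  fix m
  have "norm (of_real x ^ m * complex_of_real (exp (- x\<^sup>2 / 2))) \<le> fact m * exp (1 / 2)" for x :: real
  proof -
    have "\<bar>x\<bar> ^ m / fact m \<le> exp \<bar>x\<bar>"
    proof -
      have "sum (\<lambda>n. \<bar>x\<bar> ^ n /\<^sub>R fact n) {m} \<le> suminf (\<lambda>n. \<bar>x\<bar> ^ n /\<^sub>R fact n)"
        by (rule sum_le_suminf[OF sums_summable[OF exp_converges]]) auto
      also have "\<dots> = exp \<bar>x\<bar>" using exp_converges[of "\<bar>x\<bar>"] by (simp add: sums_iff)
      finally show ?thesis by (simp add: divide_inverse mult_ac)
    qed
    then have "\<bar>x\<bar> ^ m \<le> fact m * exp \<bar>x\<bar>" by (simp add: field_simps)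
    then have "\<bar>x\<bar> ^ m * exp (- x\<^sup>2 / 2) \<le> fact m * exp \<bar>x\<bar> * exp (- x\<^sup>2 / 2)"
      by (rule mult_right_mono) simp
    also have "\<dots> = fact m * exp (\<bar>x\<bar> - x\<^sup>2 / 2)"
      by (simp add: exp_add[symmetric] mult.assoc)
    also have "\<dots> \<le> fact m * exp (1 / 2)"
    proof -
      have "0 \<le> (\<bar>x\<bar> - 1)\<^sup>2" by simp
      then have "\<bar>x\<bar> - x\<^sup>2 / 2 \<le> 1 / 2" by (simp add: power2_eq_square algebra_simps)
      then show ?thesis by (intro mult_left_mono) auto
    qed
    finally show ?thesis by (simp add: norm_mult norm_power)
  qed
  then show "\<exists>C. \<forall>x::real. norm (of_real x ^ m * complex_of_real (exp (- x\<^sup>2 / 2))) \<le> C" by blast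
qed

lemma has_vector_derivative_gaussian:
  "((\<lambda>x. complex_of_real (exp (- x\<^sup>2 / 2))) has_vector_derivative - of_real x * of_real (exp (- x\<^sup>2 / 2))) (at x)"
proof -
  have "((\<lambda>x. exp (- x\<^sup>2 / 2)) has_field_derivative exp (- x\<^sup>2 / 2) * - x) (at x)"
    by (auto intro!: derivative_eq_intros)
  from has_vector_derivative_of_real[OF this] show ?thesis by (simp add: mult_ac)
qed

lemma gaussian_schwartz: "(\<lambda>x. of_real (exp (- x\<^sup>2 / 2))) \<in> schwartz"
proof -
  define G :: "real \<Rightarrow> complex" where "G = (\<lambda>x. of_real (exp (- x\<^sup>2 / 2)))"
  define V where "V = {\<lambda>x. poly p (of_real x) * G x |p. True}"
  have V: "rapid (\<lambda>x. poly p (of_real x) * G x)" for p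
  proof (induction p)
    case 0
    show ?case by (auto simp: rapid_def)
  next
    case (pCons a p)
    have "rapid G" using rapid_gaussian by (simp add: G_def)
    from rapid_lincomb[OF this rapid_mult_x[OF pCons(2)], of a 1] show ?case by (simp add: algebra_simps)
  qed
  show ?thesis
  proof (rule schwartz_coinduct[where V = V])
    show "(\<lambda>x. of_real (exp (- x\<^sup>2 / 2))) \<in> V"
      unfolding V_def by (intro CollectI exI[of _ "1"]) (simp add: G_def)
    fix u assume "u \<in> V"
    then obtain p where u: "u = (\<lambda>x. poly p (of_real x) * G x)" by (auto simp: V_def)
    show "rapid u" unfolding u by (rule V)
    have "(u has_vector_derivative poly (pderiv p - [:0, 1:] * p) (of_real x) * G x) (at x)" for x
    proof -
      have "((\<lambda>x. poly p (of_real x)) has_vector_derivative poly (pderiv p) (of_real x)) (at x)"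
        by (rule has_vector_derivative_real_field[OF poly_DERIV])
      from has_vector_derivative_mult[OF this has_vector_derivative_gaussian]
      show ?thesis unfolding u G_def by (simp add: algebra_simps)
    qed
    then show "\<exists>u'\<in>V. \<forall>x. (u has_vector_derivative u' x) (at x)"
      by (intro bexI[of _ "\<lambda>x. poly (pderiv p - [:0, 1:] * p) (of_real x) * G x"] allI)
        (assumption, unfold V_def, intro CollectI exI[of _ "pderiv p - [:0, 1:] * p"] conjI refl TrueI)
  qed
qed

subsection \<open>The Dunkl operator on Schwartz functions\<close>

text \<open>Besides showing that the Dunkl operator acts on Schwartz functions, this identifies the value prescribed at the origin with the limit of the difference quotient.\<close>

lemma schwartz_odd_quotient:
  assumes f: "f \<in> schwartz"
  shows "\<exists>q\<in>schwartz. (\<forall>x. f x - f (- x) = of_real x * q x) \<and>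
    (\<forall>k. dunkl_T k f = (\<lambda>x. vderiv f x + of_real k * q x))"
proof -
  have g: "(\<lambda>x. f x - f (- x)) \<in> schwartz" by (intro schwartz_diff schwartz_reflect f)
  obtain q where q: "q \<in> schwartz" and eq: "\<And>x. f x - f (- x) = of_real (x - 0) * q x"
    using schwartz_divide_zero[OF g, of 0] by auto
  have eq': "(\<lambda>x. f x - f (- x)) = (\<lambda>x. of_real x * q x)" using eq by auto
  have "((\<lambda>x. f x - f (- x)) has_vector_derivative vderiv f 0 - (- vderiv f (- 0))) (at 0)"
    by (intro has_vector_derivative_diff has_vector_derivative_reflect schwartz_has_vector_derivative f)
  moreover have "((\<lambda>x. of_real x * q x) has_vector_derivative of_real 0 * vderiv q 0 + of_real 1 * q 0) (at 0)"
    by (rule has_vector_derivative_mult[OF has_vector_derivative_of_real[OF DERIV_ident] schwartz_has_vector_derivative[OF q]])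
  ultimately have q0: "2 * vderiv f 0 = q 0"
    unfolding eq' using vector_derivative_unique_at by fastforce
  have "dunkl_T k f = (\<lambda>x. vderiv f x + of_real k * q x)" for k
    using eq q0 by (auto simp: dunkl_T_def)
  then show ?thesis using q eq by auto
qed

lemma schwartz_dunkl_T:
  assumes "f \<in> schwartz"
  shows "dunkl_T k f \<in> schwartz"
proof -
  obtain q where "q \<in> schwartz" "dunkl_T k f = (\<lambda>x. vderiv f x + of_real k * q x)"
    using schwartz_odd_quotient[OF assms] by blast
  then show ?thesis using schwartz_add[OF schwartz_vderiv[OF assms] schwartz_cmult] by simp
qed

section \<open>The Dunkl kernel at imaginary spectral parameter\<close>

subsection \<open>Normalised Bessel functions\<close>

definition bessel_coeff :: "real \<Rightarrow> nat \<Rightarrow> real" where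
  "bessel_coeff a n = 1 / (fact n * pochhammer a n)"

text \<open>The hypergeometric series with a single lower parameter \<open>a\<close> and no upper one.\<close>

definition bessel_series :: "real \<Rightarrow> real \<Rightarrow> real" where
  "bessel_series a t = (\<Sum>n. bessel_coeff a n * t ^ n)"

lemma pochhammer_lower_bound:
  assumes "a \<ge> 1 / 2"
  shows "pochhammer a n \<ge> (1 / 2 :: real)"
proof (induction n)
  case (Suc n)
  show ?case
  proof (cases n)
    case 0
    then show ?thesis using assms by simp
  next
    case (Suc m)
    have "1 / 2 * 1 \<le> pochhammer a n * (a + of_nat n)"
      using Suc.IH Suc assms by (intro mult_mono) auto
    then show ?thesis by (simp add: pochhammer_Suc)
  qed
qed simp

lemma summable_bessel:
  assumes "a \<ge> 1 / 2"
  shows "summable (\<lambda>n. bessel_coeff a n * t ^ n)"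
proof (rule summable_comparison_test)
  show "summable (\<lambda>n. 2 * (inverse (fact n) * \<bar>t\<bar> ^ n))"
    by (intro summable_mult summable_exp)
  have "norm (bessel_coeff a n * t ^ n) \<le> 2 * (inverse (fact n) * \<bar>t\<bar> ^ n)" for n
  proof -
    have p: "pochhammer a n \<ge> 1 / 2" by (rule pochhammer_lower_bound[OF assms])
    have "1 / pochhammer a n \<le> 1 / (1 / 2)" using p by (intro divide_left_mono) auto
    then have "inverse (fact n) * \<bar>t\<bar> ^ n * (1 / pochhammer a n) \<le> inverse (fact n) * \<bar>t\<bar> ^ n * 2"
      by (intro mult_left_mono) auto
    moreover have "norm (bessel_coeff a n * t ^ n) = inverse (fact n) * \<bar>t\<bar> ^ n * (1 / pochhammer a n)"
      using p by (simp add: bessel_coeff_def abs_mult power_abs field_simps)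
    ultimately show ?thesis by linarith
  qed
  then show "\<exists>N. \<forall>n\<ge>N. norm (bessel_coeff a n * t ^ n) \<le> 2 * (inverse (fact n) * \<bar>t\<bar> ^ n)" by blast
qed

lemma bessel_series_0: "bessel_series a 0 = 1"
  unfolding bessel_series_def powser_zero by (simp add: bessel_coeff_def)

lemma has_derivative_bessel_series:
  assumes a: "a \<ge> 1 / 2"
  shows "(bessel_series a has_real_derivative bessel_series (a + 1) t / a) (at t)"
proof -
  have "diffs (bessel_coeff a) n = bessel_coeff (a + 1) n / a" for n
  proof -
    have "fact (Suc n) * pochhammer a (Suc n) = of_nat (Suc n) * (fact n * (a * pochhammer (a + 1) n))"
      unfolding fact_Suc pochhammer_rec by (simp only: mult.assoc)
    then show ?thesis unfolding diffs_def bessel_coeff_def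
      by (simp del: of_nat_Suc fact_Suc)
  qed
  then have "(\<Sum>n. diffs (bessel_coeff a) n * t ^ n) = (\<Sum>n. bessel_coeff (a + 1) n * t ^ n / a)"
    by simp
  also have "\<dots> = bessel_series (a + 1) t / a"
    unfolding bessel_series_def by (rule suminf_divide[OF summable_bessel]) (use a in simp)
  finally have e: "(\<Sum>n. diffs (bessel_coeff a) n * t ^ n) = bessel_series (a + 1) t / a" .
  have "((\<lambda>x. \<Sum>n. bessel_coeff a n * x ^ n) has_field_derivative (\<Sum>n. diffs (bessel_coeff a) n * t ^ n)) (at t)"
    by (rule termdiffs_strong_converges_everywhere) (rule summable_bessel[OF a])
  then show ?thesis unfolding e bessel_series_def[symmetric] .
qed

text \<open>With \<open>bessel_series (a + 1)\<close> read as a multiple of the derivative, this is the second-order equation \<open>t b'' + a b' = b\<close> of the series.\<close>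

lemma bessel_series_contiguous:
  assumes a: "a \<ge> 1 / 2"
  shows "bessel_series a t = bessel_series (a + 1) t + t / (a * (a + 1)) * bessel_series (a + 2) t"
proof -
  have coeff: "bessel_coeff a (Suc n) = bessel_coeff (a + 1) (Suc n) + bessel_coeff (a + 2) n / (a * (a + 1))" for n
  proof -
    define P where "P = pochhammer (a + 2) n"
    have P: "P > 0" using pochhammer_lower_bound[of "a + 2" n] a by (auto simp: P_def)
    have p1: "pochhammer (a + 1) (Suc n) = (a + 1) * P"
      by (simp add: P_def pochhammer_rec add.assoc)
    have "pochhammer a (Suc (Suc n)) = a * ((a + 1) * P)"
      using p1 pochhammer_rec[of a "Suc n"] by simp
    then have p0: "pochhammer a (Suc n) = a * (a + 1) * P / (a + 1 + n)"
      using a by (simp add: pochhammer_Suc[of a "Suc n"] field_simps)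
    show ?thesis unfolding bessel_coeff_def p0 p1 P_def[symmetric] fact_Suc
      using a P by (simp add: divide_simps)
  qed
  have sm: "summable (\<lambda>n. bessel_coeff b n * t ^ n)" if "b \<ge> 1 / 2" for b by (rule summable_bessel[OF that])
  have "bessel_series a t = (\<Sum>n. bessel_coeff a (Suc n) * t ^ Suc n) + bessel_coeff a 0 * t ^ 0"
    unfolding bessel_series_def using suminf_split_head[OF sm[OF a]] by simp
  also have "(\<lambda>n. bessel_coeff a (Suc n) * t ^ Suc n) = (\<lambda>n. bessel_coeff (a + 1) (Suc n) * t ^ Suc n + t / (a * (a + 1)) * (bessel_coeff (a + 2) n * t ^ n))"
    unfolding coeff by (auto simp: algebra_simps)
  also have "suminf \<dots> = (\<Sum>n. bessel_coeff (a + 1) (Suc n) * t ^ Suc n) + t / (a * (a + 1)) * bessel_series (a + 2) t"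
  proof -
    have s1: "summable (\<lambda>n. bessel_coeff (a + 1) (Suc n) * t ^ Suc n)"
      using sm[of "a + 1"] a summable_Suc_iff[of "\<lambda>n. bessel_coeff (a + 1) n * t ^ n"] by simp
    have s2: "summable (\<lambda>n. bessel_coeff (a + 2) n * t ^ n)" using sm[of "a + 2"] a by simp
    show ?thesis
      unfolding bessel_series_def suminf_add[OF s1 summable_mult[OF s2], symmetric] suminf_mult[OF s2] ..
  qed
  also have "(\<Sum>n. bessel_coeff (a + 1) (Suc n) * t ^ Suc n) = bessel_series (a + 1) t - bessel_coeff (a + 1) 0 * t ^ 0"
    unfolding bessel_series_def using suminf_split_head[OF sm[of "a + 1"]] a by simp
  finally show ?thesis by (simp add: bessel_coeff_def)
qed

text \<open>The even Bessel function \<open>s\<^sup>-\<^sup>\<nu> J\<^sub>\<nu>(s)\<close> with \<open>\<nu> = k - 1 / 2\<close>, normalised to \<open>1\<close> at the origin.\<close>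

definition bessel :: "real \<Rightarrow> real \<Rightarrow> real" where
  "bessel k s = bessel_series (k + 1 / 2) (- s\<^sup>2 / 4)"

lemma bessel_0: "bessel k 0 = 1" by (simp add: bessel_def bessel_series_0)

lemma bessel_minus: "bessel k (- s) = bessel k s" by (simp add: bessel_def)

lemma has_derivative_bessel:
  assumes "k \<ge> 0"
  shows "(bessel k has_real_derivative - (s * bessel (k + 1) s / (2 * k + 1))) (at s)"
proof -
  have "((\<lambda>s. bessel_series (k + 1 / 2) (- s\<^sup>2 / 4)) has_real_derivative
      bessel_series (k + 1 / 2 + 1) (- s\<^sup>2 / 4) / (k + 1 / 2) * (- s / 2)) (at s)"
    by (rule DERIV_chain2[OF has_derivative_bessel_series])
      (use assms in \<open>auto intro!: derivative_eq_intros\<close>)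
  moreover have "bessel_series (k + 1 / 2 + 1) (- s\<^sup>2 / 4) / (k + 1 / 2) * (- s / 2) = - (s * bessel (k + 1) s / (2 * k + 1))"
    using assms by (simp add: bessel_def field_simps)
  ultimately show ?thesis unfolding bessel_def[abs_def] by simp
qed

lemma bessel_contiguous:
  assumes "k \<ge> 0"
  shows "bessel k s = bessel (k + 1) s - s\<^sup>2 / ((2 * k + 1) * (2 * k + 3)) * bessel (k + 2) s"
proof -
  have e: "k + 1 / 2 + 1 = (k + 1) + 1 / 2" "k + 1 / 2 + 2 = (k + 2) + 1 / 2" by simp_all
  have "(k + 1 / 2) * ((k + 1) + 1 / 2) = (2 * k + 1) * (2 * k + 3) / 4"
    by (simp add: algebra_simps add_divide_distrib)
  then have c: "(- s\<^sup>2 / 4) / ((k + 1 / 2) * ((k + 1) + 1 / 2)) = - (s\<^sup>2 / ((2 * k + 1) * (2 * k + 3)))"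
    by simp
  have "bessel_series (k + 1 / 2) (- s\<^sup>2 / 4) = bessel_series ((k + 1) + 1 / 2) (- s\<^sup>2 / 4) +
     (- s\<^sup>2 / 4) / ((k + 1 / 2) * ((k + 1) + 1 / 2)) * bessel_series ((k + 2) + 1 / 2) (- s\<^sup>2 / 4)"
    using bessel_series_contiguous[of "k + 1 / 2" "- s\<^sup>2 / 4", unfolded e] assms by simp
  then show ?thesis unfolding c bessel_def[symmetric] by simp
qed

definition bessel_odd :: "real \<Rightarrow> real \<Rightarrow> real" where
  "bessel_odd k s = s * bessel (k + 1) s / (2 * k + 1)"

lemma has_derivative_bessel_odd:
  assumes k: "k \<ge> 0"
  shows "(bessel_odd k has_real_derivative bessel k s - 2 * k / (2 * k + 1) * bessel (k + 1) s) (at s)"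
proof -
  have "(bessel_odd k has_real_derivative (1 * bessel (k + 1) s + - (s * bessel (k + 1 + 1) s / (2 * (k + 1) + 1)) * s) / (2 * k + 1)) (at s)"
    unfolding bessel_odd_def[abs_def]
    by (intro DERIV_cdivide DERIV_mult DERIV_ident has_derivative_bessel) (use k in simp)
  moreover have "(1 * bessel (k + 1) s + - (s * bessel (k + 1 + 1) s / (2 * (k + 1) + 1)) * s) / (2 * k + 1)
     = bessel k s - 2 * k / (2 * k + 1) * bessel (k + 1) s"
    unfolding bessel_contiguous[OF k, of s] using k
    by (simp add: divide_simps add.assoc) (simp add: algebra_simps power2_eq_square)
  ultimately show ?thesis by simp
qed

text \<open>The sum of squares has derivative \<open>- 4 k s B\<^sub>k\<^sub>+\<^sub>1(s)\<^sup>2 / (2 k + 1)\<^sup>2\<close>, is even, and equals \<open>1\<close> at the origin.\<close>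

lemma bessel_energy:
  assumes k: "k \<ge> 0"
  shows "(bessel k s)\<^sup>2 + (bessel_odd k s)\<^sup>2 \<le> 1"
proof -
  define N where "N = (\<lambda>s. (bessel k s)\<^sup>2 + (bessel_odd k s)\<^sup>2)"
  have N': "(N has_real_derivative - (4 * k * s * (bessel (k + 1) s)\<^sup>2 / (2 * k + 1)\<^sup>2)) (at s)" for s
  proof -
    have "(N has_real_derivative (of_nat 2 * (- (s * bessel (k + 1) s / (2 * k + 1)) * bessel k s ^ (2 - Suc 0)) +
       of_nat 2 * ((bessel k s - 2 * k / (2 * k + 1) * bessel (k + 1) s) * bessel_odd k s ^ (2 - Suc 0)))) (at s)"
      unfolding N_def
      by (intro DERIV_add DERIV_power has_derivative_bessel has_derivative_bessel_odd k)
    moreover have "(of_nat 2 * (- (s * bessel (k + 1) s / (2 * k + 1)) * bessel k s ^ (2 - Suc 0)) +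
       of_nat 2 * ((bessel k s - 2 * k / (2 * k + 1) * bessel (k + 1) s) * bessel_odd k s ^ (2 - Suc 0)))
       = - (4 * k * s * (bessel (k + 1) s)\<^sup>2 / (2 * k + 1)\<^sup>2)"
    proof -
      have alg: "of_nat 2 * (- u * b ^ (2 - Suc 0)) + of_nat 2 * ((b - c * h) * u ^ (2 - Suc 0)) = - (2 * c * h * u)"
        for u b c h :: real by (simp add: algebra_simps)
      show ?thesis unfolding bessel_odd_def alg by (simp add: power2_eq_square)
    qed
    ultimately show ?thesis by simp
  qed
  have pos: "N s \<le> 1" if "s \<ge> 0" for s
  proof -
    have "N s \<le> N 0"
      using that
    proof (rule DERIV_nonpos_imp_nonincreasing)
      fix x assume "0 \<le> x" "x \<le> s"
      then show "\<exists>y. (N has_real_derivative y) (at x) \<and> y \<le> 0"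
        by (intro exI[of _ "- (4 * k * x * (bessel (k + 1) x)\<^sup>2 / (2 * k + 1)\<^sup>2)"] conjI N')
          (use k \<open>0 \<le> x\<close> in simp)
    qed
    then show ?thesis by (simp add: N_def bessel_0 bessel_odd_def)
  qed
  have "N s = N \<bar>s\<bar>"
    by (cases "s \<ge> 0") (auto simp: N_def bessel_odd_def bessel_minus power2_eq_square)
  then show ?thesis using pos[of "\<bar>s\<bar>"] by (simp add: N_def)
qed

lemma bessel_bound:
  assumes "k \<ge> 0"
  shows "\<bar>bessel k s\<bar> \<le> 1"
proof -
  have "(bessel k s)\<^sup>2 \<le> 1"
    using bessel_energy[OF assms, of s] zero_le_power2[of "bessel_odd k s"] by linarith
  then show ?thesis by (simp add: abs_square_le_1)
qed

lemma continuous_bessel: "k \<ge> 0 \<Longrightarrow> continuous_on A (bessel k)"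
  by (intro continuous_at_imp_continuous_on) (blast intro: DERIV_isCont has_derivative_bessel)

subsection \<open>The kernel\<close>

definition dunkl_kernel :: "real \<Rightarrow> real \<Rightarrow> complex" where
  "dunkl_kernel k s = of_real (bessel k s) + \<i> * of_real (bessel_odd k s)"

definition dunkl_kernel_deriv :: "real \<Rightarrow> real \<Rightarrow> complex" where
  "dunkl_kernel_deriv k s = of_real (- bessel_odd k s) +
     \<i> * of_real (bessel k s - 2 * k / (2 * k + 1) * bessel (k + 1) s)"

lemma has_vector_derivative_kernel:
  assumes k: "k \<ge> 0"
  shows "(dunkl_kernel k has_vector_derivative dunkl_kernel_deriv k s) (at s)"
proof -
  have e: "(bessel k has_real_derivative - bessel_odd k s) (at s)"
    using has_derivative_bessel[OF k, of s] by (simp add: bessel_odd_def)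
  show ?thesis
    unfolding dunkl_kernel_def[abs_def] dunkl_kernel_deriv_def
    by (rule has_vector_derivative_add[OF has_vector_derivative_of_real[OF e]
        has_vector_derivative_mult_right[OF has_vector_derivative_of_real[OF has_derivative_bessel_odd[OF k]]]])
qed

lemma norm_kernel: "k \<ge> 0 \<Longrightarrow> norm (dunkl_kernel k s) \<le> 1"
proof -
  assume k: "k \<ge> 0"
  have "norm (dunkl_kernel k s) = sqrt ((bessel k s)\<^sup>2 + (bessel_odd k s)\<^sup>2)"
    by (simp add: dunkl_kernel_def cmod_def)
  then show ?thesis using bessel_energy[OF k, of s] by simp
qed

lemma norm_kernel_deriv: 
  assumes k: "k \<ge> 0"
  shows "norm (dunkl_kernel_deriv k s) \<le> 3"
proof -
  have "dunkl_kernel_deriv k s = \<i> * dunkl_kernel k s - \<i> * of_real (2 * k / (2 * k + 1) * bessel (k + 1) s)"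
    by (simp add: dunkl_kernel_def dunkl_kernel_deriv_def algebra_simps)
  then have "norm (dunkl_kernel_deriv k s) \<le> norm (\<i> * dunkl_kernel k s) + norm (\<i> * complex_of_real (2 * k / (2 * k + 1) * bessel (k + 1) s))"
    using norm_triangle_ineq4 by metis
  also have "\<dots> = norm (dunkl_kernel k s) + \<bar>2 * k / (2 * k + 1)\<bar> * \<bar>bessel (k + 1) s\<bar>"
    by (simp only: norm_mult norm_ii norm_of_real abs_mult mult_1)
  also have "\<dots> \<le> 1 + 1 * 1"
    using k by (intro add_mono mult_mono norm_kernel bessel_bound) auto
  finally show ?thesis by simp
qed

lemma continuous_kernel: "k \<ge> 0 \<Longrightarrow> continuous_on A (dunkl_kernel k)"
  using has_vector_derivative_continuous[OF has_vector_derivative_kernel]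
  by (intro continuous_at_imp_continuous_on) blast

lemma kernel_odd: "dunkl_kernel k s - dunkl_kernel k (- s) = 2 * \<i> * of_real (bessel_odd k s)"
  by (simp add: dunkl_kernel_def bessel_odd_def bessel_minus)

lemma has_vector_derivative_scaled_kernel:
  assumes k: "k \<ge> 0"
  shows "((\<lambda>y. dunkl_kernel k (\<xi> * y)) has_vector_derivative of_real \<xi> * dunkl_kernel_deriv k (\<xi> * y)) (at y)"
proof -
  have "(dunkl_kernel k \<circ> (\<lambda>y. \<xi> * y) has_vector_derivative \<xi> *\<^sub>R dunkl_kernel_deriv k (\<xi> * y)) (at y)"
    by (rule vector_diff_chain_at[OF _ has_vector_derivative_kernel[OF k]])
      (auto intro!: derivative_eq_intros simp flip: has_real_derivative_iff_has_vector_derivative)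
  then show ?thesis by (simp add: o_def scaleR_conv_of_real)
qed

lemma dunkl_T_kernel:
  assumes k: "k \<ge> 0"
  shows "dunkl_T k (\<lambda>y. dunkl_kernel k (\<xi> * y)) y = \<i> * of_real \<xi> * dunkl_kernel k (\<xi> * y)"
proof -
  have d: "vderiv (\<lambda>y. dunkl_kernel k (\<xi> * y)) y = of_real \<xi> * dunkl_kernel_deriv k (\<xi> * y)" for y
    by (rule vector_derivative_at[OF has_vector_derivative_scaled_kernel[OF k]])
  have nz: "1 + 2 * complex_of_real k \<noteq> 0"
  proof
    assume "1 + 2 * complex_of_real k = 0"
    then have "complex_of_real (1 + 2 * k) = 0" by simp
    then show False using k by (simp only: of_real_eq_0_iff)
  qed
  show ?thesis
  proof (cases "y = 0")
    case True
    have "dunkl_T k (\<lambda>y. dunkl_kernel k (\<xi> * y)) y = (1 + 2 * of_real k) * (of_real \<xi> * dunkl_kernel_deriv k 0)"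
      unfolding dunkl_T_def d using True by (simp add: algebra_simps)
    also have "dunkl_kernel_deriv k 0 = \<i> / (1 + 2 * of_real k)"
      using nz by (simp add: dunkl_kernel_deriv_def bessel_odd_def bessel_0 field_simps)
    finally show ?thesis using True nz by (simp add: dunkl_kernel_def bessel_0 bessel_odd_def)
  next
    case False
    have "dunkl_T k (\<lambda>y. dunkl_kernel k (\<xi> * y)) y =
      of_real \<xi> * dunkl_kernel_deriv k (\<xi> * y) + of_real k * (2 * \<i> * of_real (bessel_odd k (\<xi> * y)) / of_real y)"
      unfolding dunkl_T_def d using False kernel_odd[of k "\<xi> * y"] by simp
    also have "2 * \<i> * complex_of_real (bessel_odd k (\<xi> * y)) / of_real y = 2 * \<i> * of_real (\<xi> * bessel (k + 1) (\<xi> * y) / (2 * k + 1))"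
      using False by (simp add: bessel_odd_def)
    also have "of_real \<xi> * dunkl_kernel_deriv k (\<xi> * y) + of_real k * (2 * \<i> * of_real (\<xi> * bessel (k + 1) (\<xi> * y) / (2 * k + 1))) =
       \<i> * of_real \<xi> * dunkl_kernel k (\<xi> * y)"
      by (simp add: dunkl_kernel_def dunkl_kernel_deriv_def algebra_simps)
    finally show ?thesis .
  qed
qed

text \<open>For a solution of the eigenvalue equation with imaginary eigenvalue, the energy \<open>\<bar>v(y)\<bar>\<^sup>2 + \<bar>v(- y)\<bar>\<^sup>2\<close> has derivative \<open>- 2 k \<bar>v(y) - v(- y)\<bar>\<^sup>2 / y\<close>, so it does not increase away from the origin.\<close>

lemma dunkl_kernel_unique:
  assumes k: "k \<ge> 0"
    and d: "\<And>y. (v has_vector_derivative vderiv v y) (at y)"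
    and eq: "\<And>y. dunkl_T k v y = \<i> * of_real \<xi> * v y" and "v 0 = 0"
  shows "v y = 0"
proof -
  have inner_i: "a \<bullet> (\<i> * of_real \<xi> * a) = 0" for a :: complex
    by (simp add: inner_complex_def)
  define N where "N = (\<lambda>y. v y \<bullet> v y + v (- y) \<bullet> v (- y))"
  have N': "(N has_real_derivative 2 * (v y \<bullet> vderiv v y) - 2 * (v (- y) \<bullet> vderiv v (- y))) (at y)" for y
  proof -
    have "(N has_vector_derivative (v y \<bullet> vderiv v y + vderiv v y \<bullet> v y)
        + (v (- y) \<bullet> (- vderiv v (- y)) + (- vderiv v (- y)) \<bullet> v (- y))) (at y)"
      unfolding N_def
      by (rule has_vector_derivative_add; rule bounded_bilinear.has_vector_derivative[OF bounded_bilinear_inner];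
          (rule d has_vector_derivative_reflect[OF d]))
    then show ?thesis
      by (simp add: has_real_derivative_iff_has_vector_derivative inner_commute)
  qed
  have N'_le: "2 * (v y \<bullet> vderiv v y) - 2 * (v (- y) \<bullet> vderiv v (- y)) \<le> 0" if "y > 0" for y
  proof -
    define w where "w = v y - v (- y)"
    have kw: "(k / y) *\<^sub>R w = of_real k * (w / of_real y)" by (simp add: scaleR_conv_of_real)
    have "vderiv v y + of_real k * (w / of_real y) = \<i> * of_real \<xi> * v y"
      using eq[of y] that by (simp add: dunkl_T_def w_def)
    then have e1: "vderiv v y = \<i> * of_real \<xi> * v y - (k / y) *\<^sub>R w"
      unfolding kw eq_diff_eq .
    have "(v (- y) - v y) / of_real (- y) = w / of_real y"
      using that by (simp add: w_def field_simps)
    then have "vderiv v (- y) + of_real k * (w / of_real y) = \<i> * of_real \<xi> * v (- y)"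
      using eq[of "- y"] that by (simp add: dunkl_T_def)
    then have e2: "vderiv v (- y) = \<i> * of_real \<xi> * v (- y) - (k / y) *\<^sub>R w"
      unfolding kw eq_diff_eq .
    have "2 * (v y \<bullet> vderiv v y) - 2 * (v (- y) \<bullet> vderiv v (- y)) = - 2 * (k / y) * (w \<bullet> w)"
      unfolding e1 e2 inner_diff_right inner_i by (simp add: w_def inner_diff_left inner_diff_right algebra_simps)
    also have "\<dots> \<le> 0" using k that by (simp add: zero_le_mult_iff divide_nonneg_pos)
    finally show ?thesis .
  qed
  have "N \<bar>y\<bar> \<le> N 0"
  proof (rule DERIV_nonpos_imp_nonincreasing[where f = N and a = 0 and b = "\<bar>y\<bar>"])
    fix x assume "0 \<le> x" "x \<le> \<bar>y\<bar>"
    then show "\<exists>D. (N has_real_derivative D) (at x) \<and> D \<le> 0"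
      using N'[of x] N'_le[of x] by (cases "x = 0") auto
  qed simp
  then have "N \<bar>y\<bar> \<le> 0" using assms(4) by (simp add: N_def)
  moreover have "v y \<bullet> v y \<le> N \<bar>y\<bar>"
    by (cases "y \<ge> 0") (auto simp: N_def)
  ultimately have "v y \<bullet> v y \<le> 0" by linarith
  then show ?thesis by (simp add: inner_gt_zero_iff flip: not_less)
qed

lemma dunkl_E_eq_kernel:
  assumes k: "k \<ge> 0"
  shows "dunkl_E k x (\<i> * of_real \<xi>) = dunkl_kernel k (\<xi> * x)"
proof -
  have "(THE u. (\<forall>y. u differentiable (at y)) \<and> (\<forall>y. dunkl_T k u y = \<i> * of_real \<xi> * u y) \<and> u 0 = 1) = (\<lambda>y. dunkl_kernel k (\<xi> * y))"
  proof (rule the_equality)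
    show "(\<forall>y. (\<lambda>y. dunkl_kernel k (\<xi> * y)) differentiable (at y)) \<and>
      (\<forall>y. dunkl_T k (\<lambda>y. dunkl_kernel k (\<xi> * y)) y = \<i> * of_real \<xi> * dunkl_kernel k (\<xi> * y)) \<and> dunkl_kernel k (\<xi> * 0) = 1"
      using differentiableI_vector[OF has_vector_derivative_scaled_kernel[OF k]] dunkl_T_kernel[OF k]
      by (simp add: dunkl_kernel_def bessel_0 bessel_odd_def)
  next
    fix u assume u: "(\<forall>y. u differentiable (at y)) \<and> (\<forall>y. dunkl_T k u y = \<i> * of_real \<xi> * u y) \<and> u 0 = 1"
    define v where "v = (\<lambda>y. u y - dunkl_kernel k (\<xi> * y))"
    have ud: "(u has_vector_derivative vderiv u y) (at y)" for y
      using u by (simp add: vector_derivative_works)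
    have vd: "(v has_vector_derivative vderiv u y - vderiv (\<lambda>y. dunkl_kernel k (\<xi> * y)) y) (at y)" for y
      unfolding v_def using vector_derivative_at[OF has_vector_derivative_scaled_kernel[OF k]]
      by (intro has_vector_derivative_diff ud) (simp add: has_vector_derivative_scaled_kernel[OF k])
    have v': "vderiv v y = vderiv u y - vderiv (\<lambda>y. dunkl_kernel k (\<xi> * y)) y" for y
      by (rule vector_derivative_at[OF vd])
    have tv: "dunkl_T k v y = dunkl_T k u y - dunkl_T k (\<lambda>y. dunkl_kernel k (\<xi> * y)) y" for y
      unfolding dunkl_T_def v' by (cases "y = 0") (simp_all add: v_def field_simps)
    have tu: "dunkl_T k u y = \<i> * of_real \<xi> * u y" for y using u by blast
    have Tv: "dunkl_T k v y = \<i> * of_real \<xi> * v y" for y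
      using trans[OF tv[of y] arg_cong2[OF tu[of y] dunkl_T_kernel[OF k, of \<xi> y], of minus]]
      by (simp add: v_def right_diff_distrib)
    have vd': "(v has_vector_derivative vderiv v y) (at y)" for y unfolding v' by (rule vd)
    have v0: "v 0 = 0" using u by (simp add: v_def dunkl_kernel_def bessel_0 bessel_odd_def)
    have "v y = 0" for y by (rule dunkl_kernel_unique[OF k vd' Tv v0])
    then show "u = (\<lambda>y. dunkl_kernel k (\<xi> * y))" by (auto simp: v_def)
  qed
  then show ?thesis by (simp add: dunkl_E_def)
qed

section \<open>Integration against the Dunkl weight\<close>

definition dunkl_weight :: "real \<Rightarrow> real \<Rightarrow> real" where
  "dunkl_weight k x = \<bar>x\<bar> powr (2 * k) / (2 powr (k + 1 / 2) * Gamma (k + 1 / 2))"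

lemma dunkl_measure_eq: "dunkl_measure k = density lborel (\<lambda>x. ennreal (dunkl_weight k x))"
  by (simp add: dunkl_measure_def dunkl_weight_def)

lemma sets_dunkl_measure [measurable_cong]: "sets (dunkl_measure k) = sets borel"
  by (simp add: dunkl_measure_eq)

lemma dunkl_weight_measurable [measurable]: "dunkl_weight k \<in> borel_measurable borel"
  unfolding dunkl_weight_def[abs_def] by measurable

lemma dunkl_weight_constant_pos: "k \<ge> 0 \<Longrightarrow> 2 powr (k + 1 / 2) * Gamma (k + 1 / 2) > (0 :: real)"
  by (intro mult_pos_pos Gamma_real_pos) auto

lemma dunkl_weight_nonneg: "k \<ge> 0 \<Longrightarrow> dunkl_weight k x \<ge> 0"
  unfolding dunkl_weight_def using dunkl_weight_constant_pos[of k] by (intro divide_nonneg_pos) auto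

lemma dunkl_weight_minus: "dunkl_weight k (- x) = dunkl_weight k x"
  by (simp add: dunkl_weight_def)

lemma integral_dunkl_measure:
  fixes f :: "real \<Rightarrow> complex"
  assumes "k \<ge> 0" "f \<in> borel_measurable borel"
  shows "(LINT x|dunkl_measure k. f x) = (LINT x|lborel. dunkl_weight k x *\<^sub>R f x)"
  unfolding dunkl_measure_eq using assms
  by (intro integral_density) (auto simp: dunkl_weight_nonneg)

lemma integrable_dunkl_measure_iff:
  fixes f :: "real \<Rightarrow> complex"
  assumes "k \<ge> 0" "f \<in> borel_measurable borel"
  shows "integrable (dunkl_measure k) f \<longleftrightarrow> integrable lborel (\<lambda>x. dunkl_weight k x *\<^sub>R f x)"
  unfolding dunkl_measure_eq using assms
  by (intro integrable_density) (auto simp: dunkl_weight_nonneg)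

lemma integrable_inverse_one_plus_square: "integrable lborel (\<lambda>x::real. 1 / (1 + x\<^sup>2))"
proof -
  have "set_integrable lborel (einterval (-\<infinity>) \<infinity>) (\<lambda>x::real. 1 / (1 + x\<^sup>2))"
  proof (rule interval_integral_FTC_nonneg(1)[where F = arctan and A = "- (pi / 2)" and B = "pi / 2"])
    show "isCont (\<lambda>x::real. 1 / (1 + x\<^sup>2)) x" for x
      by (intro continuous_intros) (simp add: add_nonneg_eq_0_iff)
    show "((arctan \<circ> real_of_ereal) \<longlongrightarrow> - (pi / 2)) (at_right (- \<infinity>))"
      unfolding ereal_tendsto_simps by (rule tendsto_arctan_at_bot)
    show "((arctan \<circ> real_of_ereal) \<longlongrightarrow> pi / 2) (at_left \<infinity>)"
      unfolding ereal_tendsto_simps by (rule tendsto_arctan_at_top)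
    show "DERIV arctan x :> 1 / (1 + x\<^sup>2)" for x
      using DERIV_arctan[of x] by (simp add: divide_inverse)
  qed auto
  then show ?thesis by (simp add: set_integrable_def)
qed

text \<open>The weight grows polynomially, so a sufficiently high power of \<open>1 + x\<^sup>2\<close> times \<open>f\<close> absorbs it.\<close>

lemma schwartz_weight_decay:
  assumes k: "k \<ge> 0" and f: "f \<in> schwartz"
  shows "\<exists>C. \<forall>x. norm (dunkl_weight k x *\<^sub>R f x) \<le> C / (1 + x\<^sup>2)"
proof -
  define N where "N = nat \<lceil>k\<rceil>"
  define c where "c = 2 powr (k + 1 / 2) * Gamma (k + 1 / 2)"
  have c: "c > 0" unfolding c_def by (rule dunkl_weight_constant_pos[OF k])
  have S: "(\<lambda>x. of_real ((1 + x\<^sup>2) ^ n) * f x) \<in> schwartz" for n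
  proof (induction n)
    case 0
    then show ?case using f by simp
  next
    case (Suc n)
    have "(\<lambda>x. of_real ((1 + x\<^sup>2) ^ n) * f x + of_real x ^ 2 * (of_real ((1 + x\<^sup>2) ^ n) * f x)) \<in> schwartz"
      by (intro schwartz_add schwartz_mult_x_power Suc)
    moreover have "(\<lambda>x. of_real ((1 + x\<^sup>2) ^ n) * f x + of_real x ^ 2 * (of_real ((1 + x\<^sup>2) ^ n) * f x)) =
      (\<lambda>x. of_real ((1 + x\<^sup>2) ^ Suc n) * f x)"
      by (simp add: algebra_simps)
    ultimately show ?case by simp
  qed
  have "\<exists>C. \<forall>x. norm (of_real x ^ 0 * (of_real ((1 + x\<^sup>2) ^ Suc N) * f x)) \<le> C"
    using schwartz_rapid[OF S[of "Suc N"]] unfolding rapid_def by (rule spec)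
  then obtain C where C: "\<And>x. norm (of_real x ^ 0 * (of_real ((1 + x\<^sup>2) ^ Suc N) * f x)) \<le> C" by blast
  have "norm (dunkl_weight k x *\<^sub>R f x) \<le> (C / c) / (1 + x\<^sup>2)" for x
  proof -
    have p: "1 + x\<^sup>2 > 0" by (simp add: add_pos_nonneg)
    have "\<bar>x\<bar> powr (2 * k) = (x\<^sup>2) powr k"
    proof (cases "x = 0")
      case False
      then have "(x\<^sup>2) powr k = (\<bar>x\<bar> powr 2) powr k" by (simp add: powr_numeral)
      then show ?thesis by (simp only: powr_powr)
    qed simp
    also have "\<dots> \<le> (1 + x\<^sup>2) powr k" using k by (intro powr_mono2) auto
    also have "\<dots> \<le> (1 + x\<^sup>2) powr real N" unfolding N_def using k by (intro powr_mono) auto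
    also have "\<dots> = (1 + x\<^sup>2) ^ N" using p by (simp add: powr_realpow)
    finally have w: "\<bar>x\<bar> powr (2 * k) \<le> (1 + x\<^sup>2) ^ N" .
    have "norm (dunkl_weight k x *\<^sub>R f x) = \<bar>x\<bar> powr (2 * k) * norm (f x) / c"
      using c by (simp add: dunkl_weight_def c_def[symmetric])
    also have "\<dots> \<le> (1 + x\<^sup>2) ^ N * norm (f x) / c"
      using c w by (intro divide_right_mono mult_right_mono) auto
    also have "\<dots> = norm (of_real x ^ 0 * (of_real ((1 + x\<^sup>2) ^ Suc N) * f x)) / (1 + x\<^sup>2) / c"
    proof -
      have "norm (of_real x ^ 0 * (of_real ((1 + x\<^sup>2) ^ Suc N) * f x)) = (1 + x\<^sup>2) * ((1 + x\<^sup>2) ^ N * norm (f x))"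
        by (simp only: power_0 mult_1 norm_mult norm_of_real power_Suc abs_mult power_abs abs_of_pos[OF p] mult.assoc)
      then show ?thesis using p by simp
    qed
    also have "\<dots> \<le> C / (1 + x\<^sup>2) / c"
      using c p by (intro divide_right_mono C) auto
    finally show ?thesis by (simp add: field_simps)
  qed
  then show ?thesis by blast
qed

lemma integrable_schwartz_mult:
  fixes h :: "real \<Rightarrow> complex"
  assumes k: "k \<ge> 0" and f: "f \<in> schwartz" and h: "continuous_on UNIV h" and hC: "\<And>x. norm (h x) \<le> C"
  shows "integrable (dunkl_measure k) (\<lambda>x. h x * f x)"
proof -
  obtain D where D: "\<And>x. norm (dunkl_weight k x *\<^sub>R f x) \<le> D / (1 + x\<^sup>2)"
    using schwartz_weight_decay[OF k f] by blast
  have [measurable]: "h \<in> borel_measurable borel" "f \<in> borel_measurable borel"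
    by (intro borel_measurable_continuous_onI h schwartz_continuous f)+
  have "integrable lborel (\<lambda>x. dunkl_weight k x *\<^sub>R (h x * f x))"
  proof (rule Bochner_Integration.integrable_bound)
    show "integrable lborel (\<lambda>x::real. (C * D) * (1 / (1 + x\<^sup>2)))"
      by (intro integrable_mult_right integrable_inverse_one_plus_square)
    show "AE x in lborel. norm (dunkl_weight k x *\<^sub>R (h x * f x)) \<le> norm ((C * D) * (1 / (1 + x\<^sup>2)))"
    proof (rule AE_I2)
      fix x
      have "norm (dunkl_weight k x *\<^sub>R (h x * f x)) = norm (h x) * norm (dunkl_weight k x *\<^sub>R f x)"
        by (simp add: norm_mult)
      also have "\<dots> \<le> C * (D / (1 + x\<^sup>2))"
        using hC[of x] order_trans[OF norm_ge_zero hC[of x]] by (intro mult_mono D) auto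
      also have "\<dots> = (C * D) * (1 / (1 + x\<^sup>2))" by simp
      also have "\<dots> \<le> norm ((C * D) * (1 / (1 + x\<^sup>2)))" by (simp only: real_norm_def abs_ge_self)
      finally show "norm (dunkl_weight k x *\<^sub>R (h x * f x)) \<le> norm ((C * D) * (1 / (1 + x\<^sup>2)))" .
    qed
  qed measurable
  then show ?thesis using k by (subst integrable_dunkl_measure_iff) auto
qed

lemma integrable_schwartz: "k \<ge> 0 \<Longrightarrow> f \<in> schwartz \<Longrightarrow> integrable (dunkl_measure k) f"
  using integrable_schwartz_mult[of k f "\<lambda>_. 1" 1] by simp

lemma integral_dunkl_measure_reflect:
  fixes f :: "real \<Rightarrow> complex"
  assumes "k \<ge> 0" and [measurable]: "f \<in> borel_measurable borel"
  shows "(LINT x|dunkl_measure k. f (- x)) = (LINT x|dunkl_measure k. f x)"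
proof -
  have "(LINT x|dunkl_measure k. f x) = (LINT x|lborel. dunkl_weight k x *\<^sub>R f x)"
    by (rule integral_dunkl_measure) (use assms in auto)
  also have "\<dots> = \<bar>- 1\<bar> *\<^sub>R (LINT x|lborel. dunkl_weight k (0 + (- 1) * x) *\<^sub>R f (0 + (- 1) * x))"
    by (rule lborel_integral_real_affine) simp
  also have "\<dots> = (LINT x|lborel. dunkl_weight k x *\<^sub>R f (- x))"
    by (simp add: dunkl_weight_minus)
  also have "\<dots> = (LINT x|dunkl_measure k. f (- x))"
    by (rule integral_dunkl_measure[symmetric]) (use assms in measurable)
  finally show ?thesis by simp
qed

lemma dunkl_weight_Suc:
  assumes "k \<ge> 0"
  shows "x\<^sup>2 * dunkl_weight k x = (2 * k + 1) * dunkl_weight (k + 1) x"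
proof -
  have G: "Gamma (k + 1 + 1 / 2) = (k + 1 / 2) * Gamma (k + 1 / 2)"
    using Gamma_plus1[of "k + 1 / 2"] nonpos_Ints_nonpos[of "k + 1 / 2"] assms by (force simp: add_ac)
  have t: "2 powr (k + 1 + 1 / 2) = 2 * 2 powr (k + 1 / 2 :: real)"
    using powr_add[of 2 "k + 1 / 2" 1] by (simp add: add_ac)
  have p: "\<bar>x\<bar> powr (2 * (k + 1)) = \<bar>x\<bar> powr (2 * k) * x\<^sup>2"
  proof (cases "x = 0")
    case False
    have "\<bar>x\<bar> powr (2 * (k + 1)) = \<bar>x\<bar> powr (2 * k) * \<bar>x\<bar> powr 2"
      by (simp only: distrib_left mult_1_right powr_add)
    then show ?thesis using False by (simp add: powr_numeral)
  qed simp
  have "Gamma (k + 1 / 2) > 0" using assms by (intro Gamma_real_pos) auto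
  then show ?thesis
    unfolding dunkl_weight_def G t p using assms by (simp add: divide_simps)
qed

lemma integral_dunkl_measure_Suc:
  fixes f :: "real \<Rightarrow> complex"
  assumes "k \<ge> 0" and [measurable]: "f \<in> borel_measurable borel"
  shows "(LINT x|dunkl_measure k. of_real (x\<^sup>2) * f x) = of_real (2 * k + 1) * (LINT x|dunkl_measure (k + 1). f x)"
proof -
  have "(LINT x|dunkl_measure k. of_real (x\<^sup>2) * f x) = (LINT x|lborel. dunkl_weight k x *\<^sub>R (of_real (x\<^sup>2) * f x))"
    by (rule integral_dunkl_measure) (use assms in measurable)
  also have "\<dots> = (LINT x|lborel. (2 * k + 1) *\<^sub>R (dunkl_weight (k + 1) x *\<^sub>R f x))"
  proof (rule Bochner_Integration.integral_cong[OF refl])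
    fix x
    have "dunkl_weight k x *\<^sub>R (of_real (x\<^sup>2) * f x) = (x\<^sup>2 * dunkl_weight k x) *\<^sub>R f x"
      by (simp add: scaleR_conv_of_real mult_ac)
    then show "dunkl_weight k x *\<^sub>R (of_real (x\<^sup>2) * f x) = (2 * k + 1) *\<^sub>R (dunkl_weight (k + 1) x *\<^sub>R f x)"
      unfolding dunkl_weight_Suc[OF assms(1)] by simp
  qed
  also have "\<dots> = (2 * k + 1) *\<^sub>R (LINT x|lborel. dunkl_weight (k + 1) x *\<^sub>R f x)"
    by (rule integral_scaleR_right)
  also have "(LINT x|lborel. dunkl_weight (k + 1) x *\<^sub>R f x) = (LINT x|dunkl_measure (k + 1). f x)"
    by (rule integral_dunkl_measure[symmetric]) (use assms in auto)
  finally show ?thesis by (simp add: scaleR_conv_of_real)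
qed

lemma integral_even_eq_twice:
  fixes f :: "real \<Rightarrow> 'a :: euclidean_space"
  assumes f: "integrable lborel f" and even: "\<And>x. f (- x) = f x"
  shows "integral\<^sup>L lborel f = 2 *\<^sub>R (LBINT x=0..\<infinity>. f x)"
proof -
  have si: "set_integrable lborel A f" if "A \<in> sets lborel" for A
    unfolding set_integrable_def using that f by (rule integrable_mult_indicator)
  have "(LBINT x=-\<infinity>..0. f x) + (LBINT x=0..\<infinity>. f x) = (LBINT x=-\<infinity>..\<infinity>. f x)"
    by (rule interval_integral_sum) (simp add: interval_lebesgue_integrable_def si)
  moreover have "(LBINT x=-\<infinity>..0. f x) = (LBINT x=0..\<infinity>. f x)"
    by (subst interval_integral_reflect) (simp add: even)
  moreover have "(LBINT x=-\<infinity>..\<infinity>. f x) = integral\<^sup>L lborel f"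
    by (simp add: interval_lebesgue_integral_def set_lebesgue_integral_def)
  ultimately show ?thesis by (simp add: scaleR_2)
qed

section \<open>The Dunkl transform\<close>

text \<open>After adding the values at \<open>y\<close> and \<open>- y\<close>, the integrand on the half-line is the derivative of \<open>w(y) (f(y) h(y) - f(- y) h(- y))\<close>, where \<open>w\<close> is the weight: the logarithmic derivative \<open>2 k / y\<close> of \<open>w\<close> matches the difference terms of the Dunkl operators. The boundary term vanishes at \<open>0\<close> because the bracket is odd, and at infinity because of decay.\<close>

lemma dunkl_integration_by_parts:
  assumes k: "k \<ge> 0" and f: "f \<in> schwartz"
    and h: "\<And>y. (h has_vector_derivative h' y) (at y)" and hC: "\<And>y. norm (h y) \<le> C"
    and Th: "continuous_on UNIV Th" "\<And>y. norm (Th y) \<le> C'"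
    and Th_eq: "\<And>y. y \<noteq> 0 \<Longrightarrow> Th y = h' y + of_real k * ((h y - h (- y)) / of_real y)"
  shows "(LINT y|dunkl_measure k. h y * dunkl_T k f y) = - (LINT y|dunkl_measure k. Th y * f y)"
proof -
  define c where "c = 2 powr (k + 1 / 2) * Gamma (k + 1 / 2)"
  have c: "c > 0" unfolding c_def by (rule dunkl_weight_constant_pos[OF k])
  have Tf: "dunkl_T k f \<in> schwartz" by (rule schwartz_dunkl_T[OF f])
  have hc: "continuous_on UNIV h"
    using has_vector_derivative_continuous[OF h] by (intro continuous_at_imp_continuous_on) blast
  note cont = hc Th(1) schwartz_continuous[OF f, of UNIV] schwartz_continuous[OF Tf, of UNIV]
  note [measurable] = cont[THEN borel_measurable_continuous_onI]
  define \<phi> where "\<phi> = (\<lambda>y. h y * dunkl_T k f y + Th y * f y)"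
  have [measurable]: "\<phi> \<in> borel_measurable borel" unfolding \<phi>_def by measurable
  have int1: "integrable (dunkl_measure k) (\<lambda>y. h y * dunkl_T k f y)"
    by (rule integrable_schwartz_mult[OF k Tf hc hC])
  have int2: "integrable (dunkl_measure k) (\<lambda>y. Th y * f y)"
    by (rule integrable_schwartz_mult[OF k f Th])
  have int\<phi>: "integrable (dunkl_measure k) \<phi>" unfolding \<phi>_def by (intro Bochner_Integration.integrable_add int1 int2)
  define \<psi> where "\<psi> = (\<lambda>y. dunkl_weight k y *\<^sub>R (\<phi> y + \<phi> (- y)))"
  have int\<phi>': "integrable lborel (\<lambda>y. dunkl_weight k y *\<^sub>R \<phi> y)"
    using int\<phi> by (subst (asm) integrable_dunkl_measure_iff[OF k]) auto
  have int\<psi>: "integrable lborel \<psi>"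
  proof -
    have "integrable lborel (\<lambda>y. dunkl_weight k (0 + (- 1) * y) *\<^sub>R \<phi> (0 + (- 1) * y))"
      by (rule lborel_integrable_real_affine[OF int\<phi>']) simp
    then have "integrable lborel (\<lambda>y. dunkl_weight k y *\<^sub>R \<phi> y + dunkl_weight k y *\<^sub>R \<phi> (- y))"
      by (intro Bochner_Integration.integrable_add int\<phi>') (simp add: dunkl_weight_minus)
    then show ?thesis by (simp add: \<psi>_def scaleR_add_right)
  qed
  have "integral\<^sup>L lborel \<psi> = 2 * (LINT y|dunkl_measure k. \<phi> y)"
  proof -
    have "(LINT y|dunkl_measure k. \<phi> y + \<phi> (- y)) = integral\<^sup>L lborel \<psi>"
      unfolding \<psi>_def by (rule integral_dunkl_measure[OF k]) measurable
    moreover have "(LINT y|dunkl_measure k. \<phi> y + \<phi> (- y)) = (LINT y|dunkl_measure k. \<phi> y) + (LINT y|dunkl_measure k. \<phi> (- y))"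
    proof (rule Bochner_Integration.integral_add[OF int\<phi>])
      have "integrable lborel (\<lambda>y. dunkl_weight k (0 + (- 1) * y) *\<^sub>R \<phi> (0 + (- 1) * y))"
        by (rule lborel_integrable_real_affine[OF int\<phi>']) simp
      then have "integrable lborel (\<lambda>y. dunkl_weight k y *\<^sub>R \<phi> (- y))" by (simp add: dunkl_weight_minus)
      then show "integrable (dunkl_measure k) (\<lambda>y. \<phi> (- y))"
        by (subst integrable_dunkl_measure_iff[OF k]) auto
    qed
    ultimately show ?thesis using integral_dunkl_measure_reflect[OF k, of \<phi>] by simp
  qed
  moreover have "integral\<^sup>L lborel \<psi> = 2 *\<^sub>R (LBINT y=0..\<infinity>. \<psi> y)"
    by (rule integral_even_eq_twice[OF int\<psi>]) (simp add: \<psi>_def dunkl_weight_minus add.commute)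
  moreover have "(LBINT y=0..\<infinity>. \<psi> y) = 0 - 0"
  proof (rule interval_integral_FTC_integrable)
    define D where "D = (\<lambda>y. f y * h y - f (- y) * h (- y))"
    define D' where "D' = (\<lambda>y. (f y * h' y + vderiv f y * h y) - (f (- y) * - h' (- y) + - vderiv f (- y) * h (- y)))"
    have D: "(D has_vector_derivative D' y) (at y)" for y
      unfolding D_def D'_def
      by (rule has_vector_derivative_diff[OF has_vector_derivative_mult[OF schwartz_has_vector_derivative[OF f] h]
          has_vector_derivative_mult[OF has_vector_derivative_reflect[OF schwartz_has_vector_derivative[OF f]]
            has_vector_derivative_reflect[OF h]]])
    have w: "(dunkl_weight k has_real_derivative 2 * k / y * dunkl_weight k y) (at y)" if "y > 0" for y
    proof -
      have "((\<lambda>y. y powr (2 * k) / c) has_real_derivative (2 * k * y powr (2 * k - 1)) / c) (at y)"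
        by (rule DERIV_cdivide[OF has_real_derivative_powr[OF that]])
      moreover have "(2 * k * y powr (2 * k - 1)) / c = 2 * k / y * dunkl_weight k y"
        using that by (simp add: dunkl_weight_def c_def[symmetric] powr_diff)
      ultimately have "((\<lambda>y. y powr (2 * k) / c) has_real_derivative 2 * k / y * dunkl_weight k y) (at y)" by simp
      moreover have "\<forall>\<^sub>F z in nhds y. dunkl_weight k z = z powr (2 * k) / c"
      proof (rule eventually_mono)
        show "\<forall>\<^sub>F z in nhds y. z \<in> {0<..}" using that by (intro eventually_nhds_in_open) auto
      qed (simp add: dunkl_weight_def c_def)
      ultimately show ?thesis by (subst DERIV_cong_ev[OF refl _ refl]) auto
    qed
    have sum: "\<phi> y + \<phi> (- y) = D' y + of_real (2 * k / y) * D y" if y: "y > 0" for y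
    proof -
      have T1: "dunkl_T k f y = vderiv f y + of_real k * ((f y - f (- y)) / of_real y)"
        using y by (simp add: dunkl_T_def)
      have q: "(a - b) / of_real (- y) = (b - a) / of_real y" for a b :: complex
        unfolding of_real_minus by (subst minus_divide_divide[symmetric]) simp
      have "dunkl_T k f (- y) = vderiv f (- y) + of_real k * ((f (- y) - f (- (- y))) / of_real (- y))"
        using y by (simp add: dunkl_T_def)
      then have T2: "dunkl_T k f (- y) = vderiv f (- y) + of_real k * ((f y - f (- y)) / of_real y)"
        unfolding q minus_minus .
      have H1: "Th y = h' y + of_real k * ((h y - h (- y)) / of_real y)"
        using y by (intro Th_eq) simp
      have "Th (- y) = h' (- y) + of_real k * ((h (- y) - h (- (- y))) / of_real (- y))"
        using y by (intro Th_eq) simp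
      then have H2: "Th (- y) = h' (- y) + of_real k * ((h y - h (- y)) / of_real y)"
        unfolding q minus_minus .
      have i: "a / of_real y = a * inverse (of_real y)" for a :: complex by (rule divide_inverse)
      have j: "complex_of_real (2 * k / y) = 2 * of_real k * inverse (of_real y)" by (simp add: divide_inverse)
      show ?thesis unfolding \<phi>_def T1 T2 H1 H2 D_def D'_def i j by (simp add: algebra_simps)
    qed
    show "((\<lambda>y. dunkl_weight k y *\<^sub>R D y) has_vector_derivative \<psi> y) (at y)" if "0 < ereal y" "ereal y < \<infinity>" for y
    proof -
      have y: "y > 0" using that by simp
      have "((\<lambda>y. dunkl_weight k y *\<^sub>R D y) has_vector_derivative
         dunkl_weight k y *\<^sub>R D' y + (2 * k / y * dunkl_weight k y) *\<^sub>R D y) (at y)"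
        by (rule has_vector_derivative_scaleR[OF w[OF y] D])
      also have "dunkl_weight k y *\<^sub>R D' y + (2 * k / y * dunkl_weight k y) *\<^sub>R D y = \<psi> y"
        unfolding \<psi>_def sum[OF y] by (simp add: scaleR_conv_of_real algebra_simps)
      finally show ?thesis .
    qed
    show "isCont \<psi> y" if "0 < ereal y" "ereal y < \<infinity>" for y
    proof -
      have y: "y > 0" using that by simp
      have [continuous_intros]: "isCont h z" "isCont Th z" "isCont f z" "isCont (dunkl_T k f) z" for z
        using cont by (simp_all add: continuous_on_eq_continuous_at)
      have "isCont (\<lambda>y. g (- y)) y" if "\<And>z. isCont g z" for g :: "real \<Rightarrow> complex"
        using continuous_at_compose[of y uminus g] that by (simp add: o_def)
      then have [continuous_intros]: "isCont (\<lambda>y. h (- y)) y" "isCont (\<lambda>y. Th (- y)) y" "isCont (\<lambda>y. f (- y)) y" "isCont (\<lambda>y. dunkl_T k f (- y)) y"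
        by (blast intro: \<open>\<And>z. isCont h z\<close> \<open>\<And>z. isCont Th z\<close> \<open>\<And>z. isCont f z\<close> \<open>\<And>z. isCont (dunkl_T k f) z\<close>)+
      have wc: "isCont (dunkl_weight k) y" using w[OF y] by (rule DERIV_isCont)
      show ?thesis unfolding \<psi>_def \<phi>_def by (intro continuous_intros wc)
    qed
    show "set_integrable lborel (einterval 0 \<infinity>) \<psi>"
      unfolding set_integrable_def by (intro integrable_mult_indicator int\<psi>) auto
    have "((\<lambda>y. dunkl_weight k y *\<^sub>R D y) \<longlongrightarrow> 0) (at_right 0)"
    proof (rule Lim_null_comparison)
      have "continuous_on UNIV D" using has_vector_derivative_continuous[OF D] by (intro continuous_at_imp_continuous_on) blast
      then have "(D \<longlongrightarrow> D 0) (at_right 0)"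
        by (simp add: continuous_on_eq_continuous_at isCont_def filterlim_at_split)
      then have "((\<lambda>y. (1 / c) * norm (D y)) \<longlongrightarrow> (1 / c) * norm (D 0)) (at_right 0)"
        by (intro tendsto_intros)
      then show "((\<lambda>y. (1 / c) * norm (D y)) \<longlongrightarrow> 0) (at_right 0)" by (simp add: D_def)
      have "\<forall>\<^sub>F y in at_right 0. y \<in> {0<..<1::real}" by (rule eventually_at_right_real) simp
      then show "\<forall>\<^sub>F y in at_right 0. norm (dunkl_weight k y *\<^sub>R D y) \<le> (1 / c) * norm (D y)"
      proof eventually_elim
        fix y :: real assume y: "y \<in> {0<..<1}"
        have "y powr (2 * k) \<le> 1" using y k powr_le1[of "2 * k" y] by simp
        then have "dunkl_weight k y \<le> 1 / c"
          using c y by (simp add: dunkl_weight_def c_def[symmetric] divide_right_mono)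
        then show "norm (dunkl_weight k y *\<^sub>R D y) \<le> (1 / c) * norm (D y)"
          using dunkl_weight_nonneg[OF k, of y] by (simp only: norm_scaleR abs_of_nonneg mult_right_mono norm_ge_zero)
      qed
    qed
    then show "(((\<lambda>y. dunkl_weight k y *\<^sub>R D y) \<circ> real_of_ereal) \<longlongrightarrow> 0) (at_right 0)"
      by (simp add: zero_ereal_def ereal_tendsto_simps)
    obtain E where E: "\<And>y. norm (dunkl_weight k y *\<^sub>R f y) \<le> E / (1 + y\<^sup>2)"
      using schwartz_weight_decay[OF k f] by blast
    have "((\<lambda>y. dunkl_weight k y *\<^sub>R D y) \<longlongrightarrow> 0) at_top"
    proof (rule Lim_null_comparison)
      have bound: "norm (dunkl_weight k y *\<^sub>R D y) \<le> (2 * C * E) / (1 + y\<^sup>2)" for y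
      proof -
        have E0: "0 \<le> E / (1 + z\<^sup>2)" for z by (rule order_trans[OF norm_ge_zero E])
        have part: "norm ((dunkl_weight k z *\<^sub>R f z) * h z) \<le> E / (1 + z\<^sup>2) * C" for z
          unfolding norm_mult by (rule mult_mono[OF E hC E0 norm_ge_zero])
        have "norm (dunkl_weight k y *\<^sub>R D y) = norm ((dunkl_weight k y *\<^sub>R f y) * h y - (dunkl_weight k (- y) *\<^sub>R f (- y)) * h (- y))"
          unfolding D_def dunkl_weight_minus by (simp only: scaleR_diff_right mult_scaleR_left)
        also have "\<dots> \<le> E / (1 + y\<^sup>2) * C + E / (1 + (- y)\<^sup>2) * C"
          by (rule order_trans[OF norm_triangle_ineq4 add_mono[OF part part]])
        also have "\<dots> = (2 * C * E) / (1 + y\<^sup>2)" by (simp add: add_divide_distrib)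
        finally show ?thesis .
      qed
      show "\<forall>\<^sub>F y in at_top. norm (dunkl_weight k y *\<^sub>R D y) \<le> (2 * C * E) / (1 + y\<^sup>2)"
        by (rule always_eventually) (use bound in blast)
      have "y \<le> 1 + y\<^sup>2" for y :: real
      proof -
        have "2 * y \<le> 1 + y\<^sup>2" using zero_le_power2[of "y - 1"] by (simp add: power2_diff)
        then show ?thesis using zero_le_power2[of y] by linarith
      qed
      then have "filterlim (\<lambda>y::real. 1 + y\<^sup>2) at_top at_top"
        by (intro filterlim_at_top_mono[OF filterlim_ident] always_eventually) blast
      from tendsto_divide_0[OF tendsto_const filterlim_at_top_imp_at_infinity[OF this]]
      show "((\<lambda>y::real. (2 * C * E) / (1 + y\<^sup>2)) \<longlongrightarrow> 0) at_top" .
    qed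
    then show "(((\<lambda>y. dunkl_weight k y *\<^sub>R D y) \<circ> real_of_ereal) \<longlongrightarrow> 0) (at_left \<infinity>)"
      by (simp add: ereal_tendsto_simps)
  qed auto
  ultimately have "(LINT y|dunkl_measure k. \<phi> y) = 0" by simp
  then show ?thesis
    unfolding \<phi>_def Bochner_Integration.integral_add[OF int1 int2] by (simp add: add_eq_0_iff2)
qed

subsection \<open>Differentiation under the integral sign\<close>

lemma has_vector_derivative_iff_quotient:
  "(f has_vector_derivative d) (at x within S) \<longleftrightarrow> ((\<lambda>s. (f s - f x) /\<^sub>R (s - x)) \<longlongrightarrow> d) (at x within S)"
proof -
  have e: "norm ((1 / norm (s - x)) *\<^sub>R (f s - (f x + (s - x) *\<^sub>R d))) = norm ((f s - f x) /\<^sub>R (s - x) - d)"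
    if "s \<noteq> x" for s
  proof -
    have "(f s - f x) /\<^sub>R (s - x) - d = (f s - (f x + (s - x) *\<^sub>R d)) /\<^sub>R (s - x)"
      using that by (simp add: scaleR_diff_right scaleR_add_right)
    then show ?thesis by (simp add: divide_inverse)
  qed
  have "(f has_vector_derivative d) (at x within S) \<longleftrightarrow>
      ((\<lambda>s. (1 / norm (s - x)) *\<^sub>R (f s - (f x + (s - x) *\<^sub>R d))) \<longlongrightarrow> 0) (at x within S)"
    by (simp add: has_vector_derivative_def has_derivative_within bounded_linear_scaleR_left)
  also have "\<dots> \<longleftrightarrow> ((\<lambda>s. norm ((1 / norm (s - x)) *\<^sub>R (f s - (f x + (s - x) *\<^sub>R d)))) \<longlongrightarrow> 0) (at x within S)"
    by (rule tendsto_norm_zero_iff[symmetric])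
  also have "\<dots> \<longleftrightarrow> ((\<lambda>s. norm ((f s - f x) /\<^sub>R (s - x) - d)) \<longlongrightarrow> 0) (at x within S)"
    by (rule filterlim_cong[OF refl refl]) (unfold eventually_at_filter, rule always_eventually, use e in blast)
  also have "\<dots> \<longleftrightarrow> ((\<lambda>s. (f s - f x) /\<^sub>R (s - x) - d) \<longlongrightarrow> 0) (at x within S)"
    by (rule tendsto_norm_zero_iff)
  also have "\<dots> \<longleftrightarrow> ((\<lambda>s. (f s - f x) /\<^sub>R (s - x)) \<longlongrightarrow> d) (at x within S)"
    by (rule LIM_zero_iff)
  finally show ?thesis .
qed

lemma has_vector_derivative_lebesgue_integral:
  fixes K :: "real \<Rightarrow> 'a \<Rightarrow> complex"
  assumes K: "\<And>s y. ((\<lambda>s. K s y) has_vector_derivative K' s y) (at s)"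
    and int: "\<And>s. integrable M (K s)" and int': "integrable M (K' s0)"
    and bound: "\<And>s y. \<bar>s - s0\<bar> < 1 \<Longrightarrow> norm (K' s y) \<le> B y" and B: "integrable M B"
  shows "((\<lambda>s. LINT y|M. K s y) has_vector_derivative (LINT y|M. K' s0 y)) (at s0)"
proof -
  define S where "S = {s0 - 1<..<s0 + 1}"
  have S: "open S" "s0 \<in> S" "convex S" by (auto simp: S_def)
  have SB: "s \<in> S \<Longrightarrow> \<bar>s - s0\<bar> < 1" for s by (auto simp: S_def)
  have lip: "norm (K s y - K s0 y) \<le> B y * \<bar>s - s0\<bar>" if "s \<in> S" for s y
  proof -
    have "norm (K s y - K s0 y) \<le> B y * norm (s - s0)"
    proof (rule differentiable_bound[OF S(3) _ _ that S(2)])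
      show "((\<lambda>s. K s y) has_derivative (\<lambda>h. h *\<^sub>R K' x y)) (at x within S)" for x
        using K[of y x] unfolding has_vector_derivative_def by (rule has_derivative_at_withinI)
      show "onorm (\<lambda>h. h *\<^sub>R K' x y) \<le> B y" if "x \<in> S" for x
      proof (rule onorm_le)
        fix h :: real
        have "norm (h *\<^sub>R K' x y) = norm (K' x y) * norm h" by simp
        also have "\<dots> \<le> B y * norm h" by (intro mult_right_mono bound SB that) auto
        finally show "norm (h *\<^sub>R K' x y) \<le> B y * norm h" .
      qed
    qed
    then show ?thesis by simp
  qed
  have lim: "((\<lambda>s. ((LINT y|M. K s y) - (LINT y|M. K s0 y)) /\<^sub>R (s - s0)) \<longlongrightarrow> (LINT y|M. K' s0 y)) (at s0 within S)"
    unfolding tendsto_at_iff_sequentially comp_def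
  proof (intro allI impI)
    fix X assume X: "\<forall>i. X i \<in> S - {s0}" "X \<longlonglongrightarrow> s0"
    have "(\<lambda>i. LINT y|M. (K (X i) y - K s0 y) /\<^sub>R (X i - s0)) \<longlonglongrightarrow> (LINT y|M. K' s0 y)"
    proof (rule integral_dominated_convergence)
      show "K' s0 \<in> borel_measurable M" using int' by (rule borel_measurable_integrable)
      show "(\<lambda>y. (K (X i) y - K s0 y) /\<^sub>R (X i - s0)) \<in> borel_measurable M" for i
        using borel_measurable_integrable[OF int] by measurable
      show "AE y in M. (\<lambda>i. (K (X i) y - K s0 y) /\<^sub>R (X i - s0)) \<longlonglongrightarrow> K' s0 y"
      proof (rule AE_I2)
        fix y
        have "((\<lambda>s. (K s y - K s0 y) /\<^sub>R (s - s0)) \<longlongrightarrow> K' s0 y) (at s0)"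
          using K[of y s0] by (simp add: has_vector_derivative_iff_quotient)
        then show "(\<lambda>i. (K (X i) y - K s0 y) /\<^sub>R (X i - s0)) \<longlonglongrightarrow> K' s0 y"
          using X unfolding tendsto_at_iff_sequentially comp_def by auto
      qed
      show "AE y in M. norm ((K (X i) y - K s0 y) /\<^sub>R (X i - s0)) \<le> B y" for i
      proof (rule AE_I2)
        fix y
        have p: "\<bar>X i - s0\<bar> > 0" using X(1) by auto
        have "norm ((K (X i) y - K s0 y) /\<^sub>R (X i - s0)) = norm (K (X i) y - K s0 y) / \<bar>X i - s0\<bar>"
          by (simp only: norm_scaleR abs_inverse) (simp only: divide_inverse mult.commute)
        also have "\<dots> \<le> B y * \<bar>X i - s0\<bar> / \<bar>X i - s0\<bar>"
          using X(1) by (intro divide_right_mono lip) auto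
        also have "\<dots> = B y" using p by simp
        finally show "norm ((K (X i) y - K s0 y) /\<^sub>R (X i - s0)) \<le> B y" .
      qed
    qed (rule B)
    moreover have "(LINT y|M. (K (X i) y - K s0 y) /\<^sub>R (X i - s0)) = ((LINT y|M. K (X i) y) - (LINT y|M. K s0 y)) /\<^sub>R (X i - s0)" for i
      by (simp add: Bochner_Integration.integral_diff[OF int int])
    ultimately show "(\<lambda>i. ((LINT y|M. K (X i) y) - (LINT y|M. K s0 y)) /\<^sub>R (X i - s0)) \<longlonglongrightarrow> (LINT y|M. K' s0 y)"
      by (simp only:)
  qed
  then have "((\<lambda>s. LINT y|M. K s y) has_vector_derivative (LINT y|M. K' s0 y)) (at s0 within S)"
    unfolding has_vector_derivative_iff_quotient .
  then show ?thesis unfolding at_within_open[OF S(2,1)] .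
qed

subsection \<open>Intertwining relations\<close>

lemma dunkl_transform_eq:
  assumes "k \<ge> 0"
  shows "dunkl_transform k f \<xi> = (LINT y|dunkl_measure k. dunkl_kernel k (- \<xi> * y) * f y)"
proof -
  have "dunkl_E k y (- (\<i> * of_real \<xi>)) = dunkl_kernel k (- \<xi> * y)" for y
    using dunkl_E_eq_kernel[OF assms, of y "- \<xi>"] by simp
  then show ?thesis by (simp add: dunkl_transform_def)
qed

lemma continuous_scaled_kernel: "k \<ge> 0 \<Longrightarrow> continuous_on A (\<lambda>y. dunkl_kernel k (\<xi> * y))"
  by (rule continuous_on_compose2[OF continuous_kernel[of k UNIV]]) (auto intro!: continuous_intros)

lemma continuous_kernel_deriv: "k \<ge> 0 \<Longrightarrow> continuous_on A (dunkl_kernel_deriv k)"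
proof -
  assume k: "k \<ge> 0"
  have "continuous_on A (bessel_odd k)"
    by (intro continuous_at_imp_continuous_on) (blast intro: DERIV_isCont has_derivative_bessel_odd k)
  then show ?thesis unfolding dunkl_kernel_deriv_def[abs_def]
    using k by (intro continuous_intros continuous_bessel) auto
qed

lemma continuous_scaled_kernel_deriv: "k \<ge> 0 \<Longrightarrow> continuous_on A (\<lambda>y. dunkl_kernel_deriv k (\<xi> * y))"
  by (rule continuous_on_compose2[OF continuous_kernel_deriv[of k UNIV]]) (auto intro!: continuous_intros)

lemma integrable_kernel_mult:
  "k \<ge> 0 \<Longrightarrow> f \<in> schwartz \<Longrightarrow> integrable (dunkl_measure k) (\<lambda>y. dunkl_kernel k (\<xi> * y) * f y)"
  by (rule integrable_schwartz_mult[where C = 1]) (auto intro: norm_kernel continuous_scaled_kernel)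

lemma dunkl_transform_lincomb:
  assumes k: "k \<ge> 0" and f: "f \<in> schwartz" and g: "g \<in> schwartz"
  shows "dunkl_transform k (\<lambda>x. a * f x + b * g x) \<xi> = a * dunkl_transform k f \<xi> + b * dunkl_transform k g \<xi>"
proof -
  note int = integrable_kernel_mult[OF k f, of "- \<xi>"] integrable_kernel_mult[OF k g, of "- \<xi>"]
  have "dunkl_transform k (\<lambda>x. a * f x + b * g x) \<xi> =
    (LINT y|dunkl_measure k. a * (dunkl_kernel k (- \<xi> * y) * f y) + b * (dunkl_kernel k (- \<xi> * y) * g y))"
    unfolding dunkl_transform_eq[OF k] by (simp add: algebra_simps)
  also have "\<dots> = (LINT y|dunkl_measure k. a * (dunkl_kernel k (- \<xi> * y) * f y)) + (LINT y|dunkl_measure k. b * (dunkl_kernel k (- \<xi> * y) * g y))"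
    by (rule Bochner_Integration.integral_add) (intro integrable_mult_right int)+
  finally show ?thesis unfolding dunkl_transform_eq[OF k] by simp
qed

lemma dunkl_transform_dunkl_T:
  assumes k: "k \<ge> 0" and f: "f \<in> schwartz"
  shows "dunkl_transform k (dunkl_T k f) \<xi> = \<i> * of_real \<xi> * dunkl_transform k f \<xi>"
proof -
  have "(LINT y|dunkl_measure k. dunkl_kernel k (- \<xi> * y) * dunkl_T k f y) =
    - (LINT y|dunkl_measure k. (\<i> * of_real (- \<xi>) * dunkl_kernel k (- \<xi> * y)) * f y)"
  proof (rule dunkl_integration_by_parts[OF k f has_vector_derivative_scaled_kernel[OF k]])
    show "norm (dunkl_kernel k (- \<xi> * y)) \<le> 1" for y by (rule norm_kernel[OF k])
    show "continuous_on UNIV (\<lambda>y. \<i> * of_real (- \<xi>) * dunkl_kernel k (- \<xi> * y))"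
      by (intro continuous_intros continuous_scaled_kernel k)
    show "norm (\<i> * of_real (- \<xi>) * dunkl_kernel k (- \<xi> * y)) \<le> \<bar>\<xi>\<bar> * 1" for y
    proof -
      have "norm (\<i> * of_real (- \<xi>) * dunkl_kernel k (- \<xi> * y)) = \<bar>\<xi>\<bar> * norm (dunkl_kernel k (- \<xi> * y))"
        by (simp add: norm_mult)
      also have "\<dots> \<le> \<bar>\<xi>\<bar> * 1" by (intro mult_left_mono norm_kernel k) auto
      finally show ?thesis .
    qed
    fix y :: real assume y: "y \<noteq> 0"
    have v: "vderiv (\<lambda>y. dunkl_kernel k (- \<xi> * y)) y = of_real (- \<xi>) * dunkl_kernel_deriv k (- \<xi> * y)"
      by (rule vector_derivative_at[OF has_vector_derivative_scaled_kernel[OF k]])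
    show "\<i> * of_real (- \<xi>) * dunkl_kernel k (- \<xi> * y) = of_real (- \<xi>) * dunkl_kernel_deriv k (- \<xi> * y) +
       of_real k * ((dunkl_kernel k (- \<xi> * y) - dunkl_kernel k (- \<xi> * - y)) / of_real y)"
      unfolding dunkl_T_kernel[OF k, symmetric] dunkl_T_def v using y by simp
  qed
  also have "\<dots> = \<i> * of_real \<xi> * (LINT y|dunkl_measure k. dunkl_kernel k (- \<xi> * y) * f y)"
    by (simp add: mult.assoc)
  finally show ?thesis unfolding dunkl_transform_eq[OF k] .
qed

lemma integrable_kernel_deriv_mult:
  assumes k: "k \<ge> 0" and f: "f \<in> schwartz"
  shows "integrable (dunkl_measure k) (\<lambda>y. of_real (- y) * dunkl_kernel_deriv k (- y * \<xi>) * f y)"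
proof -
  have "integrable (dunkl_measure k) (\<lambda>y. - dunkl_kernel_deriv k (- \<xi> * y) * (of_real y * f y))"
  proof (rule integrable_schwartz_mult[OF k schwartz_mult_x[OF f], where C = 3])
    show "continuous_on UNIV (\<lambda>y. - dunkl_kernel_deriv k (- \<xi> * y))"
      by (intro continuous_on_minus continuous_scaled_kernel_deriv k)
    show "norm (- dunkl_kernel_deriv k (- \<xi> * y)) \<le> 3" for y
      unfolding norm_minus_cancel by (rule norm_kernel_deriv[OF k])
  qed
  then show ?thesis by (simp add: mult_ac)
qed

lemma has_vector_derivative_dunkl_transform:
  assumes k: "k \<ge> 0" and f: "f \<in> schwartz"
  shows "(dunkl_transform k f has_vector_derivative
    (LINT y|dunkl_measure k. of_real (- y) * dunkl_kernel_deriv k (- y * \<xi>) * f y)) (at \<xi>)"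
proof -
  have xf: "(\<lambda>y. of_real y * f y) \<in> schwartz" by (rule schwartz_mult_x[OF f])
  have int': "integrable (dunkl_measure k) (\<lambda>y. of_real (- y) * dunkl_kernel_deriv k (- y * \<xi>) * f y)"
    by (rule integrable_kernel_deriv_mult[OF k f])
  have "((\<lambda>\<xi>. LINT y|dunkl_measure k. dunkl_kernel k (- y * \<xi>) * f y) has_vector_derivative
    (LINT y|dunkl_measure k. of_real (- y) * dunkl_kernel_deriv k (- y * \<xi>) * f y)) (at \<xi>)"
  proof (rule has_vector_derivative_lebesgue_integral[where B = "\<lambda>y. 3 * norm (of_real y * f y)"])
    show "((\<lambda>s. dunkl_kernel k (- y * s) * f y) has_vector_derivative of_real (- y) * dunkl_kernel_deriv k (- y * s) * f y) (at s)" for s y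
      by (intro has_vector_derivative_mult_left has_vector_derivative_scaled_kernel k)
    show "integrable (dunkl_measure k) (\<lambda>y. dunkl_kernel k (- y * s) * f y)" for s
      using integrable_kernel_mult[OF k f, of "- s"] by (simp add: mult.commute)
    show "norm (of_real (- y) * dunkl_kernel_deriv k (- y * s) * f y) \<le> 3 * norm (of_real y * f y)" for s y
    proof -
      have "norm (of_real (- y) * dunkl_kernel_deriv k (- y * s) * f y) = norm (dunkl_kernel_deriv k (- y * s)) * norm (of_real y * f y)"
        by (simp add: norm_mult)
      also have "\<dots> \<le> 3 * norm (of_real y * f y)"
        by (intro mult_right_mono norm_kernel_deriv k) auto
      finally show ?thesis .
    qed
    show "integrable (dunkl_measure k) (\<lambda>y. 3 * norm (of_real y * f y))"
      by (intro integrable_mult_right integrable_norm integrable_schwartz k xf)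
  qed (rule int')
  moreover have "dunkl_transform k f = (\<lambda>\<xi>. LINT y|dunkl_measure k. dunkl_kernel k (- y * \<xi>) * f y)"
    unfolding dunkl_transform_eq[OF k, abs_def] by (simp add: mult.commute)
  ultimately show ?thesis by simp
qed

lemma dunkl_T_dunkl_transform:
  assumes k: "k \<ge> 0" and f: "f \<in> schwartz"
  shows "dunkl_T k (dunkl_transform k f) \<xi> = - \<i> * dunkl_transform k (\<lambda>y. of_real y * f y) \<xi>"
proof -
  have xf: "(\<lambda>y. of_real y * f y) \<in> schwartz" by (rule schwartz_mult_x[OF f])
  let ?D = "\<lambda>\<xi> y. of_real (- y) * dunkl_kernel_deriv k (- y * \<xi>) * f y"
  have intD: "integrable (dunkl_measure k) (?D \<xi>)" for \<xi>
    by (rule integrable_kernel_deriv_mult[OF k f])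
  have v: "vderiv (dunkl_transform k f) \<xi> = (LINT y|dunkl_measure k. ?D \<xi> y)" for \<xi>
    by (rule vector_derivative_at[OF has_vector_derivative_dunkl_transform[OF k f]])
  have v': "vderiv (\<lambda>\<xi>. dunkl_kernel k (- y * \<xi>)) \<xi> = of_real (- y) * dunkl_kernel_deriv k (- y * \<xi>)" for y \<xi>
    by (rule vector_derivative_at[OF has_vector_derivative_scaled_kernel[OF k]])
  have pointwise: "dunkl_T k (\<lambda>\<xi>. dunkl_kernel k (- y * \<xi>)) \<xi> * f y = - \<i> * (dunkl_kernel k (- \<xi> * y) * (of_real y * f y))" for y
    unfolding dunkl_T_kernel[OF k] by (simp add: mult_ac)
  have "dunkl_T k (dunkl_transform k f) \<xi> = (LINT y|dunkl_measure k. dunkl_T k (\<lambda>\<xi>. dunkl_kernel k (- y * \<xi>)) \<xi> * f y)"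
  proof (cases "\<xi> = 0")
    case True
    have "(LINT y|dunkl_measure k. dunkl_T k (\<lambda>\<xi>. dunkl_kernel k (- y * \<xi>)) \<xi> * f y) = (LINT y|dunkl_measure k. (1 + 2 * of_real k) * ?D \<xi> y)"
      unfolding dunkl_T_def v' using True by (simp add: algebra_simps)
    also have "\<dots> = (1 + 2 * of_real k) * (LINT y|dunkl_measure k. ?D \<xi> y)" by (rule integral_mult_right_zero)
    finally show ?thesis unfolding dunkl_T_def v using True by (simp add: algebra_simps)
  next
    case False
    have i: "integrable (dunkl_measure k) (\<lambda>y. dunkl_kernel k (- \<xi> * y) * f y)" for \<xi>
      by (rule integrable_kernel_mult[OF k f])
    have "(LINT y|dunkl_measure k. dunkl_T k (\<lambda>\<xi>. dunkl_kernel k (- y * \<xi>)) \<xi> * f y) =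
      (LINT y|dunkl_measure k. ?D \<xi> y + (of_real k / of_real \<xi>) * (dunkl_kernel k (- \<xi> * y) * f y - dunkl_kernel k (- (- \<xi>) * y) * f y))"
      unfolding dunkl_T_def v' using False
      by (intro Bochner_Integration.integral_cong refl) (simp add: algebra_simps diff_divide_distrib)
    also have "\<dots> = (LINT y|dunkl_measure k. ?D \<xi> y) + (LINT y|dunkl_measure k. (of_real k / of_real \<xi>) * (dunkl_kernel k (- \<xi> * y) * f y - dunkl_kernel k (- (- \<xi>) * y) * f y))"
      by (rule Bochner_Integration.integral_add[OF intD])
        (intro integrable_mult_right Bochner_Integration.integrable_diff i)
    also have "(LINT y|dunkl_measure k. (of_real k / of_real \<xi>) * (dunkl_kernel k (- \<xi> * y) * f y - dunkl_kernel k (- (- \<xi>) * y) * f y)) =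
       (of_real k / of_real \<xi>) * (dunkl_transform k f \<xi> - dunkl_transform k f (- \<xi>))"
      unfolding integral_mult_right_zero Bochner_Integration.integral_diff[OF i i] dunkl_transform_eq[OF k] ..
    finally show ?thesis unfolding dunkl_T_def v using False by simp
  qed
  also have "\<dots> = - \<i> * dunkl_transform k (\<lambda>y. of_real y * f y) \<xi>"
    unfolding pointwise integral_mult_right_zero dunkl_transform_eq[OF k] ..
  finally show ?thesis .
qed

lemma dunkl_transform_reflect:
  assumes k: "k \<ge> 0" and f: "f \<in> schwartz"
  shows "dunkl_transform k (\<lambda>y. f (- y)) \<xi> = dunkl_transform k f (- \<xi>)"
proof -
  have [measurable]: "f \<in> borel_measurable borel" "(\<lambda>y. dunkl_kernel k (\<xi> * y)) \<in> borel_measurable borel"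
    by (intro borel_measurable_continuous_onI schwartz_continuous f continuous_scaled_kernel k)+
  have "(LINT y|dunkl_measure k. (\<lambda>y. dunkl_kernel k (\<xi> * y) * f y) (- y)) = (LINT y|dunkl_measure k. dunkl_kernel k (\<xi> * y) * f y)"
    by (rule integral_dunkl_measure_reflect[OF k]) measurable
  then show ?thesis unfolding dunkl_transform_eq[OF k] by simp
qed

subsection \<open>The transform preserves the Schwartz space\<close>

text \<open>Multiplication by \<open>\<xi>\<close> corresponds to the Dunkl operator before the transform, and the transform of an integrable function is bounded.\<close>

lemma rapid_dunkl_transform:
  assumes k: "k \<ge> 0"
  shows "f \<in> schwartz \<Longrightarrow> rapid (dunkl_transform k f)"
proof -
  have "\<exists>C. \<forall>\<xi>. norm (of_real \<xi> ^ m * dunkl_transform k f \<xi>) \<le> C" if "f \<in> schwartz" for m f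
    using that
  proof (induction m arbitrary: f)
    case 0
    have "norm (dunkl_transform k f \<xi>) \<le> (LINT y|dunkl_measure k. norm (f y))" for \<xi>
      unfolding dunkl_transform_eq[OF k]
    proof (rule Bochner_Integration.integral_norm_bound_integral)
      show "norm (dunkl_kernel k (- \<xi> * y) * f y) \<le> norm (f y)" for y
        using mult_right_mono[OF norm_kernel[OF k], of "norm (f y)"] by (simp add: norm_mult)
    qed (intro integrable_kernel_mult k 0 integrable_norm integrable_schwartz)+
    then show ?case by auto
  next
    case (Suc m)
    obtain C where C: "\<And>\<xi>. norm (of_real \<xi> ^ m * dunkl_transform k (dunkl_T k f) \<xi>) \<le> C"
      using Suc.IH[OF schwartz_dunkl_T[OF Suc.prems]] by blast
    have "norm (of_real \<xi> ^ Suc m * dunkl_transform k f \<xi>) \<le> C" for \<xi>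
      using C[of \<xi>] unfolding dunkl_transform_dunkl_T[OF k Suc.prems] by (simp add: norm_mult mult_ac)
    then show ?case by blast
  qed
  then show "f \<in> schwartz \<Longrightarrow> rapid (dunkl_transform k f)" unfolding rapid_def by blast
qed

text \<open>The even part of the Dunkl transform.\<close>

definition hankel :: "real \<Rightarrow> (real \<Rightarrow> complex) \<Rightarrow> real \<Rightarrow> complex" where
  "hankel k g \<xi> = (LINT y|dunkl_measure k. of_real (bessel k (\<xi> * y)) * g y)"

lemma continuous_scaled_bessel: "k \<ge> 0 \<Longrightarrow> continuous_on A (\<lambda>y. complex_of_real (bessel k (\<xi> * y)))"
  by (intro continuous_intros continuous_on_compose2[OF continuous_bessel[of k UNIV]]) auto

lemma integrable_bessel_mult:
  assumes k: "k \<ge> 0" and k': "k' \<ge> 0" and g: "g \<in> schwartz"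
  shows "integrable (dunkl_measure k) (\<lambda>y. of_real (bessel k' (\<xi> * y)) * g y)"
proof (rule integrable_schwartz_mult[OF k g continuous_scaled_bessel[OF k']])
  show "norm (complex_of_real (bessel k' (\<xi> * y))) \<le> 1" for y
    unfolding norm_of_real by (rule bessel_bound[OF k'])
qed

lemma hankel_eq_transform:
  assumes k: "k \<ge> 0" and g: "g \<in> schwartz"
  shows "hankel k g \<xi> = (1 / 2) * dunkl_transform k g \<xi> + (1 / 2) * dunkl_transform k g (- \<xi>)"
proof -
  note i = integrable_kernel_mult[OF k g]
  have "dunkl_transform k g \<xi> + dunkl_transform k g (- \<xi>) =
    (LINT y|dunkl_measure k. dunkl_kernel k (- \<xi> * y) * g y + dunkl_kernel k (- (- \<xi>) * y) * g y)"
    unfolding dunkl_transform_eq[OF k] by (rule Bochner_Integration.integral_add[symmetric, OF i i])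
  also have "\<dots> = (LINT y|dunkl_measure k. 2 * (of_real (bessel k (\<xi> * y)) * g y))"
    by (intro Bochner_Integration.integral_cong refl)
      (simp add: dunkl_kernel_def bessel_minus bessel_odd_def algebra_simps)
  also have "\<dots> = 2 * hankel k g \<xi>" unfolding hankel_def by (rule integral_mult_right_zero)
  finally show ?thesis by (simp add: field_simps)
qed

lemma rapid_hankel:
  assumes k: "k \<ge> 0" and g: "g \<in> schwartz"
  shows "rapid (hankel k g)"
proof -
  have "hankel k g = (\<lambda>\<xi>. (1 / 2) * dunkl_transform k g \<xi> + (1 / 2) * dunkl_transform k g (- \<xi>))"
    by (rule ext) (rule hankel_eq_transform[OF k g])
  then show ?thesis
    by (simp only:) (intro rapid_lincomb rapid_dunkl_transform rapid_reflect k g)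
qed

text \<open>Since \<open>B\<^sub>k'(s) = - s B\<^sub>k\<^sub>+\<^sub>1(s) / (2 k + 1)\<close>, differentiation produces the factor \<open>y\<^sup>2\<close>, which raises the order of the Dunkl weight by one.\<close>

lemma has_vector_derivative_hankel:
  assumes k: "k \<ge> 0" and g: "g \<in> schwartz"
  shows "(hankel k g has_vector_derivative - (of_real \<xi> * hankel (k + 1) g \<xi>)) (at \<xi>)"
proof -
  let ?K' = "\<lambda>s y. of_real (- (s * y * bessel (k + 1) (s * y) / (2 * k + 1)) * y) * g y"
  have k1: "k + 1 \<ge> 0" using k by simp
  have yg: "(\<lambda>y. of_real y ^ 2 * g y) \<in> schwartz" by (rule schwartz_mult_x_power[OF g])
  have K': "?K' s y = of_real (- (s / (2 * k + 1))) * (of_real (y\<^sup>2) * (of_real (bessel (k + 1) (s * y)) * g y))" for s y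
    by (simp add: power2_eq_square)
  have bK': "norm (?K' s y) \<le> \<bar>s\<bar> * norm (of_real y ^ 2 * g y)" for s y
  proof -
    have "norm (?K' s y) = \<bar>s / (2 * k + 1)\<bar> * \<bar>bessel (k + 1) (s * y)\<bar> * norm (of_real y ^ 2 * g y)"
      unfolding K' by (simp only: norm_mult norm_of_real norm_power abs_minus_cancel) (simp add: mult_ac)
    also have "\<dots> \<le> \<bar>s\<bar> * 1 * norm (of_real y ^ 2 * g y)"
    proof (intro mult_right_mono mult_mono bessel_bound)
      show "\<bar>s / (2 * k + 1)\<bar> \<le> \<bar>s\<bar>"
        using k by (simp add: divide_le_eq mult_le_cancel_left1 abs_divide)
    qed (use k in auto)
    finally show ?thesis by simp
  qed
  have [measurable]: "g \<in> borel_measurable borel" "(\<lambda>y. complex_of_real (bessel (k + 1) (\<xi> * y))) \<in> borel_measurable borel"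
    by (intro borel_measurable_continuous_onI schwartz_continuous g continuous_scaled_bessel k1)+
  have "((\<lambda>s. LINT y|dunkl_measure k. of_real (bessel k (s * y)) * g y) has_vector_derivative (LINT y|dunkl_measure k. ?K' \<xi> y)) (at \<xi>)"
  proof (rule has_vector_derivative_lebesgue_integral[where B = "\<lambda>y. (\<bar>\<xi>\<bar> + 1) * norm (of_real y ^ 2 * g y)"])
    fix s y
    have "((\<lambda>s. bessel k (s * y)) has_real_derivative - (s * y * bessel (k + 1) (s * y) / (2 * k + 1)) * y) (at s)"
      by (rule DERIV_chain2[OF has_derivative_bessel[OF k]]) (auto intro!: derivative_eq_intros)
    then show "((\<lambda>s. of_real (bessel k (s * y)) * g y) has_vector_derivative ?K' s y) (at s)"
      by (intro has_vector_derivative_mult_left has_vector_derivative_of_real)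
  next
    show "integrable (dunkl_measure k) (\<lambda>y. of_real (bessel k (s * y)) * g y)" for s
      by (rule integrable_bessel_mult[OF k k g])
    show "integrable (dunkl_measure k) (\<lambda>y. (\<bar>\<xi>\<bar> + 1) * norm (of_real y ^ 2 * g y))"
      by (intro integrable_mult_right integrable_norm integrable_schwartz k yg)
    show "norm (?K' s y) \<le> (\<bar>\<xi>\<bar> + 1) * norm (of_real y ^ 2 * g y)" if "\<bar>s - \<xi>\<bar> < 1" for s y
      using that by (intro order_trans[OF bK'] mult_right_mono) auto
    show "integrable (dunkl_measure k) (?K' \<xi>)"
    proof (rule Bochner_Integration.integrable_bound)
      show "integrable (dunkl_measure k) (\<lambda>y. \<bar>\<xi>\<bar> * norm (of_real y ^ 2 * g y))"
        by (intro integrable_mult_right integrable_norm integrable_schwartz k yg)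
      show "AE y in dunkl_measure k. norm (?K' \<xi> y) \<le> norm (\<bar>\<xi>\<bar> * norm (of_real y ^ 2 * g y))"
        using bK' by (intro AE_I2) (simp add: abs_mult)
      show "?K' \<xi> \<in> borel_measurable (dunkl_measure k)" unfolding K' by measurable
    qed
  qed
  moreover have "(LINT y|dunkl_measure k. ?K' \<xi> y) = - (of_real \<xi> * hankel (k + 1) g \<xi>)"
  proof -
    have "(LINT y|dunkl_measure k. ?K' \<xi> y) = of_real (- (\<xi> / (2 * k + 1))) * (of_real (2 * k + 1) * (LINT y|dunkl_measure (k + 1). of_real (bessel (k + 1) (\<xi> * y)) * g y))"
      unfolding K' integral_mult_right_zero
      by (subst integral_dunkl_measure_Suc[OF k]) auto
    also have "\<dots> = of_real (- (\<xi> / (2 * k + 1)) * (2 * k + 1)) * hankel (k + 1) g \<xi>"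
      unfolding hankel_def of_real_mult mult.assoc ..
    also have "- (\<xi> / (2 * k + 1)) * (2 * k + 1) = - \<xi>" using k by simp
    finally show ?thesis by simp
  qed
  ultimately show ?thesis unfolding hankel_def[abs_def] by simp
qed

lemma schwartz_hankel:
  assumes "k \<ge> 0" and g: "g \<in> schwartz"
  shows "hankel k g \<in> schwartz"
proof -
  define V where "V = {u. \<exists>n c d a. (\<forall>i. a i \<ge> (0::real)) \<and> u = (\<lambda>x. \<Sum>i<(n::nat). c i * of_real x ^ (d i :: nat) * hankel (a i) g x)}"
  show ?thesis
  proof (rule schwartz_coinduct[where V = V])
    show "hankel k g \<in> V"
      unfolding V_def using assms(1)
      by (intro CollectI exI[of _ 1] exI[of _ "\<lambda>_. 1"] exI[of _ "\<lambda>_. 0"] exI[of _ "\<lambda>_. k"]) auto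
  next
    fix u assume "u \<in> V"
    then obtain n c d a where a: "\<And>i. a i \<ge> (0::real)" and u: "u = (\<lambda>x. \<Sum>i<(n::nat). c i * of_real x ^ (d i :: nat) * hankel (a i) g x)"
      unfolding V_def by blast
    have rapid_pow: "rapid (\<lambda>x. of_real x ^ m * h x)" if "rapid h" for m h
      using that by (induction m) (simp_all add: rapid_mult_x mult.assoc)
    show "rapid u"
      unfolding u
    proof (induction n)
      case 0
      show ?case by (auto simp: rapid_def)
    next
      case (Suc n)
      from rapid_lincomb[OF Suc rapid_pow[OF rapid_hankel[OF a[of n] g]], of 1 "c n" "d n"]
      show ?case by (simp add: mult.assoc)
    qed
    define c' where "c' = (\<lambda>i. if i < n then c i * of_nat (d i) else - c (i - n))"
    define d' where "d' = (\<lambda>i. if i < n then d i - 1 else d (i - n) + 1)"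
    define a' where "a' = (\<lambda>i. if i < n then a i else a (i - n) + 1)"
    define u' where "u' = (\<lambda>x. \<Sum>i<n+n. c' i * of_real x ^ d' i * hankel (a' i) g x)"
    have "u' \<in> V"
      unfolding V_def u'_def using a by (intro CollectI exI conjI refl) (auto simp: a'_def intro: add_nonneg_nonneg)
    moreover have "(u has_vector_derivative u' x) (at x)" for x
    proof -
      have "u' x = (\<Sum>i<n. c' i * of_real x ^ d' i * hankel (a' i) g x) + (\<Sum>i<n. c' (n + i) * of_real x ^ d' (n + i) * hankel (a' (n + i)) g x)"
        unfolding u'_def
        by (simp add: lessThan_atLeast0 sum.atLeastLessThan_concat[symmetric, of 0 n "n+n"]
            sum.shift_bounds_nat_ivl[of _ 0 n n, simplified] add.commute)
      also have "\<dots> = (\<Sum>i<n. c i * of_nat (d i) * of_real x ^ (d i - 1) * hankel (a i) g x - c i * of_real x ^ (d i + 1) * hankel (a i + 1) g x)"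
        by (simp add: c'_def d'_def a'_def sum_subtractf sum_negf)
      finally have u'x: "u' x = (\<Sum>i<n. c i * of_nat (d i) * of_real x ^ (d i - 1) * hankel (a i) g x - c i * of_real x ^ (d i + 1) * hankel (a i + 1) g x)" .
      have "((\<lambda>x. c i * of_real x ^ d i * hankel (a i) g x) has_vector_derivative
        c i * of_nat (d i) * of_real x ^ (d i - 1) * hankel (a i) g x - c i * of_real x ^ (d i + 1) * hankel (a i + 1) g x) (at x)" for i
      proof -
        have p: "((\<lambda>t. c i * of_real t ^ d i) has_vector_derivative c i * of_nat (d i) * of_real x ^ (d i - 1)) (at x)"
          using has_vector_derivative_of_real_power[of "c i" "d i" 1 x] by simp
        from has_vector_derivative_mult[OF p has_vector_derivative_hankel[OF a[of i] g, of x]]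
        show ?thesis by (simp add: algebra_simps)
      qed
      then show ?thesis unfolding u u'x by (intro has_vector_derivative_sum)
    qed
    ultimately show "\<exists>u'\<in>V. \<forall>x. (u has_vector_derivative u' x) (at x)" by blast
  qed
qed

text \<open>The even part of the kernel gives a Hankel transform of \<open>f\<close>, the odd part \<open>\<xi>\<close> times a Hankel transform of next order of the odd part of \<open>f\<close> divided by \<open>y\<close>.\<close>

lemma schwartz_dunkl_transform:
  assumes k: "k \<ge> 0" and f: "f \<in> schwartz"
  shows "dunkl_transform k f \<in> schwartz"
proof -
  have k1: "k + 1 \<ge> 0" using k by simp
  obtain q where q: "q \<in> schwartz" and fq: "\<And>y. f y - f (- y) = of_real y * q y"
    using schwartz_odd_quotient[OF f] by blast
  have xf: "(\<lambda>y. of_real y * f y) \<in> schwartz" by (rule schwartz_mult_x[OF f])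
  have "dunkl_transform k f \<xi> = 1 * hankel k f \<xi> + (- \<i> / 2) * (of_real \<xi> * hankel (k + 1) q \<xi>)" for \<xi>
  proof -
    let ?b = "\<lambda>y. complex_of_real (bessel (k + 1) (\<xi> * y))"
    have [measurable]: "f \<in> borel_measurable borel" "q \<in> borel_measurable borel" "?b \<in> borel_measurable borel"
      by (intro borel_measurable_continuous_onI schwartz_continuous f q continuous_scaled_bessel k1)+
    have i: "integrable (dunkl_measure k) (\<lambda>y. ?b y * (of_real y * f y))"
      by (rule integrable_bessel_mult[OF k k1 xf])
    have r: "(LINT y|dunkl_measure k. ?b y * (of_real (- y) * f (- y))) = (LINT y|dunkl_measure k. ?b y * (of_real y * f y))"
      using integral_dunkl_measure_reflect[OF k, of "\<lambda>y. ?b y * (of_real y * f y)"] by (simp add: bessel_minus)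
    have xf': "(\<lambda>y. of_real (- y) * f (- y)) \<in> schwartz" using schwartz_reflect[OF xf] by simp
    have i': "integrable (dunkl_measure k) (\<lambda>y. ?b y * (of_real (- y) * f (- y)))"
      by (rule integrable_bessel_mult[OF k k1 xf'])
    have "2 * (LINT y|dunkl_measure k. ?b y * (of_real y * f y)) =
      (LINT y|dunkl_measure k. ?b y * (of_real y * f y) + ?b y * (of_real (- y) * f (- y)))"
      unfolding Bochner_Integration.integral_add[OF i i'] r by simp
    also have "\<dots> = (LINT y|dunkl_measure k. of_real (y\<^sup>2) * (?b y * q y))"
    proof (intro Bochner_Integration.integral_cong refl)
      fix y
      have "?b y * (of_real y * f y) + ?b y * (of_real (- y) * f (- y)) = ?b y * (of_real y * (f y - f (- y)))"
        by (simp add: algebra_simps)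
      then show "?b y * (of_real y * f y) + ?b y * (of_real (- y) * f (- y)) = of_real (y\<^sup>2) * (?b y * q y)"
        unfolding fq by (simp add: power2_eq_square)
    qed
    also have "\<dots> = of_real (2 * k + 1) * hankel (k + 1) q \<xi>"
      unfolding hankel_def by (rule integral_dunkl_measure_Suc[OF k]) measurable
    finally have "2 * (LINT y|dunkl_measure k. ?b y * (of_real y * f y)) = of_real (2 * k + 1) * hankel (k + 1) q \<xi>" .
    then have e: "(LINT y|dunkl_measure k. ?b y * (of_real y * f y)) = of_real (2 * k + 1) * hankel (k + 1) q \<xi> / 2"
      by (metis nonzero_mult_div_cancel_left zero_neq_numeral)
    have nz: "complex_of_real (2 * k + 1) \<noteq> 0" using k by (simp only: of_real_eq_0_iff)
    have "dunkl_transform k f \<xi> = (LINT y|dunkl_measure k. of_real (bessel k (\<xi> * y)) * f y + (- \<i> * of_real (\<xi> / (2 * k + 1))) * (?b y * (of_real y * f y)))"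
      unfolding dunkl_transform_eq[OF k]
      by (intro Bochner_Integration.integral_cong refl)
        (simp add: dunkl_kernel_def bessel_odd_def bessel_minus algebra_simps)
    also have "\<dots> = hankel k f \<xi> + (- \<i> * of_real (\<xi> / (2 * k + 1))) * (of_real (2 * k + 1) * hankel (k + 1) q \<xi> / 2)"
      unfolding hankel_def[of k f] e[symmetric] integral_mult_right_zero[symmetric]
      by (rule Bochner_Integration.integral_add) (intro integrable_bessel_mult k f integrable_mult_right i)+
    also have "\<dots> = 1 * hankel k f \<xi> + (- \<i> / 2) * (of_real \<xi> * hankel (k + 1) q \<xi>)"
      unfolding of_real_divide using nz by simp
    finally show ?thesis .
  qed
  then have "dunkl_transform k f = (\<lambda>\<xi>. 1 * hankel k f \<xi> + (- \<i> / 2) * (of_real \<xi> * hankel (k + 1) q \<xi>))" by blast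
  then show ?thesis
    by (simp only:) (intro schwartz_lincomb schwartz_mult_x schwartz_hankel k k1 f q)
qed

section \<open>Inversion\<close>

text \<open>Substituting \<open>t = y\<^sup>2 / 2\<close> turns the integral into Euler's integral for \<open>Gamma (k + 1 / 2)\<close>.\<close>

lemma integral_gaussian:
  assumes k: "k \<ge> 0"
  shows "(LINT y|dunkl_measure k. complex_of_real (exp (- y\<^sup>2 / 2))) = 1"
proof -
  define c where "c = 2 powr (k + 1 / 2) * Gamma (k + 1 / 2)"
  have c: "c > 0" unfolding c_def by (rule dunkl_weight_constant_pos[OF k])
  define r where "r = (\<lambda>y. dunkl_weight k y * exp (- y\<^sup>2 / 2))"
  define F where "F = (\<lambda>t. t powr (k - 1 / 2) / exp t)"
  have m: "(\<lambda>y. complex_of_real (exp (- y\<^sup>2 / 2))) \<in> borel_measurable borel" by measurable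
  have "integrable lborel (\<lambda>y. dunkl_weight k y *\<^sub>R complex_of_real (exp (- y\<^sup>2 / 2)))"
    using integrable_schwartz[OF k gaussian_schwartz] unfolding integrable_dunkl_measure_iff[OF k m] .
  then have "integrable lborel (\<lambda>y. complex_of_real (r y))"
    by (simp add: r_def scaleR_conv_of_real)
  then have r: "integrable lborel r" by (simp only: complex_of_real_integrable_eq)
  have "(LINT y|dunkl_measure k. complex_of_real (exp (- y\<^sup>2 / 2))) = (LINT y|lborel. complex_of_real (r y))"
    unfolding integral_dunkl_measure[OF k m] by (simp add: r_def scaleR_conv_of_real)
  also have "\<dots> = complex_of_real (LINT y|lborel. r y)" by (rule integral_complex_of_real)
  also have "(LINT y|lborel. r y) = 2 *\<^sub>R (LBINT y=0..\<infinity>. r y)"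
    by (rule integral_even_eq_twice[OF r]) (simp add: r_def dunkl_weight_minus)
  also have "(LBINT y=0..\<infinity>. r y) = 1 / 2"
  proof -
    have sub: "r y = (2 powr (k - 1 / 2) / c) * (F (y\<^sup>2 / 2) * y)" if "y > 0" for y
    proof -
      have "(y\<^sup>2 / 2) powr (k - 1 / 2) = (y powr 2) powr (k - 1 / 2) / 2 powr (k - 1 / 2)"
        using that by (simp add: powr_divide powr_numeral)
      also have "(y powr 2) powr (k - 1 / 2) = y powr (2 * k - 1)"
        unfolding powr_powr by (simp add: algebra_simps)
      also have "\<dots> = y powr (2 * k) / y" using that by (simp add: powr_diff)
      finally have "(y\<^sup>2 / 2) powr (k - 1 / 2) = y powr (2 * k) / y / 2 powr (k - 1 / 2)" .
      then have F: "F (y\<^sup>2 / 2) = y powr (2 * k) / y / 2 powr (k - 1 / 2) / exp (y\<^sup>2 / 2)"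
        by (simp only: F_def)
      have w: "dunkl_weight k y = y powr (2 * k) / c"
        unfolding dunkl_weight_def c_def using that by simp
      have e: "exp (- y\<^sup>2 / 2) = 1 / exp (y\<^sup>2 / 2)"
        unfolding minus_divide_left[symmetric] exp_minus by (rule inverse_eq_divide)
      have alg: "A / c * (1 / E) = (B / c) * (A / y / B / E * y)" if "B \<noteq> 0" for A B E :: real
        using that \<open>y > 0\<close> by simp
      show ?thesis unfolding r_def F w e by (rule alg) simp
    qed
    have si: "set_integrable lborel (einterval 0 \<infinity>) (\<lambda>y. F (y\<^sup>2 / 2) * y)"
    proof -
      have "set_integrable lborel (einterval 0 \<infinity>) (\<lambda>y. (c / 2 powr (k - 1 / 2)) * r y)"
        unfolding set_integrable_def by (intro integrable_mult_indicator integrable_mult_right r) auto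
      also have "?this \<longleftrightarrow> ?thesis"
      proof (intro set_integrable_cong refl)
        fix y assume "y \<in> einterval 0 \<infinity>"
        then have y: "y > 0" by (simp add: einterval_def zero_ereal_def)
        show "c / 2 powr (k - 1 / 2) * r y = F (y\<^sup>2 / 2) * y"
          unfolding sub[OF y] using c by simp
      qed
      finally show ?thesis .
    qed
    have deriv: "((\<lambda>y. y\<^sup>2 / 2) has_real_derivative y) (at y)" for y :: real
      using DERIV_cdivide[OF DERIV_power[OF DERIV_ident[of "at y"], where n = 2], where c = 2] by simp
    have cF: "isCont F (y\<^sup>2 / 2)" if "y > 0" for y
      unfolding F_def using that by (intro continuous_intros) auto
    have lim: "((\<lambda>y::real. ereal (y\<^sup>2 / 2)) \<longlongrightarrow> 0) (at_right 0)"
    proof -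
      have "((\<lambda>y::real. y\<^sup>2 / 2) \<longlongrightarrow> 0\<^sup>2 / 2) (at_right 0)" by (intro tendsto_intros) simp
      then show ?thesis by (simp add: zero_ereal_def)
    qed
    have "filterlim (\<lambda>y::real. y\<^sup>2 / 2) at_top at_top"
    proof (rule filterlim_at_top_mono[OF filterlim_ident])
      show "\<forall>\<^sub>F y in at_top. y \<le> y\<^sup>2 / (2::real)"
        using eventually_ge_at_top[of 2] by eventually_elim (simp add: power2_eq_square)
    qed
    then have lim': "((\<lambda>y::real. ereal (y\<^sup>2 / 2)) \<longlongrightarrow> \<infinity>) at_top"
      by (simp add: tendsto_PInfty_eq_at_top)
    have "(((\<lambda>y. ereal (y\<^sup>2 / 2)) \<circ> real_of_ereal) \<longlongrightarrow> ereal 0) (at_right (ereal 0))"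
      unfolding ereal_tendsto_simps using lim by (simp add: zero_ereal_def)
    then have limA: "((ereal \<circ> (\<lambda>y. y\<^sup>2 / 2) \<circ> real_of_ereal) \<longlongrightarrow> 0) (at_right 0)"
      by (simp only: o_def zero_ereal_def)
    have "(((\<lambda>y. ereal (y\<^sup>2 / 2)) \<circ> real_of_ereal) \<longlongrightarrow> \<infinity>) (at_left \<infinity>)"
      unfolding ereal_tendsto_simps by (rule lim')
    then have limB: "((ereal \<circ> (\<lambda>y. y\<^sup>2 / 2) \<circ> real_of_ereal) \<longlongrightarrow> \<infinity>) (at_left \<infinity>)"
      by (simp only: o_def)
    note subst = interval_integral_substitution_nonneg[where f = F and g = "\<lambda>y. y\<^sup>2 / 2" and g' = "\<lambda>y. y"
        and a = 0 and b = \<infinity> and A = 0 and B = \<infinity>, OF _ deriv _ _ _ _ limA limB si]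
    have s1: "set_integrable lborel (einterval 0 \<infinity>) F"
      by (rule subst(1)) (use cF in \<open>auto simp: F_def zero_ereal_def\<close>)
    have s2: "(LBINT t=0..\<infinity>. F t) = (LBINT y=0..\<infinity>. F (y\<^sup>2 / 2) * y)"
      by (rule subst(2)) (use cF in \<open>auto simp: F_def zero_ereal_def\<close>)
    have "(LBINT y=0..\<infinity>. r y) = (LBINT y=0..\<infinity>. (2 powr (k - 1 / 2) / c) * (F (y\<^sup>2 / 2) * y))"
      by (rule interval_lebesgue_integral_cong) (auto simp: einterval_def zero_ereal_def sub)
    also have "\<dots> = (2 powr (k - 1 / 2) / c) * (LBINT t=0..\<infinity>. F t)"
      unfolding s2 by (rule interval_lebesgue_integral_mult_right)
    also have "(LBINT t=0..\<infinity>. F t) = integral (einterval 0 \<infinity>) F"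
      by (rule interval_integral_eq_integral'[OF _ s1]) simp
    also have "\<dots> = Gamma (k + 1 / 2)"
    proof (rule integral_unique)
      have G: "(F has_integral Gamma (k + 1 / 2)) {0..}"
        using Gamma_integral_real[of "k + 1 / 2"] k by (simp add: F_def)
      have "(F has_integral Gamma (k + 1 / 2)) {0<..} \<longleftrightarrow> (F has_integral Gamma (k + 1 / 2)) {0..}"
        by (rule has_integral_spike_set_eq; rule negligible_subset[of "{0}"]) auto
      moreover have "einterval 0 \<infinity> = {0<..}" by (auto simp: einterval_def zero_ereal_def)
      ultimately show "(F has_integral Gamma (k + 1 / 2)) (einterval 0 \<infinity>)" using G by simp
    qed
    also have "2 powr (k - 1 / 2) / c * Gamma (k + 1 / 2) = 1 / 2"
    proof -
      have "(2::real) powr (k + 1 / 2) = 2 * 2 powr (k - 1 / 2)"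
      proof -
        have "(k - 1 / 2) + 1 = k + 1 / 2" by simp
        from powr_add[of 2 "k - 1 / 2" 1, unfolded this] show ?thesis by simp
      qed
      moreover have "Gamma (k + 1 / 2) > 0" using k by (intro Gamma_real_pos) auto
      ultimately show ?thesis by (simp add: c_def)
    qed
    finally show ?thesis .
  qed
  finally show ?thesis by simp
qed

text \<open>The Gaussian satisfies \<open>T G = - x G\<close>. The intertwining relations turn this into the same equation for the transform, which is even, so it solves \<open>u' = - \<xi> u\<close> with \<open>u(0) = 1\<close>.\<close>

lemma dunkl_transform_gaussian:
  assumes k: "k \<ge> 0"
  shows "dunkl_transform k (\<lambda>x. of_real (exp (- x\<^sup>2 / 2))) \<xi> = of_real (exp (- \<xi>\<^sup>2 / 2))"
proof -
  define G :: "real \<Rightarrow> complex" where "G = (\<lambda>x. of_real (exp (- x\<^sup>2 / 2)))"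
  have G: "G \<in> schwartz" unfolding G_def by (rule gaussian_schwartz)
  have G': "(G has_vector_derivative - of_real x * G x) (at x)" for x
    unfolding G_def by (rule has_vector_derivative_gaussian)
  define u where "u = dunkl_transform k G"
  have u: "u \<in> schwartz" unfolding u_def by (rule schwartz_dunkl_transform[OF k G])
  have even: "u (- \<xi>) = u \<xi>" for \<xi>
    using dunkl_transform_reflect[OF k G, of \<xi>] by (simp add: u_def G_def)
  have TG: "dunkl_T k G = (\<lambda>x. - 1 * (of_real x * G x) + 0 * G x)"
  proof
    fix x
    have "vderiv G x = - of_real x * G x" for x by (rule vector_derivative_at[OF G'])
    then show "dunkl_T k G x = - 1 * (of_real x * G x) + 0 * G x"
      unfolding dunkl_T_def by (simp add: G_def)
  qed
  have xG: "(\<lambda>x. of_real x * G x) \<in> schwartz" by (rule schwartz_mult_x[OF G])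
  have Tu: "dunkl_T k u \<xi> = - of_real \<xi> * u \<xi>" for \<xi>
  proof -
    define X where "X = dunkl_transform k (\<lambda>x. of_real x * G x) \<xi>"
    have "\<i> * of_real \<xi> * u \<xi> = - 1 * X + 0 * dunkl_transform k G \<xi>"
      unfolding u_def X_def dunkl_transform_dunkl_T[OF k G, symmetric] TG by (rule dunkl_transform_lincomb[OF k xG G])
    then have X: "X = - (\<i> * of_real \<xi> * u \<xi>)" by simp
    have "dunkl_T k u \<xi> = - \<i> * X"
      unfolding u_def X_def by (rule dunkl_T_dunkl_transform[OF k G])
    then show ?thesis unfolding X by (simp flip: mult.assoc)
  qed
  have du: "vderiv u \<xi> = - of_real \<xi> * u \<xi>" for \<xi>
  proof (cases "\<xi> = 0")
    case True
    have "((\<lambda>x. u (- x)) has_vector_derivative - vderiv u (- 0)) (at 0)"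
      by (rule has_vector_derivative_reflect[OF schwartz_has_vector_derivative[OF u]])
    then have "(u has_vector_derivative - vderiv u 0) (at 0)" by (simp add: even)
    then have "vderiv u 0 = - vderiv u 0" by (rule vector_derivative_at)
    then show ?thesis using True by simp
  next
    case False
    then show ?thesis using Tu[of \<xi>] by (simp add: dunkl_T_def even)
  qed
  define v where "v = (\<lambda>\<xi>. of_real (exp (\<xi>\<^sup>2 / 2)) * u \<xi>)"
  have "(v has_vector_derivative 0) (at \<xi>)" for \<xi>
  proof -
    have e: "((\<lambda>\<xi>. exp (\<xi>\<^sup>2 / 2)) has_field_derivative exp (\<xi>\<^sup>2 / 2) * \<xi>) (at \<xi>)"
      by (auto intro!: derivative_eq_intros)
    have "(v has_vector_derivative of_real (exp (\<xi>\<^sup>2 / 2)) * vderiv u \<xi> + of_real (exp (\<xi>\<^sup>2 / 2) * \<xi>) * u \<xi>) (at \<xi>)"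
      unfolding v_def
      by (rule has_vector_derivative_mult[OF has_vector_derivative_of_real[OF e] schwartz_has_vector_derivative[OF u]])
    then show ?thesis unfolding du by simp
  qed
  then obtain c where "\<And>\<xi>. v \<xi> = c"
    using has_vector_derivative_zero_constant[of UNIV v] by auto
  then have "v \<xi> = v 0" by simp
  moreover have "v 0 = 1"
    using integral_gaussian[OF k]
    by (simp add: v_def u_def dunkl_transform_eq[OF k] dunkl_kernel_def bessel_0 bessel_odd_def G_def)
  ultimately have "of_real (exp (\<xi>\<^sup>2 / 2)) * u \<xi> = 1" by (simp add: v_def)
  then have "of_real (exp (- \<xi>\<^sup>2 / 2)) * (of_real (exp (\<xi>\<^sup>2 / 2)) * u \<xi>) = of_real (exp (- \<xi>\<^sup>2 / 2))" by simp
  moreover have "complex_of_real (exp (- \<xi>\<^sup>2 / 2)) * of_real (exp (\<xi>\<^sup>2 / 2)) = 1"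
    by (simp add: exp_minus flip: of_real_mult)
  ultimately have "u \<xi> = of_real (exp (- \<xi>\<^sup>2 / 2))" by (simp only: mult.assoc[symmetric] mult_1)
  then show ?thesis by (simp only: u_def G_def)
qed

text \<open>The operator \<open>J\<close> (twofold transform followed by reflection) commutes with multiplication by \<open>x\<close>. Subtracting a multiple of the Gaussian, which \<open>J\<close> fixes, from \<open>f\<close> makes it vanish at a given point \<open>x\<close>; it is then \<open>y - x\<close> times a Schwartz function, and \<open>J\<close> preserves the zero.\<close>

theorem dunkl_inversion:
  assumes k: "k \<ge> 0" and f: "f \<in> schwartz"
  shows "dunkl_transform k (dunkl_transform k f) (- x) = f x"
proof -
  define J where "J = (\<lambda>g x. dunkl_transform k (dunkl_transform k g) (- x))"
  have J_lincomb: "J (\<lambda>y. a * g y + b * h y) x = a * J g x + b * J h x" if g: "g \<in> schwartz" and h: "h \<in> schwartz" for g h a b x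
  proof -
    have "dunkl_transform k (\<lambda>y. a * g y + b * h y) = (\<lambda>\<xi>. a * dunkl_transform k g \<xi> + b * dunkl_transform k h \<xi>)"
      by (rule ext) (rule dunkl_transform_lincomb[OF k g h])
    then show ?thesis
      unfolding J_def by (simp only: dunkl_transform_lincomb[OF k schwartz_dunkl_transform[OF k g] schwartz_dunkl_transform[OF k h]])
  qed
  have J_mult_x: "J (\<lambda>y. of_real y * g y) x = of_real x * J g x" if g: "g \<in> schwartz" for g x
  proof -
    note Fg = schwartz_dunkl_transform[OF k g]
    have "dunkl_transform k (\<lambda>y. of_real y * g y) = (\<lambda>\<xi>. \<i> * dunkl_T k (dunkl_transform k g) \<xi> + 0 * dunkl_transform k g \<xi>)"
      unfolding dunkl_T_dunkl_transform[OF k g] by simp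
    then have "J (\<lambda>y. of_real y * g y) x = \<i> * dunkl_transform k (dunkl_T k (dunkl_transform k g)) (- x)"
      unfolding J_def by (simp only: dunkl_transform_lincomb[OF k schwartz_dunkl_T[OF Fg] Fg]) simp
    also have "\<dots> = of_real x * J g x"
      unfolding dunkl_transform_dunkl_T[OF k Fg] J_def by (simp flip: mult.assoc)
    finally show ?thesis .
  qed
  define G :: "real \<Rightarrow> complex" where "G = (\<lambda>x. of_real (exp (- x\<^sup>2 / 2)))"
  have G: "G \<in> schwartz" unfolding G_def by (rule gaussian_schwartz)
  have FG: "dunkl_transform k G = G" unfolding G_def by (rule ext) (rule dunkl_transform_gaussian[OF k])
  have JG: "J G x = G x" unfolding J_def FG by (simp add: G_def)
  have Gx: "G x \<noteq> 0" by (simp add: G_def)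
  define h where "h = (\<lambda>y. 1 * f y + (- (f x / G x)) * G y)"
  have h: "h \<in> schwartz" unfolding h_def by (rule schwartz_lincomb[OF f G])
  have "h x = 0" using Gx by (simp add: h_def)
  then obtain q where q: "q \<in> schwartz" and hq: "\<And>y. h y = of_real (y - x) * q y"
    using schwartz_divide_zero[OF h] by blast
  have hq': "h = (\<lambda>y. 1 * (of_real y * q y) + (- of_real x) * q y)"
    using hq by (auto simp: algebra_simps)
  have "J h x = 0"
    unfolding hq' J_lincomb[OF schwartz_mult_x[OF q] q] J_mult_x[OF q] by simp
  moreover have "J h x = J f x - f x"
    unfolding h_def J_lincomb[OF f G] JG using Gx by simp
  ultimately show ?thesis by (simp add: J_def)
qed

section \<open>Quantisation\<close>

definition momentum :: "real \<Rightarrow> (real \<Rightarrow> complex) \<Rightarrow> real \<Rightarrow> complex" where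
  "momentum k f = (\<lambda>x. - \<i> * dunkl_T k f x)"

lemma schwartz_momentum: "f \<in> schwartz \<Longrightarrow> momentum k f \<in> schwartz"
  unfolding momentum_def by (intro schwartz_cmult schwartz_dunkl_T)

lemma schwartz_funpow_momentum: "f \<in> schwartz \<Longrightarrow> (momentum k ^^ n) f \<in> schwartz"
  by (induction n) (auto intro: schwartz_momentum)

lemma dunkl_transform_cmult:
  "k \<ge> 0 \<Longrightarrow> f \<in> schwartz \<Longrightarrow> dunkl_transform k (\<lambda>x. c * f x) \<xi> = c * dunkl_transform k f \<xi>"
  using dunkl_transform_lincomb[of k f f c 0 \<xi>] by simp

lemma dunkl_transform_funpow_momentum:
  assumes k: "k \<ge> 0" and f: "f \<in> schwartz"
  shows "dunkl_transform k ((momentum k ^^ n) f) \<xi> = of_real \<xi> ^ n * dunkl_transform k f \<xi>"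
proof (induction n)
  case (Suc n)
  define g where "g = (momentum k ^^ n) f"
  have g: "g \<in> schwartz" unfolding g_def by (rule schwartz_funpow_momentum[OF f])
  have "dunkl_transform k (momentum k g) \<xi> = - \<i> * (\<i> * of_real \<xi> * dunkl_transform k g \<xi>)"
    unfolding momentum_def dunkl_transform_cmult[OF k schwartz_dunkl_T[OF g]] dunkl_transform_dunkl_T[OF k g] ..
  also have "\<dots> = of_real \<xi> * dunkl_transform k g \<xi>" by (simp flip: mult.assoc)
  finally show ?case using Suc by (simp add: g_def)
qed simp

lemma Op_eq:
  assumes "k \<ge> 0"
  shows "Op k a f x = (LINT p|dunkl_measure k. a (x, p) * dunkl_kernel k (p * x) * dunkl_transform k f p)"
  unfolding Op_def dunkl_E_eq_kernel[OF assms] ..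

lemma Op_monomial:
  assumes k: "k \<ge> 0" and f: "f \<in> schwartz"
  shows "Op k (\<lambda>(x, p). c * of_real x ^ m * of_real p ^ n) f x = c * of_real x ^ m * (momentum k ^^ n) f x"
proof -
  define g where "g = (momentum k ^^ n) f"
  have g: "g \<in> schwartz" unfolding g_def by (rule schwartz_funpow_momentum[OF f])
  have "Op k (\<lambda>(x, p). c * of_real x ^ m * of_real p ^ n) f x =
     (LINT p|dunkl_measure k. (c * of_real x ^ m) * (dunkl_kernel k (- (- x) * p) * dunkl_transform k g p))"
    unfolding Op_eq[OF k] g_def dunkl_transform_funpow_momentum[OF k f]
    by (intro Bochner_Integration.integral_cong refl) (simp add: mult_ac)
  also have "\<dots> = c * of_real x ^ m * dunkl_transform k (dunkl_transform k g) (- x)"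
    unfolding integral_mult_right_zero dunkl_transform_eq[OF k, of "dunkl_transform k g"] ..
  finally show ?thesis unfolding dunkl_inversion[OF k g] by (simp add: g_def)
qed

lemma integrable_Op:
  assumes k: "k \<ge> 0" and f: "f \<in> schwartz" and a: "has_bidegree a m n"
  shows "integrable (dunkl_measure k) (\<lambda>p. a (x, p) * dunkl_kernel k (p * x) * dunkl_transform k f p)"
  using a
proof (induction rule: has_bidegree_induct)
  case (add a b)
  then show ?case
    using Bochner_Integration.integrable_add[OF add(3,4)] by (simp add: distrib_right)
next
  case (monomial c i j)
  have "integrable (dunkl_measure k) (\<lambda>p. (c * of_real x ^ i) * (dunkl_kernel k (x * p) * (of_real p ^ j * dunkl_transform k f p)))"
    by (intro integrable_mult_right integrable_kernel_mult schwartz_mult_x_power schwartz_dunkl_transform k f)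
  then show ?case by (simp add: mult_ac)
qed simp

lemma Op_add:
  assumes k: "k \<ge> 0" and f: "f \<in> schwartz" and a: "has_bidegree a m n" and b: "has_bidegree b m' n'"
  shows "Op k (\<lambda>z. a z + b z) f x = Op k a f x + Op k b f x"
  unfolding Op_eq[OF k] distrib_right
  by (rule Bochner_Integration.integral_add) (rule integrable_Op[OF k f a] integrable_Op[OF k f b])+

lemma Op_zero: "Op k (\<lambda>_. 0) f x = 0"
  by (simp add: Op_def)

lemma Op_lincomb:
  assumes k: "k \<ge> 0" and f: "f \<in> schwartz" and g: "g \<in> schwartz" and a: "has_bidegree a m n"
  shows "Op k a (\<lambda>x. c * f x + d * g x) x = c * Op k a f x + d * Op k a g x"
proof -
  note i = integrable_Op[OF k f a, of x] integrable_Op[OF k g a, of x]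
  have "Op k a (\<lambda>x. c * f x + d * g x) x =
    (LINT p|dunkl_measure k. c * (a (x, p) * dunkl_kernel k (p * x) * dunkl_transform k f p) +
       d * (a (x, p) * dunkl_kernel k (p * x) * dunkl_transform k g p))"
    unfolding Op_eq[OF k] dunkl_transform_lincomb[OF k f g] by (simp add: algebra_simps)
  also have "\<dots> = (LINT p|dunkl_measure k. c * (a (x, p) * dunkl_kernel k (p * x) * dunkl_transform k f p)) +
     (LINT p|dunkl_measure k. d * (a (x, p) * dunkl_kernel k (p * x) * dunkl_transform k g p))"
    by (rule Bochner_Integration.integral_add) (intro integrable_mult_right i)+
  finally show ?thesis unfolding Op_eq[OF k] by simp
qed

lemma schwartz_Op:
  assumes k: "k \<ge> 0" and f: "f \<in> schwartz" and a: "has_bidegree a m n"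
  shows "Op k a f \<in> schwartz"
  using a
proof (induction rule: has_bidegree_induct)
  case zero
  have "Op k (\<lambda>_. 0) f = (\<lambda>x. 0 * f x)" by (auto simp: Op_zero)
  then show ?case using schwartz_cmult[OF f, of 0] by simp
next
  case (add a b)
  have "Op k (\<lambda>z. a z + b z) f = (\<lambda>x. Op k a f x + Op k b f x)"
    by (rule ext) (rule Op_add[OF k f add(1,2)])
  then show ?case using schwartz_add[OF add(3,4)] by simp
next
  case (monomial c i j)
  have "Op k (\<lambda>(x, p). c * of_real x ^ i * of_real p ^ j) f = (\<lambda>x. c * (of_real x ^ i * (momentum k ^^ j) f x))"
    by (rule ext) (subst Op_monomial[OF k f], rule mult.assoc)
  then show ?case
    by (simp only:) (intro schwartz_cmult schwartz_mult_x_power schwartz_funpow_momentum f)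
qed

lemma schwartz_gamma_hat: "f \<in> schwartz \<Longrightarrow> gamma_hat f \<in> schwartz"
  unfolding gamma_hat_def[abs_def] by (rule schwartz_reflect)

subsection \<open>Commuting the momentum past a symbol\<close>

lemma momentum_gamma_hat:
  assumes "f \<in> schwartz"
  shows "momentum k (gamma_hat f) = (\<lambda>x. - gamma_hat (momentum k f) x)"
proof
  fix x
  have v: "vderiv (gamma_hat f) x = - vderiv f (- x)" for x
    unfolding gamma_hat_def[abs_def]
    by (rule vector_derivative_at[OF has_vector_derivative_reflect[OF schwartz_has_vector_derivative[OF assms]]])
  show "momentum k (gamma_hat f) x = - gamma_hat (momentum k f) x"
    unfolding momentum_def dunkl_T_def v unfolding gamma_hat_def
    by (cases "x = 0") (simp_all add: algebra_simps)
qed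

lemma momentum_lincomb:
  assumes f: "f \<in> schwartz" and g: "g \<in> schwartz"
  shows "momentum k (\<lambda>x. a * f x + b * g x) = (\<lambda>x. a * momentum k f x + b * momentum k g x)"
proof
  fix x
  have v: "vderiv (\<lambda>x. a * f x + b * g x) x = a * vderiv f x + b * vderiv g x" for x
    by (rule vector_derivative_at[OF has_vector_derivative_add[OF
        has_vector_derivative_mult_right[OF schwartz_has_vector_derivative[OF f]]
        has_vector_derivative_mult_right[OF schwartz_has_vector_derivative[OF g]]]])
  show "momentum k (\<lambda>x. a * f x + b * g x) x = a * momentum k f x + b * momentum k g x"
    unfolding momentum_def dunkl_T_def v
    by (cases "x = 0") (simp_all add: algebra_simps add_divide_distrib diff_divide_distrib)
qed

lemma funpow_momentum_gamma_hat:
  assumes f: "f \<in> schwartz"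
  shows "(momentum k ^^ n) (gamma_hat f) x = (- 1) ^ n * (momentum k ^^ n) f (- x)"
proof (induction n arbitrary: x)
  case 0
  then show ?case by (simp add: gamma_hat_def)
next
  case (Suc n)
  define g where "g = (momentum k ^^ n) f"
  have g: "g \<in> schwartz" unfolding g_def by (rule schwartz_funpow_momentum[OF f])
  have "(momentum k ^^ n) (gamma_hat f) = (\<lambda>x. (- 1) ^ n * gamma_hat g x + 0 * g x)"
    by (rule ext) (simp only: Suc, simp add: g_def gamma_hat_def)
  then have "(momentum k ^^ Suc n) (gamma_hat f) x = momentum k (\<lambda>x. (- 1) ^ n * gamma_hat g x + 0 * g x) x"
    by simp
  also have "\<dots> = (- 1) ^ Suc n * momentum k g (- x)"
    unfolding momentum_lincomb[OF schwartz_gamma_hat[OF g] g] momentum_gamma_hat[OF g] by (simp add: gamma_hat_def)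
  finally show ?case by (simp add: g_def)
qed

lemma dunkl_T_mult_x_power:
  assumes g: "g \<in> schwartz"
  shows "dunkl_T k (\<lambda>x. of_real x ^ m * g x) x =
    of_real x ^ m * dunkl_T k g x + of_nat m * of_real x ^ (m - 1) * g x +
      of_real k * ((1 - (- 1) ^ m) * of_real x ^ (m - 1) * g (- x))"
proof -
  have v: "vderiv (\<lambda>x. of_real x ^ m * g x) x = of_real x ^ m * vderiv g x + of_nat m * of_real x ^ (m - 1) * g x" for x
  proof (rule vector_derivative_at)
    have "((\<lambda>t. of_real t ^ m) has_vector_derivative (of_nat m * of_real x ^ (m - 1) :: complex)) (at x)"
      using has_vector_derivative_of_real_power[of 1 m 1 x] by simp
    from has_vector_derivative_mult[OF this schwartz_has_vector_derivative[OF g]]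
    show "((\<lambda>x. of_real x ^ m * g x) has_vector_derivative of_real x ^ m * vderiv g x + of_nat m * of_real x ^ (m - 1) * g x) (at x)" .
  qed
  show ?thesis
  proof (cases "x = 0")
    case True
    have "m = 0 \<or> m = 1 \<or> (\<exists>n. m = Suc (Suc n))" by presburger
    then consider "m = 0" | "m = 1" | n where "m = Suc (Suc n)" by blast
    then show ?thesis
      unfolding dunkl_T_def v if_P[OF True] True by cases (simp_all add: ring_distribs)
  next
    case False
    define X where "X = complex_of_real x"
    have X: "X \<noteq> 0" using False by (simp add: X_def)
    have s: "complex_of_real (- x) ^ m = (- 1) ^ m * X ^ m" unfolding X_def of_real_minus by (rule power_minus)
    have r: "(X ^ m * a - (- 1) ^ m * X ^ m * b) / X = X ^ m * ((a - b) / X) + (1 - (- 1) ^ m) * X ^ (m - 1) * b" for a b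
    proof (cases m)
      case (Suc n)
      define P \<sigma> where "P = X ^ n" and "\<sigma> = (- 1 :: complex) ^ m"
      have m: "X ^ m = X * P" "X ^ (m - 1) = P" using Suc by (simp_all add: P_def)
      have "X * P * a - \<sigma> * (X * P) * b = X * (P * (a - \<sigma> * b))" by (simp add: algebra_simps)
      then have "(X * P * a - \<sigma> * (X * P) * b) / X = P * (a - \<sigma> * b)"
        unfolding \<open>X * P * a - \<sigma> * (X * P) * b = X * (P * (a - \<sigma> * b))\<close>
        by (intro nonzero_mult_div_cancel_left X)
      also have "\<dots> = P * (a - b) + (1 - \<sigma>) * P * b" by (simp add: algebra_simps)
      also have "P * (a - b) = X * (P * (a - b)) / X" by (rule nonzero_mult_div_cancel_left[OF X, symmetric])
      also have "\<dots> = X * P * ((a - b) / X)" by (simp only: times_divide_eq_right mult.assoc)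
      finally show ?thesis unfolding m \<sigma>_def[symmetric] .
    qed simp
    show ?thesis
      unfolding dunkl_T_def v s X_def[symmetric] if_not_P[OF False] r
      by (simp only: distrib_left mult.left_commute[of "of_real k"] mult.assoc add_ac)
  qed
qed

lemma symbol_R_monomial:
  "symbol_R (\<lambda>(x, p). c * of_real x ^ m * of_real p ^ n) =
    (\<lambda>(x, p). (- \<i> * c * (1 - (- 1) ^ m) * (- 1) ^ n) * of_real x ^ (m - 1) * of_real p ^ n)"
  (is "symbol_R ?a = ?b")
proof -
  have a: "?a \<in> C_infinity"
    by (rule has_bidegree_C_infinity[OF has_bidegree_monomial[OF order_refl order_refl]])
  have b: "?b \<in> C_infinity"
    by (rule has_bidegree_C_infinity[OF has_bidegree_monomial[OF order_refl order_refl]])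
  have "(\<lambda>z. symbol_R ?a (snd z, fst z)) = (\<lambda>z. ?b (snd z, fst z))"
  proof (rule C_infinity_eqI_off_axis)
    show "continuous_on UNIV (\<lambda>z. symbol_R ?a (snd z, fst z))"
      by (rule continuous_on_compose2[OF C_infinity_continuous[OF C_infinity_symbol_R[OF a], of UNIV]])
        (auto intro!: continuous_intros)
    show "continuous_on UNIV (\<lambda>z. ?b (snd z, fst z))"
      by (rule continuous_on_compose2[OF C_infinity_continuous[OF b, of UNIV]]) (auto intro!: continuous_intros)
    fix p x :: real assume x: "x \<noteq> 0"
    have "of_real x * symbol_R ?a (x, p) = - \<i> * (?a (x, - p) - ?a (- x, - p))"
      by (rule mult_x_symbol_R[OF a])
    also have "\<dots> = - \<i> * c * (1 - (- 1) ^ m) * (- 1) ^ n * (of_real x ^ m * of_real p ^ n)"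
      by (simp add: power_minus[of "complex_of_real p"] power_minus[of "complex_of_real x"] algebra_simps)
    also have "\<dots> = of_real x * ?b (x, p)"
      by (cases m) (simp_all add: algebra_simps)
    finally have eq: "of_real x * symbol_R ?a (x, p) = of_real x * ?b (x, p)" .
    have nz: "complex_of_real x \<noteq> 0" using x by simp
    have "symbol_R ?a (x, p) = ?b (x, p)" using eq unfolding mult_left_cancel[OF nz] .
    then show "symbol_R ?a (snd (p, x), fst (p, x)) = ?b (snd (p, x), fst (p, x))"
      unfolding fst_conv snd_conv .
  qed
  from fun_cong[OF this] have "symbol_R ?a (snd z, fst z) = ?b (snd z, fst z)" for z .
  from this[of "(p, x)" for p x] have "symbol_R ?a (x, p) = ?b (x, p)" for x p
    unfolding fst_conv snd_conv .
  then show ?thesis by (intro ext) (simp only: split_paired_all)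
qed

lemma symbol_D_monomial:
  "symbol_D (\<lambda>(x, p). c * of_real x ^ m * of_real p ^ n) =
    (\<lambda>(x, p). (- \<i> * c * of_nat m) * of_real x ^ (m - 1) * of_real p ^ n)"
proof -
  have "partial_x (\<lambda>(x, p). c * of_real x ^ m * of_real p ^ n) = (\<lambda>(x, p). c * of_nat m * of_real x ^ (m - 1) * of_real p ^ n)"
    by (rule partial_x_eqI) (auto intro: has_vector_derivative_of_real_power[unfolded One_nat_def])
  then show ?thesis by (auto simp: symbol_D_def)
qed

lemma mult_p_monomial:
  "mult_p (\<lambda>(x, p). c * of_real x ^ m * of_real p ^ n) = (\<lambda>(x, p). c * of_real x ^ m * of_real p ^ Suc n)"
  by (auto simp: mult_p_def)

lemma mult_p_add: "mult_p (\<lambda>z. a z + b z) = (\<lambda>z. mult_p a z + mult_p b z)"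
  by (simp add: mult_p_def distrib_left)

lemma has_bidegree_mult_p:
  assumes "has_bidegree a m n"
  shows "has_bidegree (mult_p a) m (n + 1)"
proof -
  have "has_bidegree (\<lambda>(x, p). 1 * of_real x ^ 0 * of_real p ^ 1) 0 1"
    by (rule has_bidegree_monomial) auto
  from has_bidegree_mult[OF this assms] have "has_bidegree (mult_p a) (0 + m) (1 + n)"
    by (simp add: mult_p_def case_prod_unfold)
  then show ?thesis unfolding add_0 add.commute[of 1 n] .
qed

text \<open>Both sides are linear in the symbol; on monomials this is the product rule \<open>dunkl_T_mult_x_power\<close>, where the reflected term carries a power of \<open>P\<close> past \<open>\<gamma>\<close> and thereby replaces \<open>p\<close> by \<open>- p\<close>.\<close>

lemma momentum_Op:
  assumes k: "k \<ge> 0" and f: "f \<in> schwartz" and a: "has_bidegree a m n"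
  shows "momentum k (Op k a f) x = Op k (mult_p a) f x + Op k (symbol_D a) f x + of_real k * Op k (symbol_R a) (gamma_hat f) x"
  using a
proof (induction rule: has_bidegree_induct)
  case zero
  have z: "Op k (\<lambda>_. 0) f = (\<lambda>x. 0 * f x + 0 * f x)" by (auto simp: Op_zero)
  have "mult_p (\<lambda>_. 0) = (\<lambda>_. 0)" "symbol_D (\<lambda>_. 0) = (\<lambda>_. 0)" "symbol_R (\<lambda>_. 0) = (\<lambda>_. 0)"
    by (auto simp: mult_p_def symbol_D_def symbol_R_def partial_x_zero average_def)
  then show ?case unfolding z momentum_lincomb[OF f f] by (simp add: Op_zero)
next
  case (add a b)
  have Ca: "a \<in> C_infinity" "b \<in> C_infinity" using add(1,2) by (auto intro: has_bidegree_C_infinity)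
  have D: "symbol_D (\<lambda>z. a z + b z) = (\<lambda>z. symbol_D a z + symbol_D b z)"
    using symbol_D_lincomb[OF Ca, of 1 1] by simp
  have R: "symbol_R (\<lambda>z. a z + b z) = (\<lambda>z. symbol_R a z + symbol_R b z)"
    using symbol_R_lincomb[OF Ca, of 1 1] by simp
  have "Op k (\<lambda>z. a z + b z) f = (\<lambda>x. 1 * Op k a f x + 1 * Op k b f x)"
    by (rule ext) (simp only: Op_add[OF k f add(1,2)] mult_1)
  then have "momentum k (Op k (\<lambda>z. a z + b z) f) x = momentum k (\<lambda>x. 1 * Op k a f x + 1 * Op k b f x) x"
    by (rule arg_cong[where f = "\<lambda>g. momentum k g x"])
  also have "\<dots> = 1 * momentum k (Op k a f) x + 1 * momentum k (Op k b f) x"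
    by (rule fun_cong[OF momentum_lincomb[OF schwartz_Op[OF k f add(1)] schwartz_Op[OF k f add(2)]]])
  finally have e: "momentum k (Op k (\<lambda>z. a z + b z) f) x = momentum k (Op k a f) x + momentum k (Op k b f) x"
    unfolding mult_1 .
  show ?case
    unfolding e mult_p_add D R add(3,4)
      Op_add[OF k f has_bidegree_mult_p[OF add(1)] has_bidegree_mult_p[OF add(2)]]
      Op_add[OF k f has_bidegree_symbol_D[OF add(1)] has_bidegree_symbol_D[OF add(2)]]
      Op_add[OF k schwartz_gamma_hat[OF f] has_bidegree_symbol_R[OF add(1)] has_bidegree_symbol_R[OF add(2)]]
    by (simp add: distrib_left)
next
  case (monomial c i j)
  define g where "g = (momentum k ^^ j) f"
  have g: "g \<in> schwartz" unfolding g_def by (rule schwartz_funpow_momentum[OF f])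
  have xg: "(\<lambda>x. of_real x ^ i * g x) \<in> schwartz" by (rule schwartz_mult_x_power[OF g])
  have "Op k (\<lambda>(x, p). c * of_real x ^ i * of_real p ^ j) f = (\<lambda>x. c * (of_real x ^ i * g x) + 0 * g x)"
    by (rule ext) (simp add: Op_monomial[OF k f] g_def)
  then have "momentum k (Op k (\<lambda>(x, p). c * of_real x ^ i * of_real p ^ j) f) x = c * momentum k (\<lambda>x. of_real x ^ i * g x) x"
    by (simp only: momentum_lincomb[OF xg g]) simp
  also have "\<dots> = c * of_real x ^ i * momentum k g x + (- \<i> * c * of_nat i) * of_real x ^ (i - 1) * g x +
     of_real k * ((- \<i> * c * (1 - (- 1) ^ i)) * of_real x ^ (i - 1) * g (- x))"
    unfolding momentum_def dunkl_T_mult_x_power[OF g] by (simp add: algebra_simps)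
  also have "g (- x) = (- 1) ^ j * (momentum k ^^ j) (gamma_hat f) x"
    unfolding funpow_momentum_gamma_hat[OF f] g_def by (simp flip: mult.assoc power_mult_distrib)
  also have "momentum k g x = (momentum k ^^ Suc j) f x" by (simp add: g_def)
  finally show ?case
    unfolding mult_p_monomial symbol_D_monomial symbol_R_monomial Op_monomial[OF k f] Op_monomial[OF k schwartz_gamma_hat[OF f]]
    by (simp add: g_def mult_ac)
qed

section \<open>The composition formula\<close>

text \<open>The operator contributed by all words of length \<open>j\<close>.\<close>

definition star_level :: "real \<Rightarrow> nat \<Rightarrow> (real \<times> real \<Rightarrow> complex) \<Rightarrow> (real \<times> real \<Rightarrow> complex) \<Rightarrow> (real \<Rightarrow> complex) \<Rightarrow> real \<Rightarrow> complex" where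
  "star_level k j a1 a2 f x = (\<Sum>l\<le>j. of_real k ^ l * Op k (star j l 0 0 a1 a2) ((gamma_hat ^^ l) f) x)"

lemma schwartz_funpow_gamma_hat: "f \<in> schwartz \<Longrightarrow> (gamma_hat ^^ l) f \<in> schwartz"
  by (induction l) (auto intro: schwartz_gamma_hat)

lemma star_level_mult_p_0:
  assumes "has_bidegree a1 m1 n1" "has_bidegree a2 m2 n2"
  shows "star_level k 0 (mult_p a1) a2 f x = star_level k 0 a1 (mult_p a2) f x"
  unfolding star_level_def
  by (simp add: star_shift_0[OF has_bidegree_C_infinity[OF assms(1)] has_bidegree_C_infinity[OF assms(2)]] del: star.simps)

text \<open>This is \<open>star_shift_Suc\<close> after quantisation. The last two terms collect, as in \<open>momentum_Op\<close>, the contributions of a momentum that acts on the second symbol.\<close>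

lemma star_level_mult_p_Suc:
  assumes k: "k \<ge> 0" and f: "f \<in> schwartz" and a1: "has_bidegree a1 m1 n1" and a2: "has_bidegree a2 m2 n2"
  shows "star_level k (Suc j) (mult_p a1) a2 f x =
    star_level k (Suc j) a1 (mult_p a2) f x + star_level k j a1 (symbol_D a2) f x
      + of_real k * star_level k j a1 (symbol_R a2) (gamma_hat f) x"
proof -
  note fl = schwartz_funpow_gamma_hat[OF f]
  note bP = has_bidegree_star[OF a1 has_bidegree_mult_p[OF a2], of "Suc j" _ 0 0]
  note bD = has_bidegree_star[OF a1 has_bidegree_symbol_D[OF a2], of j _ 0 0]
  note bR = has_bidegree_star[OF a1 has_bidegree_symbol_R[OF a2], of j _ 0 0]
  have R0: "has_bidegree (\<lambda>z. if l = 0 then 0 else star j (l - 1) 0 0 a1 (symbol_R a2) z)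
      (m1 + (m2 - 1) - int j) (n1 + n2 - int 0 - int 0 - int j)" for l
    by (cases "l = 0") (use bR has_bidegree_zero in auto)
  have PD: "has_bidegree (\<lambda>z. star (Suc j) l 0 0 a1 (mult_p a2) z + star j l 0 0 a1 (symbol_D a2) z) (m1 + m2) (n1 + n2)" for l
  proof -
    have e: "has_bidegree h m n \<Longrightarrow> m \<le> m' \<Longrightarrow> n \<le> n' \<Longrightarrow> has_bidegree h m' n'" for h m n m' n'
    proof (induction rule: has_bidegree_induct)
      case (monomial c i j)
      then show ?case by (intro has_bidegree_monomial) auto
    qed (auto intro: has_bidegree_zero has_bidegree_add)
    show ?thesis by (intro has_bidegree_add e[OF bP] e[OF bD]) auto
  qed
  have summand: "Op k (star (Suc j) l 0 0 (mult_p a1) a2) ((gamma_hat ^^ l) f) x =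
     Op k (star (Suc j) l 0 0 a1 (mult_p a2)) ((gamma_hat ^^ l) f) x + Op k (star j l 0 0 a1 (symbol_D a2)) ((gamma_hat ^^ l) f) x
     + (if l = 0 then 0 else Op k (star j (l - 1) 0 0 a1 (symbol_R a2)) ((gamma_hat ^^ l) f) x)" for l
    unfolding star_shift_Suc[OF has_bidegree_C_infinity[OF a1] has_bidegree_C_infinity[OF a2]]
      Op_add[OF k fl PD R0] Op_add[OF k fl bP bD]
    by (cases "l = 0") (simp_all add: Op_zero)
  have "star_level k (Suc j) (mult_p a1) a2 f x = star_level k (Suc j) a1 (mult_p a2) f x
      + (\<Sum>l\<le>Suc j. of_real k ^ l * Op k (star j l 0 0 a1 (symbol_D a2)) ((gamma_hat ^^ l) f) x)
      + (\<Sum>l\<le>Suc j. of_real k ^ l * (if l = 0 then 0 else Op k (star j (l - 1) 0 0 a1 (symbol_R a2)) ((gamma_hat ^^ l) f) x))"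
    unfolding star_level_def summand distrib_left sum.distrib ..
  also have "(\<Sum>l\<le>Suc j. of_real k ^ l * Op k (star j l 0 0 a1 (symbol_D a2)) ((gamma_hat ^^ l) f) x) = star_level k j a1 (symbol_D a2) f x"
    unfolding star_level_def sum.atMost_Suc using star_eq_0[of j "Suc j" 0 0 a1 "symbol_D a2"] by (simp add: Op_zero)
  also have "(\<Sum>l\<le>Suc j. of_real k ^ l * (if l = 0 then 0 else Op k (star j (l - 1) 0 0 a1 (symbol_R a2)) ((gamma_hat ^^ l) f) x))
     = of_real k * star_level k j a1 (symbol_R a2) (gamma_hat f) x"
    unfolding star_level_def sum.atMost_Suc_shift sum_distrib_left
    by (simp add: funpow_Suc_right mult.assoc del: funpow.simps)
  finally show ?thesis .
qed

lemma star_level_eq_0: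
  assumes "has_bidegree a1 m1 n1" "has_bidegree a2 m2 n2" "int j > m1 + m2"
  shows "star_level k j a1 a2 f x = 0"
proof -
  have "star j l 0 0 a1 a2 = (\<lambda>_. 0)" for l
    by (rule has_bidegree_zeroD[OF has_bidegree_star[OF assms(1,2)]]) (use assms(3) in simp)
  then show ?thesis by (simp add: star_level_def Op_zero)
qed

lemma Op_monomial_Suc:
  assumes k: "k \<ge> 0" and h: "h \<in> schwartz"
  shows "Op k (mult_p (\<lambda>(x, p). c * of_real x ^ m * of_real p ^ n)) h x =
    Op k (\<lambda>(x, p). c * of_real x ^ m * of_real p ^ n) (momentum k h) x"
  unfolding mult_p_monomial Op_monomial[OF k h] Op_monomial[OF k schwartz_momentum[OF h]]
  by (simp add: funpow_Suc_right del: funpow.simps)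

text \<open>By induction on \<open>n\<close>: one factor \<open>P\<close> of the left operator is applied to \<open>Op k a2\<close>, and \<open>star_level_mult_p_Suc\<close> matches the resulting three terms. The bound \<open>J\<close> only has to reach the total degree in \<open>x\<close>, which no step of the induction raises.\<close>

lemma Op_Op_monomial:
  assumes k: "k \<ge> 0"
  shows "f \<in> schwartz \<Longrightarrow> has_bidegree a2 m2 n2 \<Longrightarrow> int J \<ge> int m + m2 \<Longrightarrow>
    Op k (\<lambda>(x, p). c * of_real x ^ m * of_real p ^ n) (Op k a2 f) x =
      (\<Sum>j\<le>J. star_level k j (\<lambda>(x, p). c * of_real x ^ m * of_real p ^ n) a2 f x)"
proof (induction n arbitrary: f a2 m2 n2 J x)
  case 0
  let ?a = "\<lambda>(x, p::real). c * complex_of_real x ^ m * of_real p ^ 0"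
  have C: "?a \<in> C_infinity" by (rule has_bidegree_C_infinity[OF has_bidegree_monomial[OF order_refl order_refl]])
  have dp: "partial_p ?a = (\<lambda>_. 0)" by (rule partial_p_eqI) simp
  have "star_level k j ?a a2 f x = 0" if "j > 0" for j
    using star_eq_0_of_no_p[OF C dp, of 0 0 j] that by (simp add: star_level_def Op_zero)
  then have "(\<Sum>j\<le>J. star_level k j ?a a2 f x) = (\<Sum>j\<in>{0}. star_level k j ?a a2 f x)"
    by (intro sum.mono_neutral_right) auto
  also have "\<dots> = Op k (\<lambda>z. divdiff (Suc 0) 0 ?a z * a2 z) f x"
    by (simp add: star_level_def)
  also have "(\<lambda>z. divdiff (Suc 0) 0 ?a z * a2 z) = (\<lambda>z. c * of_real (fst z) ^ m * a2 z)"
    by (auto simp: case_prod_unfold)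
  also have "Op k (\<lambda>z. c * of_real (fst z) ^ m * a2 z) f x = c * of_real x ^ m * Op k a2 f x"
    unfolding Op_def by (simp add: mult.assoc)
  finally show ?case
    using Op_monomial[OF k schwartz_Op[OF k 0(1,2)], of c m 0 x] by simp
next
  case (Suc n)
  define a1 where "a1 = (\<lambda>(x, p). c * complex_of_real x ^ m * of_real p ^ n)"
  have a1: "has_bidegree a1 (int m) (int n)" unfolding a1_def by (rule has_bidegree_monomial) auto
  have a1_Suc: "(\<lambda>(x, p). c * complex_of_real x ^ m * of_real p ^ Suc n) = mult_p a1"
    unfolding a1_def mult_p_monomial ..
  note f = Suc.prems(1) and a2 = Suc.prems(2)
  have gf: "gamma_hat f \<in> schwartz" by (rule schwartz_gamma_hat[OF f])
  note bP = has_bidegree_mult_p[OF a2] and bD = has_bidegree_symbol_D[OF a2] and bR = has_bidegree_symbol_R[OF a2]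
  note sP = schwartz_Op[OF k f bP] and sD = schwartz_Op[OF k f bD] and sR = schwartz_Op[OF k gf bR]
  have IH: "Op k a1 (Op k b g) x = (\<Sum>j\<le>J'. star_level k j a1 b g x)"
    if "g \<in> schwartz" "has_bidegree b m' n'" "int J' \<ge> int m + m'" for g b m' n' J'
    using Suc.IH[OF that] unfolding a1_def .
  have mom: "momentum k (Op k a2 f) = (\<lambda>x. 1 * (1 * Op k (mult_p a2) f x + 1 * Op k (symbol_D a2) f x) + of_real k * Op k (symbol_R a2) (gamma_hat f) x)"
    by (rule ext) (simp only: momentum_Op[OF k f a2] mult_1)
  have "Op k (mult_p a1) (Op k a2 f) x = Op k a1 (momentum k (Op k a2 f)) x"
    unfolding a1_def by (rule Op_monomial_Suc[OF k schwartz_Op[OF k f a2]])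
  also have "\<dots> = Op k a1 (Op k (mult_p a2) f) x + Op k a1 (Op k (symbol_D a2) f) x + of_real k * Op k a1 (Op k (symbol_R a2) (gamma_hat f)) x"
    unfolding mom Op_lincomb[OF k schwartz_lincomb[OF sP sD] sR a1] Op_lincomb[OF k sP sD a1] by simp
  also have "\<dots> = (\<Sum>j\<le>Suc J. star_level k j a1 (mult_p a2) f x) + (\<Sum>j\<le>J. star_level k j a1 (symbol_D a2) f x)
      + of_real k * (\<Sum>j\<le>J. star_level k j a1 (symbol_R a2) (gamma_hat f) x)"
    using Suc.prems(3) by (subst IH[OF f bP, of "Suc J"], simp, subst IH[OF f bD, of J], simp, subst IH[OF gf bR, of J], simp) simp
  also have "\<dots> = star_level k 0 a1 (mult_p a2) f x + (\<Sum>j\<le>J. star_level k (Suc j) a1 (mult_p a2) f x + star_level k j a1 (symbol_D a2) f x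
      + of_real k * star_level k j a1 (symbol_R a2) (gamma_hat f) x)"
    unfolding sum.atMost_Suc_shift sum.distrib sum_distrib_left by simp
  also have "\<dots> = (\<Sum>j\<le>Suc J. star_level k j (mult_p a1) a2 f x)"
    unfolding sum.atMost_Suc_shift star_level_mult_p_0[OF a1 a2] star_level_mult_p_Suc[OF k f a1 a2] ..
  also have "\<dots> = (\<Sum>j\<le>J. star_level k j (mult_p a1) a2 f x)"
    using star_level_eq_0[OF has_bidegree_mult_p[OF a1] a2, of "Suc J"] Suc.prems(3) by simp
  finally show ?case unfolding a1_Suc .
qed

lemma Op_Op:
  assumes k: "k \<ge> 0" and f: "f \<in> schwartz" and a1: "has_bidegree a1 m1 n1" and a2: "has_bidegree a2 m2 n2"
    and J: "int J \<ge> m1 + m2"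
  shows "Op k a1 (Op k a2 f) x = (\<Sum>j\<le>J. star_level k j a1 a2 f x)"
  using a1
proof (induction rule: has_bidegree_induct)
  case zero
  have "star j l 0 0 (\<lambda>_. 0) a2 = (\<lambda>_. 0)" for j l
    using star_lincomb_left[OF C_infinity_const C_infinity_const, of j l 0 0 0 0 0 0 a2] by simp
  then show ?case by (simp add: star_level_def Op_zero)
next
  case (add a b)
  have C: "a \<in> C_infinity" "b \<in> C_infinity" using add(1,2) by (auto intro: has_bidegree_C_infinity)
  have star: "star j l 0 0 (\<lambda>z. a z + b z) a2 = (\<lambda>z. star j l 0 0 a a2 z + star j l 0 0 b a2 z)" for j l
    using star_lincomb_left[OF C, of j l 0 0 1 1 a2] by simp
  have "star_level k j (\<lambda>z. a z + b z) a2 f x = star_level k j a a2 f x + star_level k j b a2 f x" for j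
    unfolding star_level_def star
      Op_add[OF k schwartz_funpow_gamma_hat[OF f] has_bidegree_star[OF add(1) a2] has_bidegree_star[OF add(2) a2]]
      distrib_left sum.distrib ..
  then show ?case
    unfolding Op_add[OF k schwartz_Op[OF k f a2] add(1,2)] add(3,4) by (simp add: sum.distrib)
next
  case (monomial c i j)
  show ?case by (rule Op_Op_monomial[OF k f a2]) (use monomial J in simp)
qed

theorem theorem3p10:
  shows "\<exists>(C0 :: nat \<Rightarrow> nat \<Rightarrow> bioperator) (C1 :: nat \<Rightarrow> nat \<Rightarrow> bioperator).
    (\<forall>j l. bilinear_operator (C0 j l) \<and> gamma_local (C0 j l) \<and>
           bilinear_operator (C1 j l) \<and> gamma_local (C1 j l)) \<and>
    (\<forall>j l a1 a2 m1 n1 m2 n2. has_bidegree a1 m1 n1 \<and> has_bidegree a2 m2 n2 \<longrightarrow>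
       has_bidegree (C0 j l a1 a2) (m1 + m2 - int j) (n1 + n2 - int j) \<and>
       has_bidegree (C1 j l a1 a2) (m1 + m2 - int j) (n1 + n2 - int j)) \<and>
    (\<forall>j l. l > j \<longrightarrow> (\<forall>f\<in>C_infinity. \<forall>g\<in>C_infinity.
       C0 j l f g = (\<lambda>_. 0) \<and> C1 j l f g = (\<lambda>_. 0))) \<and>
    (\<forall>a1\<in>Poly2. \<forall>a2\<in>Poly2.
       finite {(j, l). C0 j l a1 a2 \<noteq> (\<lambda>_. 0) \<or> C1 j l a1 a2 \<noteq> (\<lambda>_. 0)} \<and>
       (\<forall>k\<ge>0. \<forall>f\<in>schwartz. \<forall>x.
          (Op k a1 \<circ> Op k a2) f x =
          (\<Sum>(j, l) | C0 j l a1 a2 \<noteq> (\<lambda>_. 0) \<or> C1 j l a1 a2 \<noteq> (\<lambda>_. 0).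
             of_real k ^ l *
             (Op k (C0 j l a1 a2) f x + (Op k (C1 j l a1 a2) \<circ> gamma_hat) f x))))"
proof -
  define Z :: bioperator where "Z = (\<lambda>f g _. 0)"
  have Z: "bilinear_operator Z" "gamma_local Z"
    by (auto simp: Z_def bilinear_operator_def gamma_local_def C_infinity_const)
  define C0 :: "nat \<Rightarrow> nat \<Rightarrow> bioperator" where "C0 = (\<lambda>j l. if even l then star j l 0 0 else Z)"
  define C1 :: "nat \<Rightarrow> nat \<Rightarrow> bioperator" where "C1 = (\<lambda>j l. if even l then Z else star j l 0 0)"
  have 1: "bilinear_operator (C0 j l) \<and> gamma_local (C0 j l) \<and> bilinear_operator (C1 j l) \<and> gamma_local (C1 j l)" for j l
    by (auto simp: C0_def C1_def Z bilinear_operator_star gamma_local_star)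
  have 2: "has_bidegree (C0 j l a1 a2) (m1 + m2 - int j) (n1 + n2 - int j) \<and>
      has_bidegree (C1 j l a1 a2) (m1 + m2 - int j) (n1 + n2 - int j)"
    if "has_bidegree a1 m1 n1" "has_bidegree a2 m2 n2" for j l a1 a2 m1 n1 m2 n2
    using has_bidegree_star[OF that, of j l 0 0] by (auto simp: C0_def C1_def Z_def has_bidegree_zero)
  have 3: "C0 j l f g = (\<lambda>_. 0) \<and> C1 j l f g = (\<lambda>_. 0)" if "l > j" for j l f g
    using star_eq_0[OF that] by (auto simp: C0_def C1_def Z_def)
  have 4: "finite {(j, l). C0 j l a1 a2 \<noteq> (\<lambda>_. 0) \<or> C1 j l a1 a2 \<noteq> (\<lambda>_. 0)} \<and>
       (\<forall>k\<ge>0. \<forall>f\<in>schwartz. \<forall>x.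
          (Op k a1 \<circ> Op k a2) f x =
          (\<Sum>(j, l) | C0 j l a1 a2 \<noteq> (\<lambda>_. 0) \<or> C1 j l a1 a2 \<noteq> (\<lambda>_. 0).
             of_real k ^ l *
             (Op k (C0 j l a1 a2) f x + (Op k (C1 j l a1 a2) \<circ> gamma_hat) f x)))"
    if "a1 \<in> Poly2" "a2 \<in> Poly2" for a1 a2
  proof -
    from \<open>a1 \<in> Poly2\<close> obtain m1 n1 where a1: "has_bidegree a1 m1 n1" unfolding Poly2_def by blast
    from \<open>a2 \<in> Poly2\<close> obtain m2 n2 where a2: "has_bidegree a2 m2 n2" unfolding Poly2_def by blast
    note a = a1 a2
    define J where "J = nat (m1 + m2)"
    define S where "S = {(j, l). C0 j l a1 a2 \<noteq> (\<lambda>_. 0) \<or> C1 j l a1 a2 \<noteq> (\<lambda>_. 0)}"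
    have S: "S \<subseteq> (SIGMA j:{..J}. {..j})"
    proof (rule subrelI)
      fix j l assume "(j, l) \<in> S"
      then have ne: "C0 j l a1 a2 \<noteq> (\<lambda>_. 0) \<or> C1 j l a1 a2 \<noteq> (\<lambda>_. 0)" by (simp add: S_def)
      have "\<not> l > j" using 3[of j l a1 a2] ne by blast
      moreover have "\<not> m1 + m2 - int j < 0"
        using 2[OF a, of j l] has_bidegree_zeroD ne by blast
      ultimately show "(j, l) \<in> (SIGMA j:{..J}. {..j})" by (simp add: J_def)
    qed
    then have fin: "finite S" by (rule finite_subset) auto
    have "(Op k a1 \<circ> Op k a2) f x = (\<Sum>(j, l)\<in>S. of_real k ^ l * (Op k (C0 j l a1 a2) f x + (Op k (C1 j l a1 a2) \<circ> gamma_hat) f x))"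
      if k: "k \<ge> 0" and f: "f \<in> schwartz" for k f x
    proof -
      have gg: "(gamma_hat ^^ l) f = (if even l then f else gamma_hat f)" for l
        by (induction l) (auto simp: gamma_hat_def[abs_def])
      have summand: "of_real k ^ l * Op k (star j l 0 0 a1 a2) ((gamma_hat ^^ l) f) x =
        of_real k ^ l * (Op k (C0 j l a1 a2) f x + (Op k (C1 j l a1 a2) \<circ> gamma_hat) f x)" for j l
        by (auto simp: gg C0_def C1_def Z_def Op_zero)
      have "(Op k a1 \<circ> Op k a2) f x = (\<Sum>j\<le>J. star_level k j a1 a2 f x)"
        using Op_Op[OF k f a, of J] by (simp add: J_def)
      also have "\<dots> = (\<Sum>(j, l)\<in>(SIGMA j:{..J}. {..j}). of_real k ^ l * (Op k (C0 j l a1 a2) f x + (Op k (C1 j l a1 a2) \<circ> gamma_hat) f x))"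
        unfolding star_level_def summand by (rule sum.Sigma) auto
      also have "\<dots> = (\<Sum>(j, l)\<in>S. of_real k ^ l * (Op k (C0 j l a1 a2) f x + (Op k (C1 j l a1 a2) \<circ> gamma_hat) f x))"
        by (rule sum.mono_neutral_right[OF _ S]) (auto simp: S_def Op_zero)
      finally show ?thesis .
    qed
    then show ?thesis using fin unfolding S_def by blast
  qed
  show ?thesis
    by (rule exI[of _ C0], rule exI[of _ C1]) (use 1 2 3 4 in blast)
qed

end
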